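(* Let $G$ be an affine reductive algebraic group over $\mathbb C$, let $H$ be a finite central subgroup of $G$, and let $\Gamma$ be a finitely generated group. (1) The projection $G\to G/H$ induces an isomorphism $$\phi:\ Hom^0(\Gamma,G)/Hom'(\Gamma,H)\to Hom^0(\Gamma,G/H).$$ (2) Furthermore, $\phi$ descends to an isomorphism $$\psi:\ X^0_G(\Gamma)/Hom'(\Gamma,H)\to X^0_{G/H}(\Gamma).$$
   Context: For an affine reductive algebraic group $G$ over $\mathbb C$ and a group $\Gamma$ generated by $\gamma_1,\dots,\gamma_N$, $Hom(\Gamma,G)$ is viewed as an algebraic subset of $G^N$, on which $G$ acts by conjugation, and $X_G(\Gamma)=Hom(\Gamma,G)//G$ is the categorical quotient. $Hom^0(\Gamma,G)$ denotes the connected component of the trivial representation in $Hom(\Gamma,G)$, and $X^0_G(\Gamma)$ denotes its image in $X_G(\Gamma)$. The group $Hom(\Gamma,H)$ acts on $Hom(\Gamma,G)$ by multiplication, $(\sigma\cdot\rho)(\gamma)=\sigma(\gamma)\rho(\gamma)$, and $Hom'(\Gamma,H)$ is the set of elements of $Hom(\Gamma,H)$ which map $Hom^0(\Gamma,G)$ to itself. It acts on $Hom^0(\Gamma,G)$, and, since this action commutes with conjugation by $G$, also on $X^0_G(\Gamma)$. Since $Hom'(\Gamma,H)$ is finite, the quotients by it are both set-theoretic and categorical quotients. Isomorphisms are isomorphisms of algebraic sets. *)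

theory Defs
  imports "HOL-Algebra.Coset" "HOL-Algebra.Generated_Groups" "HOL-Analysis.Abstract_Topology_2"
begin

section \<open>Sets with regular functions and affine algebraic sets\<close>

text \<open>
  An algebraic set is represented by its set of points together with its ring of regular
  functions to the complex numbers. HOL functions are total, so every ring \<open>reg A\<close> constructed
  below is closed under changing a function outside \<open>pts A\<close>; a member of \<open>reg A\<close> is to be read
  as its restriction to \<open>pts A\<close>.
\<close>

record 'a fspace =
  pts :: "'a set"
  reg :: "('a \<Rightarrow> complex) set"

inductive_set generated_algebra :: "'a set \<Rightarrow> ('a \<Rightarrow> complex) set \<Rightarrow> ('a \<Rightarrow> complex) set"
  for S :: "'a set" and F :: "('a \<Rightarrow> complex) set" where
  base: "f \<in> F \<Longrightarrow> f \<in> generated_algebra S F"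
| const: "(\<lambda>x. c) \<in> generated_algebra S F"
| add: "f \<in> generated_algebra S F \<Longrightarrow> g \<in> generated_algebra S F \<Longrightarrow>
        (\<lambda>x. f x + g x) \<in> generated_algebra S F"
| mult: "f \<in> generated_algebra S F \<Longrightarrow> g \<in> generated_algebra S F \<Longrightarrow>
         (\<lambda>x. f x * g x) \<in> generated_algebra S F"
| cong: "f \<in> generated_algebra S F \<Longrightarrow> (\<And>x. x \<in> S \<Longrightarrow> g x = f x) \<Longrightarrow>
         g \<in> generated_algebra S F"

definition affine_space :: "nat \<Rightarrow> (nat \<Rightarrow> complex) fspace" where
  "affine_space n =
     \<lparr>pts = {..<n} \<rightarrow>\<^sub>E UNIV,
      reg = generated_algebra ({..<n} \<rightarrow>\<^sub>E UNIV) {(\<lambda>x. x i) | i. i < n}\<rparr>"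

text \<open>
  The coordinate ring of a product of affine algebraic sets is the tensor product of the
  coordinate rings of the factors, i.e. it is generated by the functions pulled back from the
  factors.
\<close>

definition prod_space :: "'a fspace \<Rightarrow> 'b fspace \<Rightarrow> ('a \<times> 'b) fspace" where
  "prod_space A B =
     \<lparr>pts = pts A \<times> pts B,
      reg = generated_algebra (pts A \<times> pts B)
              ({(\<lambda>z. f (fst z)) | f. f \<in> reg A} \<union> {(\<lambda>z. g (snd z)) | g. g \<in> reg B})\<rparr>"

definition power_space :: "nat \<Rightarrow> 'a fspace \<Rightarrow> (nat \<Rightarrow> 'a) fspace" where
  "power_space n A =
     \<lparr>pts = {..<n} \<rightarrow>\<^sub>E pts A,
      reg = generated_algebra ({..<n} \<rightarrow>\<^sub>E pts A) {(\<lambda>x. f (x i)) | f i. f \<in> reg A \<and> i < n}\<rparr>"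

text \<open>
  The structure on \<open>S\<close> obtained by identifying \<open>S\<close> with the subset \<open>e ` S\<close> of \<open>B\<close> (for \<open>e\<close>
  injective on \<open>S\<close>): regular functions are the restrictions of regular functions on \<open>B\<close>.
\<close>

definition induced_space :: "'a set \<Rightarrow> ('a \<Rightarrow> 'b) \<Rightarrow> 'b fspace \<Rightarrow> 'a fspace" where
  "induced_space S e B = \<lparr>pts = S, reg = {f. \<exists>g\<in>reg B. \<forall>x\<in>S. f x = g (e x)}\<rparr>"

definition subspace_of :: "'a fspace \<Rightarrow> 'a set \<Rightarrow> 'a fspace" where
  "subspace_of A S = induced_space S (\<lambda>x. x) A"

text \<open>
  The structure on the image of \<open>q\<close> whose regular functions are those which pull back to
  regular functions. For \<open>q\<close> the orbit map of a finite group acting on an affine algebraic set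
  this is the quotient, both set-theoretically and categorically.
\<close>

definition quotient_space :: "('a \<Rightarrow> 'b) \<Rightarrow> 'a fspace \<Rightarrow> 'b fspace" where
  "quotient_space q A = \<lparr>pts = q ` pts A, reg = {f. (\<lambda>x. f (q x)) \<in> reg A}\<rparr>"

definition orbit_of :: "'s set \<Rightarrow> ('s \<Rightarrow> 'a \<Rightarrow> 'a) \<Rightarrow> 'a \<Rightarrow> 'a set" where
  "orbit_of S act x = {act s x | s. s \<in> S}"

definition orbit_space :: "'s set \<Rightarrow> ('s \<Rightarrow> 'a \<Rightarrow> 'a) \<Rightarrow> 'a fspace \<Rightarrow> 'a set fspace" where
  "orbit_space S act A = quotient_space (orbit_of S act) A"

definition zariski :: "'a fspace \<Rightarrow> 'a topology" where
  "zariski A = topology_generated_by {{x \<in> pts A. f x \<noteq> 0} | f. f \<in> reg A}"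

definition affine_algebraic_set :: "'a fspace \<Rightarrow> bool" where
  "affine_algebraic_set A \<longleftrightarrow>
     (\<exists>n e. inj_on e (pts A) \<and> closedin (zariski (affine_space n)) (e ` pts A) \<and>
            A = induced_space (pts A) e (affine_space n))"

definition morphism :: "'a fspace \<Rightarrow> 'b fspace \<Rightarrow> ('a \<Rightarrow> 'b) \<Rightarrow> bool" where
  "morphism A B h \<longleftrightarrow> h \<in> pts A \<rightarrow> pts B \<and> (\<forall>f\<in>reg B. (\<lambda>x. f (h x)) \<in> reg A)"

definition isomorphism :: "'a fspace \<Rightarrow> 'b fspace \<Rightarrow> ('a \<Rightarrow> 'b) \<Rightarrow> bool" where
  "isomorphism A B h \<longleftrightarrow>
     morphism A B h \<and>
     (\<exists>k. morphism B A k \<and> (\<forall>x\<in>pts A. k (h x) = x) \<and> (\<forall>y\<in>pts B. h (k y) = y))"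

text \<open>
  Universal property, in the category of affine algebraic sets, of the quotient \<open>\<pi>\<close> from \<open>A\<close> to
  \<open>X\<close> by an action of the group with underlying set \<open>S\<close>. It suffices to test against closed
  subsets \<open>V\<close> of affine spaces, since every affine algebraic set is isomorphic to one of these.
\<close>

definition categorical_quotient ::
  "'s set \<Rightarrow> ('s \<Rightarrow> 'a \<Rightarrow> 'a) \<Rightarrow> 'a fspace \<Rightarrow> 'x fspace \<Rightarrow> ('a \<Rightarrow> 'x) \<Rightarrow> bool" where
  "categorical_quotient S act A X \<pi> \<longleftrightarrow>
     affine_algebraic_set X \<and> morphism A X \<pi> \<and>
     (\<forall>s\<in>S. \<forall>a\<in>pts A. \<pi> (act s a) = \<pi> a) \<and>
     (\<forall>n V f. closedin (zariski (affine_space n)) V \<and>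
              morphism A (subspace_of (affine_space n) V) f \<and>
              (\<forall>s\<in>S. \<forall>a\<in>pts A. f (act s a) = f a) \<longrightarrow>
        (\<exists>h. morphism X (subspace_of (affine_space n) V) h \<and> (\<forall>a\<in>pts A. h (\<pi> a) = f a) \<and>
             (\<forall>h'. morphism X (subspace_of (affine_space n) V) h' \<and>
                   (\<forall>a\<in>pts A. h' (\<pi> a) = f a) \<longrightarrow> (\<forall>x\<in>pts X. h' x = h x))))"


section \<open>Affine algebraic groups\<close>

definition affine_algebraic_group :: "'g monoid \<Rightarrow> 'g fspace \<Rightarrow> bool" where
  "affine_algebraic_group G A \<longleftrightarrow>
     group G \<and> pts A = carrier G \<and> affine_algebraic_set A \<and>
     morphism (prod_space A A) A (\<lambda>z. fst z \<otimes>\<^bsub>G\<^esub> snd z) \<and>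
     morphism A A (\<lambda>x. inv\<^bsub>G\<^esub> x)"

text \<open>
  An element \<open>u\<close> is unipotent iff right translation by \<open>u\<close> is a locally unipotent operator
  on the coordinate ring.
\<close>

definition unipotent_element :: "'g monoid \<Rightarrow> 'g fspace \<Rightarrow> 'g \<Rightarrow> bool" where
  "unipotent_element G A u \<longleftrightarrow>
     (\<forall>f\<in>reg A. \<exists>n. \<forall>x\<in>carrier G. ((\<lambda>g y. g (y \<otimes>\<^bsub>G\<^esub> u) - g y) ^^ n) f x = 0)"

text \<open>
  The unipotent radical is the largest connected closed normal unipotent subgroup; a group is
  reductive (but not necessarily connected) iff it is trivial.
\<close>

definition reductive :: "'g monoid \<Rightarrow> 'g fspace \<Rightarrow> bool" where
  "reductive G A \<longleftrightarrow>
     (\<forall>U. U \<lhd> G \<and> closedin (zariski A) U \<and> connectedin (zariski A) U \<and>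
          (\<forall>u\<in>U. unipotent_element G A u) \<longrightarrow> U = {\<one>\<^bsub>G\<^esub>})"

text \<open>The regular functions on \<open>G Mod H\<close> are the right \<open>H\<close>-invariant regular functions on \<open>G\<close>.\<close>

definition coset_space :: "'g monoid \<Rightarrow> 'g fspace \<Rightarrow> 'g set \<Rightarrow> 'g set fspace" where
  "coset_space G A H = quotient_space (\<lambda>g. H #>\<^bsub>G\<^esub> g) A"


section \<open>Representation spaces\<close>

definition Homs :: "'c monoid \<Rightarrow> 'g monoid \<Rightarrow> ('c \<Rightarrow> 'g) set" where
  "Homs \<Gamma> G = hom \<Gamma> G \<inter> extensional (carrier \<Gamma>)"

text \<open>
  \<open>Homs \<Gamma> G\<close> as an algebraic subset of the \<open>N\<close>-th power of \<open>G\<close>, where \<open>\<gamma>s\<close> is a list of \<open>N\<close>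
  generators of \<open>\<Gamma>\<close>.
\<close>

definition rep_space :: "'c monoid \<Rightarrow> 'c list \<Rightarrow> 'g monoid \<Rightarrow> 'g fspace \<Rightarrow> ('c \<Rightarrow> 'g) fspace" where
  "rep_space \<Gamma> \<gamma>s G A =
     induced_space (Homs \<Gamma> G) (\<lambda>\<rho>. \<lambda>i\<in>{..<length \<gamma>s}. \<rho> (\<gamma>s ! i)) (power_space (length \<gamma>s) A)"

definition trivial_rep :: "'c monoid \<Rightarrow> 'g monoid \<Rightarrow> 'c \<Rightarrow> 'g" where
  "trivial_rep \<Gamma> G = (\<lambda>c\<in>carrier \<Gamma>. \<one>\<^bsub>G\<^esub>)"

definition rep_space0 :: "'c monoid \<Rightarrow> 'c list \<Rightarrow> 'g monoid \<Rightarrow> 'g fspace \<Rightarrow> ('c \<Rightarrow> 'g) fspace" where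
  "rep_space0 \<Gamma> \<gamma>s G A =
     subspace_of (rep_space \<Gamma> \<gamma>s G A)
       (connected_component_of_set (zariski (rep_space \<Gamma> \<gamma>s G A)) (trivial_rep \<Gamma> G))"

definition conj_rep :: "'c monoid \<Rightarrow> 'g monoid \<Rightarrow> 'g \<Rightarrow> ('c \<Rightarrow> 'g) \<Rightarrow> 'c \<Rightarrow> 'g" where
  "conj_rep \<Gamma> G g \<rho> = (\<lambda>c\<in>carrier \<Gamma>. g \<otimes>\<^bsub>G\<^esub> \<rho> c \<otimes>\<^bsub>G\<^esub> inv\<^bsub>G\<^esub> g)"

definition mult_rep :: "'c monoid \<Rightarrow> 'g monoid \<Rightarrow> ('c \<Rightarrow> 'g) \<Rightarrow> ('c \<Rightarrow> 'g) \<Rightarrow> 'c \<Rightarrow> 'g" where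
  "mult_rep \<Gamma> G \<sigma> \<rho> = (\<lambda>c\<in>carrier \<Gamma>. \<sigma> c \<otimes>\<^bsub>G\<^esub> \<rho> c)"

definition proj_rep :: "'c monoid \<Rightarrow> 'g monoid \<Rightarrow> 'g set \<Rightarrow> ('c \<Rightarrow> 'g) \<Rightarrow> 'c \<Rightarrow> 'g set" where
  "proj_rep \<Gamma> G H \<rho> = (\<lambda>c\<in>carrier \<Gamma>. H #>\<^bsub>G\<^esub> \<rho> c)"

definition Homs' ::
  "'c monoid \<Rightarrow> 'c list \<Rightarrow> 'g monoid \<Rightarrow> 'g fspace \<Rightarrow> 'g set \<Rightarrow> ('c \<Rightarrow> 'g) set" where
  "Homs' \<Gamma> \<gamma>s G A H =
     {\<sigma> \<in> Homs \<Gamma> (G\<lparr>carrier := H\<rparr>).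
        mult_rep \<Gamma> G \<sigma> ` pts (rep_space0 \<Gamma> \<gamma>s G A) \<subseteq> pts (rep_space0 \<Gamma> \<gamma>s G A)}"

definition is_character_variety ::
  "'c monoid \<Rightarrow> 'c list \<Rightarrow> 'g monoid \<Rightarrow> 'g fspace \<Rightarrow> 'x fspace \<Rightarrow> (('c \<Rightarrow> 'g) \<Rightarrow> 'x) \<Rightarrow> bool" where
  "is_character_variety \<Gamma> \<gamma>s G A X \<pi> \<longleftrightarrow>
     categorical_quotient (carrier G) (conj_rep \<Gamma> G) (rep_space \<Gamma> \<gamma>s G A) X \<pi>"

definition character_variety0 ::
  "'c monoid \<Rightarrow> 'c list \<Rightarrow> 'g monoid \<Rightarrow> 'g fspace \<Rightarrow> 'x fspace \<Rightarrow> (('c \<Rightarrow> 'g) \<Rightarrow> 'x) \<Rightarrow> 'x fspace" where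
  "character_variety0 \<Gamma> \<gamma>s G A X \<pi> = subspace_of X (\<pi> ` pts (rep_space0 \<Gamma> \<gamma>s G A))"

text \<open>
  The action on \<open>\<pi> ` S\<close> to which an action on \<open>S\<close> compatible with \<open>\<pi>\<close> descends:
  \<open>s\<close> maps \<open>\<pi> a\<close> to \<open>\<pi> (act s a)\<close>.
\<close>

definition descended_action ::
  "'a set \<Rightarrow> ('a \<Rightarrow> 'x) \<Rightarrow> ('s \<Rightarrow> 'a \<Rightarrow> 'a) \<Rightarrow> 's \<Rightarrow> 'x \<Rightarrow> 'x" where
  "descended_action S \<pi> act s x = (THE y. \<forall>a\<in>S. \<pi> a = x \<longrightarrow> y = \<pi> (act s a))"

end

theory Submission
  imports Defs "HOL-Analysis.Abstract_Topological_Spaces" "HOL-Library.Function_Algebras"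
    "HOL-Algebra.Product_Groups" "HOL-Computational_Algebra.Fundamental_Theorem_Algebra"
begin

text \<open>
  Let \<open>N\<close> be the number of generators of \<open>\<Gamma>\<close>. The projection of representation spaces is the
  restriction of the quotient map \<open>q\<close> from \<open>G\<^sup>N\<close> to \<open>(G/H)\<^sup>N\<close> by the finite group \<open>H\<^sup>N\<close>, and averaging
  over \<open>H\<^sup>N\<close> shows that the regular functions on \<open>(G/H)\<^sup>N\<close> are exactly the invariant ones on \<open>G\<^sup>N\<close>
  (\<open>power_coset_space\<close>). Let \<open>Y\<close> be the preimage of the representation space of \<open>G/H\<close>: the tuples at
  which every relator of \<open>\<Gamma>\<close> takes a value in \<open>H\<close>. Since \<open>H\<close> is finite, a relator is locally constant
  on \<open>Y\<close>, so the component \<open>C\<close> of the trivial tuple in \<open>Y\<close> consists of representations of \<open>\<Gamma>\<close> in \<open>G\<close>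
  and is the identity component of their space (\<open>C_subset_Homs\<close>, \<open>ev_R0\<close>).

  Two facts from algebraic geometry control \<open>C\<close>. By the Hilbert basis theorem \<open>C\<close> is open and closed
  in \<open>Y\<close>. As \<open>q\<close> is a closed map, the image of \<open>C\<close> and that of the points whose orbit avoids \<open>C\<close>
  partition \<open>q(Y)\<close> into closed sets, so \<open>q(C)\<close> is the identity component downstairs
  (\<open>component_image\<close>). By the Nullstellensatz some regular function is \<open>1\<close> on \<open>C\<close> and \<open>0\<close> on the rest
  of \<open>Y\<close>. Multiplying by it and summing over orbits turns a regular function that is constant on the
  fibres of \<open>q\<close> in \<open>C\<close> into a regular function on \<open>q(Y)\<close> which is unchanged on \<open>q(C)\<close> and vanishes
  elsewhere (\<open>extension\<close>).

  Two representations in \<open>C\<close> with the same projection differ by a homomorphism to \<open>H\<close>, which permutes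
  the components and so maps \<open>C\<close> to itself (\<open>fibre\<close>). Hence the fibres of the projection on \<open>C\<close> are
  the orbits of \<open>Hom'(\<Gamma>, H)\<close>, and the extension theorem identifies the regular functions; this is
  part (1).

  For part (2), the universal property makes regular functions on \<open>X\<close> the same as conjugation
  invariant regular functions on the whole representation space. An invariant function on the
  component downstairs, extended by zero, is such a function (\<open>invariant_descent\<close>), which identifies
  the regular functions. For injectivity, if the character of \<open>\<tau>\<close> differs from those of all
  translates of \<open>\<rho>\<close>, a product of translates of one function on \<open>X\<close> is invariant and separates the
  images of \<open>\<rho>\<close> and \<open>\<tau>\<close> (\<open>separation\<close>).
\<close>

section \<open>Algebras of functions and their Zariski topology\<close>

locale function_algebra =
  fixes P :: "'a set" and R :: "('a \<Rightarrow> complex) set"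
  assumes const: "(\<lambda>x. c) \<in> R"
    and add: "f \<in> R \<Longrightarrow> g \<in> R \<Longrightarrow> (\<lambda>x. f x + g x) \<in> R"
    and mult: "f \<in> R \<Longrightarrow> g \<in> R \<Longrightarrow> (\<lambda>x. f x * g x) \<in> R"
    and cong: "f \<in> R \<Longrightarrow> (\<And>x. x \<in> P \<Longrightarrow> g x = f x) \<Longrightarrow> g \<in> R"
begin

lemma scale: "f \<in> R \<Longrightarrow> (\<lambda>x. c * f x) \<in> R"
  by (rule mult[OF const])

lemma diff: "f \<in> R \<Longrightarrow> g \<in> R \<Longrightarrow> (\<lambda>x. f x - g x) \<in> R"
  using add[of f "\<lambda>x. -1 * g x"] scale[of g "-1"] by simp

lemma sum: "(\<And>i. i \<in> I \<Longrightarrow> f i \<in> R) \<Longrightarrow> (\<lambda>x. \<Sum>i\<in>I. f i x) \<in> R"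
  by (induction I rule: infinite_finite_induct) (auto intro: const add)

lemma prod: "(\<And>i. i \<in> I \<Longrightarrow> f i \<in> R) \<Longrightarrow> (\<lambda>x. \<Prod>i\<in>I. f i x) \<in> R"
  by (induction I rule: infinite_finite_induct) (auto intro: const mult)

lemma generated_subset:
  assumes "F \<subseteq> R" "f \<in> generated_algebra P F"
  shows "f \<in> R"
  using assms(2) by (induction) (use assms(1) in \<open>auto intro: const add mult cong\<close>)

end

abbreviation fspace_algebra :: "'a fspace \<Rightarrow> bool" where
  "fspace_algebra B \<equiv> function_algebra (pts B) (reg B)"

lemma function_algebra_generated: "function_algebra P (generated_algebra P F)"
  by unfold_locales (auto intro: generated_algebra.intros)

lemma generated_algebra_mono: "F \<subseteq> F' \<Longrightarrow> generated_algebra P F \<subseteq> generated_algebra P F'"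
  using function_algebra.generated_subset[OF function_algebra_generated, of F P F']
  by (auto intro: generated_algebra.base)

lemma pts_simps [simp]:
  "pts (affine_space n) = {..<n} \<rightarrow>\<^sub>E UNIV"
  "pts (prod_space A B) = pts A \<times> pts B"
  "pts (power_space n A) = {..<n} \<rightarrow>\<^sub>E pts A"
  by (simp_all add: affine_space_def prod_space_def power_space_def)

lemma pts_induced [simp]: "pts (induced_space S e B) = S"
  by (simp add: induced_space_def)

lemma pts_subspace [simp]: "pts (subspace_of B S) = S"
  by (simp add: subspace_of_def)

lemma pts_quotient [simp]: "pts (quotient_space q B) = q ` pts B"
  by (simp add: quotient_space_def)

lemma reg_induced: "reg (induced_space S e B) = {f. \<exists>g\<in>reg B. \<forall>x\<in>S. f x = g (e x)}"
  by (simp add: induced_space_def)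

lemma reg_subspace: "reg (subspace_of B S) = {f. \<exists>g\<in>reg B. \<forall>x\<in>S. f x = g x}"
  by (simp add: subspace_of_def reg_induced)

lemma reg_quotient: "reg (quotient_space q B) = {f. (\<lambda>x. f (q x)) \<in> reg B}"
  by (simp add: quotient_space_def)

lemma fspace_algebra_power: "fspace_algebra (power_space n A)"
  and fspace_algebra_affine: "fspace_algebra (affine_space n)"
  by (simp_all add: power_space_def affine_space_def function_algebra_generated)

lemma fspace_algebra_induced:
  assumes "fspace_algebra B"
  shows "fspace_algebra (induced_space S e B)"
proof -
  interpret function_algebra "pts B" "reg B" by fact
  show ?thesis
  proof (unfold_locales, goal_cases)
    case (1 c) show ?case using const[of c] by (force simp: reg_induced)
  next
    case (2 f g)
    then obtain f' g' where "f' \<in> reg B" "g' \<in> reg B" "\<forall>x\<in>S. f x = f' (e x)" "\<forall>x\<in>S. g x = g' (e x)"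
      by (auto simp: reg_induced)
    then show ?case using add[of f' g'] unfolding reg_induced by force
  next
    case (3 f g)
    then obtain f' g' where "f' \<in> reg B" "g' \<in> reg B" "\<forall>x\<in>S. f x = f' (e x)" "\<forall>x\<in>S. g x = g' (e x)"
      by (auto simp: reg_induced)
    then show ?case using mult[of f' g'] unfolding reg_induced by force
  next
    case (4 f g) then show ?case by (auto simp: reg_induced)
  qed
qed

lemma fspace_algebra_subspace: "fspace_algebra B \<Longrightarrow> fspace_algebra (subspace_of B S)"
  unfolding subspace_of_def by (rule fspace_algebra_induced)

lemma fspace_algebra_quotient:
  assumes "fspace_algebra B"
  shows "fspace_algebra (quotient_space q B)"
proof -
  interpret function_algebra "pts B" "reg B" by fact
  show ?thesis
  proof (unfold_locales, goal_cases)
    case (4 f g)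
    then show ?case using cong[of "\<lambda>x. f (q x)" "\<lambda>x. g (q x)"] by (auto simp: reg_quotient)
  qed (auto simp: reg_quotient const add mult)
qed

lemma morphismD: "morphism A B h \<Longrightarrow> f \<in> reg B \<Longrightarrow> (\<lambda>x. f (h x)) \<in> reg A"
  and morphism_pts: "morphism A B h \<Longrightarrow> x \<in> pts A \<Longrightarrow> h x \<in> pts B"
  by (auto simp: morphism_def)

text \<open>
  The functions that pull back to regular functions form an algebra, so regularity of a map can be
  tested on generators.
\<close>

lemma morphism_into_generated:
  assumes A: "fspace_algebra A" and "reg B = generated_algebra (pts B) F"
    and h: "\<And>x. x \<in> pts A \<Longrightarrow> h x \<in> pts B" and F: "\<And>f. f \<in> F \<Longrightarrow> (\<lambda>x. f (h x)) \<in> reg A"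
  shows "morphism A B h"
proof -
  interpret function_algebra "pts A" "reg A" by fact
  have "(\<lambda>x. f (h x)) \<in> reg A" if "f \<in> generated_algebra (pts B) F" for f
    using that
  proof induction
    case (cong f g)
    then show ?case using function_algebra.cong[OF A, of "\<lambda>x. f (h x)" "\<lambda>x. g (h x)"] h by auto
  qed (auto intro: F const add mult)
  then show ?thesis using assms by (auto simp: morphism_def)
qed

lemma morphism_into_prod:
  assumes "fspace_algebra B" "morphism B A1 u" "morphism B A2 v"
  shows "morphism B (prod_space A1 A2) (\<lambda>x. (u x, v x))"
  by (rule morphism_into_generated[OF assms(1), where F =
      "{(\<lambda>z. f (fst z)) | f. f \<in> reg A1} \<union> {(\<lambda>z. g (snd z)) | g. g \<in> reg A2}"])
    (use assms(2,3) in \<open>auto simp: prod_space_def morphism_def\<close>)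

lemma morphism_into_power:
  assumes "fspace_algebra B" "\<And>i. i < n \<Longrightarrow> morphism B A (\<lambda>x. u x i)"
    and "\<And>x. x \<in> pts B \<Longrightarrow> u x \<in> extensional {..<n}"
  shows "morphism B (power_space n A) u"
  by (rule morphism_into_generated[OF assms(1), where F =
      "{(\<lambda>x. f (x i)) | f i. f \<in> reg A \<and> i < n}"])
    (use assms(2,3) in \<open>auto simp: power_space_def morphism_def PiE_def\<close>)

lemma morphism_coordinate: "i < n \<Longrightarrow> morphism (power_space n A) A (\<lambda>x. x i)"
  by (auto simp: morphism_def power_space_def intro: generated_algebra.base)

lemma morphism_compose: "morphism A B h \<Longrightarrow> morphism B C k \<Longrightarrow> morphism A C (\<lambda>x. k (h x))"
  by (auto simp: morphism_def)

lemma morphism_const: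
  assumes "fspace_algebra A" "b \<in> pts B"
  shows "morphism A B (\<lambda>x. b)"
  using assms by (auto simp: morphism_def function_algebra.const)

lemma topspace_zariski:
  assumes "fspace_algebra B"
  shows "topspace (zariski B) = pts B"
proof -
  have "pts B = {x \<in> pts B. (1::complex) \<noteq> 0}" by simp
  then have "pts B \<in> {{x \<in> pts B. f x \<noteq> 0} | f. f \<in> reg B}"
    using function_algebra.const[OF assms, of 1] by (intro CollectI exI[of _ "\<lambda>x. 1"] conjI)
  then have "pts B \<subseteq> topspace (zariski B)"
    unfolding zariski_def topology_generated_by_topspace by (rule Union_upper)
  moreover have "topspace (zariski B) \<subseteq> pts B"
    unfolding zariski_def topology_generated_by_topspace by (rule Union_least) blast
  ultimately show ?thesis by (rule equalityI[rotated])
qed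

text \<open>
  Basic open sets are closed under intersection because a product of two regular functions
  vanishes exactly where one of them does; hence they form a basis.
\<close>

lemma openin_zariski:
  assumes "fspace_algebra B"
  shows "openin (zariski B) U \<longleftrightarrow>
    U \<subseteq> pts B \<and> (\<forall>x\<in>U. \<exists>f\<in>reg B. f x \<noteq> 0 \<and> (\<forall>y\<in>pts B - U. f y = 0))"
proof
  interpret function_algebra "pts B" "reg B" by fact
  assume "openin (zariski B) U"
  then have "generate_topology_on {{x \<in> pts B. f x \<noteq> 0} | f. f \<in> reg B} U"
    by (simp add: zariski_def openin_topology_generated_by_iff)
  then show "U \<subseteq> pts B \<and> (\<forall>x\<in>U. \<exists>f\<in>reg B. f x \<noteq> 0 \<and> (\<forall>y\<in>pts B - U. f y = 0))"
  proof induction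
    case (Int a b)
    show ?case
    proof (intro conjI ballI)
      fix x assume "x \<in> a \<inter> b"
      then obtain f g where fg: "f \<in> reg B" "f x \<noteq> 0" "\<forall>y\<in>pts B - a. f y = 0"
          "g \<in> reg B" "g x \<noteq> 0" "\<forall>y\<in>pts B - b. g y = 0"
        using Int.IH by (metis IntD1 IntD2)
      show "\<exists>f\<in>reg B. f x \<noteq> 0 \<and> (\<forall>y\<in>pts B - a \<inter> b. f y = 0)"
        by (rule bexI[of _ "\<lambda>x. f x * g x"]) (use fg in \<open>auto intro: mult\<close>)
    qed (use Int.IH in auto)
  next
    case (UN K)
    show ?case
    proof (intro conjI ballI)
      fix x assume "x \<in> \<Union> K"
      then obtain k where k: "k \<in> K" "x \<in> k" by blast
      then obtain f where "f \<in> reg B" "f x \<noteq> 0" "\<forall>y\<in>pts B - k. f y = 0" using UN.IH by metis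
      then show "\<exists>f\<in>reg B. f x \<noteq> 0 \<and> (\<forall>y\<in>pts B - \<Union> K. f y = 0)"
        using k by (intro bexI[of _ f]) auto
    qed (use UN.IH in auto)
  qed auto
next
  assume U: "U \<subseteq> pts B \<and> (\<forall>x\<in>U. \<exists>f\<in>reg B. f x \<noteq> 0 \<and> (\<forall>y\<in>pts B - U. f y = 0))"
  show "openin (zariski B) U"
  proof (subst openin_subopen, intro ballI)
    fix x assume "x \<in> U"
    then obtain f where f: "f \<in> reg B" "f x \<noteq> 0" "\<forall>y\<in>pts B - U. f y = 0" using U by metis
    have "openin (zariski B) {x \<in> pts B. f x \<noteq> 0}"
      unfolding zariski_def by (rule topology_generated_by_Basis) (use f in auto)
    then show "\<exists>T. openin (zariski B) T \<and> x \<in> T \<and> T \<subseteq> U"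
      using f U \<open>x \<in> U\<close> by (intro exI[of _ "{x \<in> pts B. f x \<noteq> 0}"]) auto
  qed
qed

lemma closedin_zariski:
  assumes "fspace_algebra B"
  shows "closedin (zariski B) Z \<longleftrightarrow>
    Z \<subseteq> pts B \<and> (\<forall>x\<in>pts B - Z. \<exists>f\<in>reg B. f x \<noteq> 0 \<and> (\<forall>z\<in>Z. f z = 0))"
proof (cases "Z \<subseteq> pts B")
  case True
  then have Z: "pts B - (pts B - Z) = Z" by blast
  show ?thesis
    unfolding closedin_def openin_zariski[OF assms] topspace_zariski[OF assms] Z
    using True by blast
qed (simp add: closedin_def topspace_zariski[OF assms])

lemma continuous_map_morphism:
  assumes A: "fspace_algebra A" and B: "fspace_algebra B" and h: "morphism A B h"
  shows "continuous_map (zariski A) (zariski B) h"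
proof -
  have "openin (zariski A) {x \<in> pts A. h x \<in> U}" if U: "openin (zariski B) U" for U
    unfolding openin_zariski[OF A]
  proof (intro conjI ballI)
    fix x assume x: "x \<in> {x \<in> pts A. h x \<in> U}"
    have "\<forall>y\<in>U. \<exists>f\<in>reg B. f y \<noteq> 0 \<and> (\<forall>y\<in>pts B - U. f y = 0)"
      using U openin_zariski[OF B] by blast
    then obtain f where f: "f \<in> reg B" "f (h x) \<noteq> 0" "\<forall>y\<in>pts B - U. f y = 0"
      using x by blast
    show "\<exists>f\<in>reg A. f x \<noteq> 0 \<and> (\<forall>y\<in>pts A - {x \<in> pts A. h x \<in> U}. f y = 0)"
    proof (intro bexI conjI ballI)
      show "(\<lambda>x. f (h x)) \<in> reg A" using h f(1) by (rule morphismD)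
      show "f (h y) = 0" if "y \<in> pts A - {x \<in> pts A. h x \<in> U}" for y
        using that f(3) morphism_pts[OF h, of y] by blast
    qed (rule f(2))
  qed blast
  then show ?thesis
    using morphism_pts[OF h] by (simp add: continuous_map_def topspace_zariski A B)
qed

lemma zariski_subspace:
  assumes B: "fspace_algebra B" and S: "S \<subseteq> pts B"
  shows "zariski (subspace_of B S) = subtopology (zariski B) S"
proof (rule topology_eq[THEN iffD2], intro allI)
  note BS = fspace_algebra_subspace[OF B, of S]
  fix U
  show "openin (zariski (subspace_of B S)) U \<longleftrightarrow> openin (subtopology (zariski B) S) U"
  proof
    assume U: "openin (zariski (subspace_of B S)) U"
    define V where "V = {x \<in> pts B. \<exists>f\<in>reg B. f x \<noteq> 0 \<and> (\<forall>y\<in>S - U. f y = 0)}"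
    have "openin (zariski B) V"
      unfolding openin_zariski[OF B] V_def using S by blast
    moreover have "U = V \<inter> S"
    proof (intro equalityI subsetI)
      fix x assume x: "x \<in> U"
      then obtain f where f: "f \<in> reg (subspace_of B S)" "f x \<noteq> 0" "\<forall>y\<in>S - U. f y = 0"
        using U unfolding openin_zariski[OF BS] by auto
      then obtain g where "g \<in> reg B" "\<forall>x\<in>S. f x = g x" by (auto simp: reg_subspace)
      moreover have "x \<in> S" using U x unfolding openin_zariski[OF BS] by auto
      ultimately show "x \<in> V \<inter> S" using f S unfolding V_def by (auto intro!: bexI[of _ g])
    qed (auto simp: V_def)
    ultimately show "openin (subtopology (zariski B) S) U" by (auto simp: openin_subtopology)
  next
    assume "openin (subtopology (zariski B) S) U"
    then obtain V where V: "openin (zariski B) V" "U = V \<inter> S"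
      unfolding openin_subtopology by blast
    have V': "\<forall>x\<in>V. \<exists>f\<in>reg B. f x \<noteq> 0 \<and> (\<forall>y\<in>pts B - V. f y = 0)"
      using V(1) openin_zariski[OF B] by blast
    have "\<exists>f\<in>reg (subspace_of B S). f x \<noteq> 0 \<and> (\<forall>y\<in>S - U. f y = 0)" if "x \<in> U" for x
    proof -
      obtain f where f: "f \<in> reg B" "f x \<noteq> 0" "\<forall>y\<in>pts B - V. f y = 0"
        using V' V(2) \<open>x \<in> U\<close> by blast
      show ?thesis
      proof (intro bexI[of _ f] conjI ballI)
        show "f \<in> reg (subspace_of B S)" using f(1) unfolding reg_subspace by blast
        show "f y = 0" if "y \<in> S - U" for y using that f(3) S V(2) by blast
      qed (rule f(2))
    qed
    then show "openin (zariski (subspace_of B S)) U"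
      unfolding openin_zariski[OF BS] pts_subspace using V(2) by blast
  qed
qed

text \<open>
  The structure induced along an injection \<open>e\<close> is the one for which \<open>e\<close> is an isomorphism onto its
  image; so \<open>e\<close> matches connected components.
\<close>

lemma connected_component_induced:
  assumes B: "fspace_algebra B" and e: "e ` S \<subseteq> pts B" and inj: "inj_on e S" and x: "x \<in> S"
  shows "e ` connected_component_of_set (zariski (induced_space S e B)) x =
    connected_component_of_set (subtopology (zariski B) (e ` S)) (e x)"
proof -
  let ?I = "induced_space S e B" and ?J = "subspace_of B (e ` S)"
  note I = fspace_algebra_induced[OF B, of S e] and J = fspace_algebra_subspace[OF B, of "e ` S"]
  have ht: "homeomorphic_map (zariski ?I) (zariski ?J) e"
  proof (rule homeomorphic_maps_imp_map)
    have "morphism ?I ?J e" by (auto simp: morphism_def reg_induced reg_subspace)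
    moreover have "morphism ?J ?I (inv_into S e)"
      by (auto simp: morphism_def reg_induced reg_subspace inv_into_into inj)
    ultimately show "homeomorphic_maps (zariski ?I) (zariski ?J) e (inv_into S e)"
      unfolding homeomorphic_maps_def using continuous_map_morphism[OF I J] continuous_map_morphism[OF J I]
      by (auto simp: topspace_zariski[OF I] topspace_zariski[OF J] inj f_inv_into_f)
  qed
  have "connected_component_of_set (zariski ?J) (e x) = e ` connected_component_of_set (zariski ?I) x"
    by (rule homeomorphic_map_connected_component_of[OF ht]) (simp add: topspace_zariski[OF I] x)
  then show ?thesis by (simp add: zariski_subspace[OF B e])
qed

text \<open>
  If each \<open>f z\<close> separates \<open>x\<close> from the point \<open>z\<close> of \<open>Z\<close>, the product of the functions
  \<open>y \<mapsto> f z y - f z z\<close> vanishes on \<open>Z\<close> but not at \<open>x\<close>.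
\<close>

lemma closedin_finite_zariski:
  assumes "fspace_algebra B" "finite Z" "Z \<subseteq> pts B"
    and sep: "\<And>x y. x \<in> pts B \<Longrightarrow> y \<in> pts B \<Longrightarrow> x \<noteq> y \<Longrightarrow> \<exists>f\<in>reg B. f x \<noteq> f y"
  shows "closedin (zariski B) Z"
  unfolding closedin_zariski[OF assms(1)]
proof (intro conjI ballI)
  interpret function_algebra "pts B" "reg B" by fact
  fix x assume x: "x \<in> pts B - Z"
  have "\<forall>z\<in>Z. \<exists>f. f \<in> reg B \<and> f x \<noteq> f z" using sep x assms(3) by blast
  then obtain f where f: "\<forall>z\<in>Z. f z \<in> reg B \<and> f z x \<noteq> f z z" by metis
  show "\<exists>f\<in>reg B. f x \<noteq> 0 \<and> (\<forall>z\<in>Z. f z = 0)"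
  proof (intro bexI conjI ballI)
    show "(\<lambda>y. \<Prod>z\<in>Z. f z y - f z z) \<in> reg B" using f by (intro prod diff const) auto
  qed (use f assms(2) in auto)
qed fact

text \<open>
  Avoiding zeros: over an infinite field a linear combination of functions is nonzero at finitely
  many points simultaneously if each point is avoided by one of them.
\<close>

lemma common_nonvanishing:
  assumes "finite Q" and "(\<lambda>x. 0) \<in> I"
    and lin: "\<And>f g c. f \<in> I \<Longrightarrow> g \<in> I \<Longrightarrow> (\<lambda>x. f x + c * g x) \<in> I"
    and "\<And>q. q \<in> Q \<Longrightarrow> \<exists>f\<in>I. f q \<noteq> (0::complex)"
  shows "\<exists>f\<in>I. \<forall>q\<in>Q. f q \<noteq> 0"
  using assms(1,4)
proof (induction Q)
  case empty then show ?case using assms(2) by auto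
next
  case (insert a Q)
  then obtain f g where fg: "f \<in> I" "\<forall>q\<in>Q. f q \<noteq> 0" "g \<in> I" "g a \<noteq> 0" by (metis insert_iff)
  have "finite (insert 0 ((\<lambda>q. - f q / g q) ` insert a Q))" using insert by simp
  then obtain c where c: "c \<notin> insert 0 ((\<lambda>q. - f q / g q) ` insert a Q)"
    using ex_new_if_finite[OF infinite_UNIV_char_0] by blast
  have "f q + c * g q \<noteq> 0" if "q \<in> insert a Q" for q
  proof (cases "g q = 0")
    case True then show ?thesis using fg that by auto
  next
    case False
    have "c \<noteq> - f q / g q" using c that by blast
    then show ?thesis using False by (auto simp: field_simps add_eq_0_iff)
  qed
  then show ?case using lin[OF fg(1,3), of c] by (intro bexI[of _ "\<lambda>x. f x + c * g x"]) auto
qed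

section \<open>The Hilbert basis theorem and clopen components\<close>

text \<open>
  The ideal of \<open>R\<close> generated by \<open>S\<close>, for functions compared on \<open>P\<close>; the inductive form makes
  visible that each member involves only finitely many generators.
\<close>

inductive_set ideal_gen ::
    "'a set \<Rightarrow> ('a \<Rightarrow> complex) set \<Rightarrow> ('a \<Rightarrow> complex) set \<Rightarrow> ('a \<Rightarrow> complex) set"
  for P R S where
  zero: "(\<And>x. x \<in> P \<Longrightarrow> g x = 0) \<Longrightarrow> g \<in> ideal_gen P R S"
| step: "g \<in> ideal_gen P R S \<Longrightarrow> r \<in> R \<Longrightarrow> s \<in> S \<Longrightarrow>
    (\<And>x. x \<in> P \<Longrightarrow> h x = g x + r x * s x) \<Longrightarrow> h \<in> ideal_gen P R S"

lemma ideal_gen_mono: "S \<subseteq> S' \<Longrightarrow> ideal_gen P R S \<subseteq> ideal_gen P R S'"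
proof
  fix g assume "S \<subseteq> S'" "g \<in> ideal_gen P R S"
  from this(2) show "g \<in> ideal_gen P R S'"
    by induction (use \<open>S \<subseteq> S'\<close> in \<open>auto intro: ideal_gen.intros\<close>)
qed

lemma ideal_gen_vanish:
  "g \<in> ideal_gen P R S \<Longrightarrow> x \<in> P \<Longrightarrow> (\<And>s. s \<in> S \<Longrightarrow> s x = 0) \<Longrightarrow> g x = 0"
  by (induction rule: ideal_gen.induct) auto

lemma ideal_gen_finite:
  "g \<in> ideal_gen P R S \<Longrightarrow> \<exists>T\<subseteq>S. finite T \<and> g \<in> ideal_gen P R T"
proof (induction rule: ideal_gen.induct)
  case (zero g)
  then show ?case by (intro exI[of _ "{}"]) (auto intro: ideal_gen.zero)
next
  case (step g r s h)
  then obtain T where T: "T \<subseteq> S" "finite T" "g \<in> ideal_gen P R T" by blast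
  have "h \<in> ideal_gen P R (insert s T)"
    by (rule ideal_gen.step[OF _ step(2) _ step(4)])
      (use T ideal_gen_mono[of T "insert s T" P R] in auto)
  then show ?case using T step(3) by (intro exI[of _ "insert s T"]) auto
qed

lemma ideal_gen_cong:
  "g \<in> ideal_gen P R S \<Longrightarrow> (\<And>x. x \<in> P \<Longrightarrow> h x = g x) \<Longrightarrow> h \<in> ideal_gen P R S"
  by (erule ideal_gen.cases) (auto intro: ideal_gen.intros)

lemma ideal_gen_add:
  assumes "f \<in> ideal_gen P R S" "g \<in> ideal_gen P R S"
  shows "(\<lambda>x. f x + g x) \<in> ideal_gen P R S"
  using assms(1)
proof (induction rule: ideal_gen.induct)
  case (zero f)
  then show ?case by (intro ideal_gen_cong[OF assms(2)]) auto
next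
  case (step f r s h)
  show ?case by (rule ideal_gen.step[OF step(5,2,3)]) (simp add: step(4))
qed

lemma (in function_algebra) ideal_gen_subset:
  assumes "S \<subseteq> R"
  shows "ideal_gen P R S \<subseteq> R"
proof
  fix g assume "g \<in> ideal_gen P R S"
  then show "g \<in> R"
  proof induction
    case (zero g)
    then show ?case by (intro cong[OF const[of 0]]) auto
  next
    case (step g r s h)
    then have "(\<lambda>x. g x + r x * s x) \<in> R" using assms by (intro add mult) auto
    then show ?case by (rule cong) (simp add: step)
  qed
qed

lemma (in function_algebra) ideal_gen_mult:
  assumes "r \<in> R" "g \<in> ideal_gen P R S"
  shows "(\<lambda>x. r x * g x) \<in> ideal_gen P R S"
  using assms(2)
proof induction
  case (zero g)
  then show ?case by (intro ideal_gen.zero) auto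
next
  case (step g r' s h)
  show ?case
    by (rule ideal_gen.step[OF step(5) mult[OF assms(1) step(2)] step(3)])
      (simp add: step(4) algebra_simps)
qed

lemma (in function_algebra) ideal_gen_base:
  "s \<in> S \<Longrightarrow> s \<in> ideal_gen P R S"
  using ideal_gen.step[OF ideal_gen.zero[of P "\<lambda>x. 0"] const[of 1], of s S s] by simp

lemma (in function_algebra) ideal_gen_idem:
  assumes "S \<subseteq> ideal_gen P R T"
  shows "ideal_gen P R S \<subseteq> ideal_gen P R T"
proof
  fix g assume "g \<in> ideal_gen P R S"
  then show "g \<in> ideal_gen P R T"
  proof induction
    case (step g r s h)
    then have "(\<lambda>x. g x + r x * s x) \<in> ideal_gen P R T"
      using assms by (intro ideal_gen_add ideal_gen_mult) auto
    then show ?case by (rule ideal_gen_cong) (simp add: step)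
  qed (rule ideal_gen.zero)
qed

lemma (in function_algebra) ideal_gen_sequence:
  assumes "g \<in> ideal_gen P R (s ` {..<k::nat})"
  shows "\<exists>r. (\<forall>i<k. r i \<in> R) \<and> (\<forall>x\<in>P. g x = (\<Sum>i<k. r i x * s i x))"
  using assms
proof induction
  case (zero g)
  then show ?case by (intro exI[of _ "\<lambda>i x. 0"]) (auto intro: const)
next
  case (step g r t h)
  then obtain r' j where r': "\<forall>i<k. r' i \<in> R" "\<forall>x\<in>P. g x = (\<Sum>i<k. r' i x * s i x)"
    and j: "j < k" "t = s j" by blast
  let ?r = "r'(j := \<lambda>x. r' j x + r x)"
  have "h x = (\<Sum>i<k. ?r i x * s i x)" if "x \<in> P" for x
  proof -
    have "(\<Sum>i<k. ?r i x * s i x) = (\<Sum>i<k. r' i x * s i x + (if i = j then r x * s j x else 0))"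
      by (intro sum.cong) (auto simp: algebra_simps)
    then show ?thesis using r'(2) j that step(4) by (simp add: sum.distrib)
  qed
  moreover have "\<forall>i<k. ?r i \<in> R" using r'(1) step(2) add[of "r' j" r] by auto
  ultimately show ?case by (intro exI[of _ ?r]) auto
qed

text \<open>
  The ascending chain condition in the form used by Hilbert's argument: in every sequence some member
  lies in the ideal generated by its predecessors.
\<close>

definition noetherian :: "'a set \<Rightarrow> ('a \<Rightarrow> complex) set \<Rightarrow> bool" where
  "noetherian P R \<longleftrightarrow>
     (\<forall>s :: nat \<Rightarrow> _. range s \<subseteq> R \<longrightarrow> (\<exists>k. s k \<in> ideal_gen P R (s ` {..<k})))"

text \<open>
  Polynomials of degree less than \<open>n\<close> in \<open>t\<close>. As \<open>t\<close> may be algebraic over \<open>R\<close>, one function can have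
  expressions of several degrees, so this is only a filtration; the degree of a function is the
  smallest possible one.
\<close>

definition poly_below ::
    "'a set \<Rightarrow> ('a \<Rightarrow> complex) set \<Rightarrow> ('a \<Rightarrow> complex) \<Rightarrow> nat \<Rightarrow> ('a \<Rightarrow> complex) set" where
  "poly_below P R t n = {g. \<exists>a. (\<forall>i<n. a i \<in> R) \<and> (\<forall>x\<in>P. g x = (\<Sum>i<n. a i x * t x ^ i))}"

context function_algebra
begin

lemma poly_belowI:
  "(\<And>i. i < n \<Longrightarrow> a i \<in> R) \<Longrightarrow> (\<And>x. x \<in> P \<Longrightarrow> g x = (\<Sum>i<n. a i x * t x ^ i)) \<Longrightarrow> g \<in> poly_below P R t n"
  unfolding poly_below_def by blast

lemma poly_below_add:
  assumes "f \<in> poly_below P R t n" "g \<in> poly_below P R t n"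
  shows "(\<lambda>x. f x + g x) \<in> poly_below P R t n"
proof -
  obtain a b where "\<forall>i<n. a i \<in> R" "\<forall>x\<in>P. f x = (\<Sum>i<n. a i x * t x ^ i)"
    "\<forall>i<n. b i \<in> R" "\<forall>x\<in>P. g x = (\<Sum>i<n. b i x * t x ^ i)"
    using assms unfolding poly_below_def by blast
  then show ?thesis
    by (intro poly_belowI[where a = "\<lambda>i x. a i x + b i x"])
      (auto simp: sum.distrib algebra_simps intro: add)
qed

lemma poly_below_scale:
  assumes "r \<in> R" "f \<in> poly_below P R t n"
  shows "(\<lambda>x. r x * f x) \<in> poly_below P R t n"
proof -
  obtain a where "\<forall>i<n. a i \<in> R" "\<forall>x\<in>P. f x = (\<Sum>i<n. a i x * t x ^ i)"
    using assms unfolding poly_below_def by blast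
  then show ?thesis
    by (intro poly_belowI[where a = "\<lambda>i x. r x * a i x"])
      (auto simp: sum_distrib_left algebra_simps intro: mult assms)
qed

lemma poly_below_sum:
  assumes "\<And>i. i \<in> I \<Longrightarrow> f i \<in> poly_below P R t n"
  shows "(\<lambda>x. \<Sum>i\<in>I. f i x) \<in> poly_below P R t n"
  using assms
proof (induction I rule: infinite_finite_induct)
  case (insert i I)
  then show ?case using poly_below_add[of "f i" t n "\<lambda>x. \<Sum>i\<in>I. f i x"] by auto
qed (auto intro!: poly_belowI[where a = "\<lambda>i x. 0"] const)

lemma poly_below_cong:
  "f \<in> poly_below P R t n \<Longrightarrow> (\<And>x. x \<in> P \<Longrightarrow> g x = f x) \<Longrightarrow> g \<in> poly_below P R t n"
  unfolding poly_below_def by auto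

lemma poly_below_monomial:
  assumes "r \<in> R" "d < n"
  shows "(\<lambda>x. r x * t x ^ d) \<in> poly_below P R t n"
proof (rule poly_belowI[where a = "\<lambda>i x. if i = d then r x else 0"])
  show "(\<lambda>x. if i = d then r x else 0) \<in> R" for i using assms const[of 0] by (cases "i = d") auto
  show "r x * t x ^ d = (\<Sum>i<n. (if i = d then r x else 0) * t x ^ i)" for x
    using assms(2) by (simp add: if_distrib[of "\<lambda>u. u * _"] cong: if_cong)
qed

lemma poly_below_mono:
  assumes "f \<in> poly_below P R t m" "m \<le> n"
  shows "f \<in> poly_below P R t n"
proof -
  obtain a where a: "\<forall>i<m. a i \<in> R" "\<forall>x\<in>P. f x = (\<Sum>i<m. a i x * t x ^ i)"
    using assms(1) unfolding poly_below_def by blast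
  have "(\<lambda>x. \<Sum>i<m. a i x * t x ^ i) \<in> poly_below P R t n"
    by (intro poly_below_sum poly_below_monomial) (use a assms(2) in auto)
  then show ?thesis by (rule poly_below_cong) (use a in auto)
qed

lemma poly_below_power:
  assumes "f \<in> poly_below P R t m" "m + k \<le> n"
  shows "(\<lambda>x. t x ^ k * f x) \<in> poly_below P R t n"
proof -
  obtain a where a: "\<forall>i<m. a i \<in> R" "\<forall>x\<in>P. f x = (\<Sum>i<m. a i x * t x ^ i)"
    using assms(1) unfolding poly_below_def by blast
  have "(\<lambda>x. \<Sum>i<m. a i x * t x ^ (i + k)) \<in> poly_below P R t n"
    by (intro poly_below_sum poly_below_monomial) (use a assms(2) in auto)
  then show ?thesis
    by (rule poly_below_cong) (use a in \<open>auto simp: sum_distrib_left power_add algebra_simps\<close>)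
qed

lemma poly_below_mult:
  assumes "f \<in> poly_below P R t m" "g \<in> poly_below P R t n"
  shows "(\<lambda>x. f x * g x) \<in> poly_below P R t (m + n)"
proof -
  obtain a where a: "\<forall>i<m. a i \<in> R" "\<forall>x\<in>P. f x = (\<Sum>i<m. a i x * t x ^ i)"
    using assms(1) unfolding poly_below_def by blast
  have "(\<lambda>x. \<Sum>i<m. a i x * (t x ^ i * g x)) \<in> poly_below P R t (m + n)"
    by (intro poly_below_sum poly_below_scale poly_below_power[OF assms(2)]) (use a in auto)
  then show ?thesis
    by (rule poly_below_cong) (use a in \<open>auto simp: sum_distrib_right sum_distrib_left algebra_simps\<close>)
qed

lemma poly_below_Suc:
  assumes "f \<in> poly_below P R t (Suc d)"
  shows "\<exists>a\<in>R. (\<lambda>x. f x - a x * t x ^ d) \<in> poly_below P R t d"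
proof -
  obtain a where a: "\<forall>i<Suc d. a i \<in> R" "\<forall>x\<in>P. f x = (\<Sum>i<Suc d. a i x * t x ^ i)"
    using assms unfolding poly_below_def by blast
  then show ?thesis by (intro bexI[of _ "a d"] poly_belowI[where a = a]) auto
qed

end

lemma generated_insert_poly:
  assumes "g \<in> generated_algebra P (insert t F)"
  shows "\<exists>n. g \<in> poly_below P (generated_algebra P F) t n"
proof -
  let ?R = "generated_algebra P F"
  interpret function_algebra P ?R by (rule function_algebra_generated)
  show ?thesis using assms
  proof induction
    case (base f)
    show ?case
    proof (cases "f = t")
      case True
      then show ?thesis using poly_below_monomial[OF const[of 1], of 1 2 t] by auto
    next
      case False
      then have "f \<in> ?R" using base by (auto intro: generated_algebra.base)
      then show ?thesis using poly_below_monomial[of f 0 1 t] by auto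
    qed
  next
    case (const c)
    then show ?case using poly_below_monomial[OF function_algebra.const[OF function_algebra_generated], of 0 1 c t] by fastforce
  next
    case (add f g)
    then obtain m n where "f \<in> poly_below P ?R t m" "g \<in> poly_below P ?R t n" by blast
    then have "f \<in> poly_below P ?R t (max m n)" "g \<in> poly_below P ?R t (max m n)"
      by (auto intro: poly_below_mono)
    then show ?case using poly_below_add by blast
  next
    case (mult f g)
    then show ?case using poly_below_mult by blast
  next
    case (cong f g)
    then show ?case using poly_below_cong[of f t _ g] by blast
  qed
qed

text \<open>
  Hilbert's argument. If an ideal \<open>J\<close> of \<open>R[t]\<close> is not finitely generated, choose \<open>G k\<close> in \<open>J\<close>
  outside the ideal of the earlier choices and of least possible degree \<open>d k\<close>; the degrees do not
  decrease.
  By the hypothesis on \<open>R\<close> some leading coefficient is a combination of the earlier ones, and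
  subtracting the corresponding combination of the earlier \<open>G i\<close>, shifted by powers of \<open>t\<close>,
  contradicts minimality.
\<close>

lemma noetherian_insert:
  assumes R: "noetherian P (generated_algebra P F)"
  shows "noetherian P (generated_algebra P (insert t F))"
proof (rule ccontr)
  let ?R = "generated_algebra P F" and ?T = "generated_algebra P (insert t F)"
  interpret R: function_algebra P ?R by (rule function_algebra_generated)
  interpret T: function_algebra P ?T by (rule function_algebra_generated)
  have RT: "?R \<subseteq> ?T" by (rule generated_algebra_mono) blast
  have tpow: "(\<lambda>x. t x ^ k) \<in> ?T" for k
    by (induction k) (auto intro: T.const T.mult generated_algebra.base)
  assume "\<not> noetherian P ?T"
  then obtain s where s: "range s \<subseteq> ?T" "\<And>k::nat. s k \<notin> ideal_gen P ?T (s ` {..<k})"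
    unfolding noetherian_def by blast
  define J where "J = ideal_gen P ?T (range s)"
  have JT: "J \<subseteq> ?T" unfolding J_def by (rule T.ideal_gen_subset[OF s(1)])
  have not_fg: "\<not> J \<subseteq> ideal_gen P ?T S" if "finite S" "S \<subseteq> J" for S
  proof
    assume J: "J \<subseteq> ideal_gen P ?T S"
    have "\<exists>m. S \<subseteq> ideal_gen P ?T (s ` {..<m})"
      using that
    proof (induction S)
      case (insert g S)
      then obtain m where m: "S \<subseteq> ideal_gen P ?T (s ` {..<m})" by blast
      have "g \<in> ideal_gen P ?T (range s)" using insert.prems unfolding J_def by simp
      from ideal_gen_finite[OF this]
      obtain U where U: "U \<subseteq> range s" "finite U" "g \<in> ideal_gen P ?T U" by blast
      then obtain N where N: "finite N" "U = s ` N" by (meson finite_subset_image)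
      have sub: "s ` {..<m} \<subseteq> s ` {..<max m (Suc (Max (insert 0 N)))}"
        "U \<subseteq> s ` {..<max m (Suc (Max (insert 0 N)))}"
        using N by (auto intro!: image_mono simp: le_imp_less_Suc less_max_iff_disj)
      then show ?case
        using m U(3) ideal_gen_mono[OF sub(1), of P ?T] ideal_gen_mono[OF sub(2), of P ?T] by blast
    qed auto
    then obtain m where "S \<subseteq> ideal_gen P ?T (s ` {..<m})" ..
    from J T.ideal_gen_idem[OF this] have "J \<subseteq> ideal_gen P ?T (s ` {..<m})"
      by (rule subset_trans)
    moreover have "s m \<in> J" unfolding J_def by (rule T.ideal_gen_base[OF rangeI])
    ultimately have "s m \<in> ideal_gen P ?T (s ` {..<m})" by (rule subsetD)
    with s(2)[of m] show False by (rule notE)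
  qed
  define deg where "deg g = (LEAST n. g \<in> poly_below P ?R t n)" for g
  have deg: "g \<in> poly_below P ?R t (deg g)" if "g \<in> ?T" for g
    unfolding deg_def using generated_insert_poly[OF that] by (rule LeastI_ex)
  \<comment> \<open>The premise \<open>G ` {..<k} \<subseteq> J\<close> makes a choice possible at every stage; it then holds by induction.\<close>
  define good where "good G k g \<longleftrightarrow> G ` {..<k} \<subseteq> J \<longrightarrow>
      g \<in> J - ideal_gen P ?T (G ` {..<k}) \<and>
      (\<forall>g'\<in>J - ideal_gen P ?T (G ` {..<k}). deg g \<le> deg g')" for G and k :: nat and g
  have "\<exists>G. \<forall>k::nat. good G k (G k)"
  proof (rule dependent_wellorder_choice)
    fix r and f g :: "nat \<Rightarrow> 'a \<Rightarrow> complex" and k :: nat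
    assume "\<And>y. y < k \<Longrightarrow> f y = g y"
    then have "f ` {..<k} = g ` {..<k}" by auto
    then show "good f k r = good g k r" unfolding good_def by simp
  next
    fix k :: nat and f :: "nat \<Rightarrow> 'a \<Rightarrow> complex"
    show "\<exists>r. good f k r"
    proof (cases "f ` {..<k} \<subseteq> J")
      case True
      then obtain g where "g \<in> J - ideal_gen P ?T (f ` {..<k})" using not_fg[of "f ` {..<k}"] by auto
      from ex_has_least_nat[of "\<lambda>g. g \<in> J - ideal_gen P ?T (f ` {..<k})", OF this, of deg]
      show ?thesis unfolding good_def by blast
    qed (auto simp: good_def)
  qed
  then obtain G where "\<forall>k. good G k (G k)" by blast
  moreover have GJ: "G ` {..<k} \<subseteq> J" for k
  proof (induction k)
    case (Suc k)
    then show ?case using \<open>\<forall>k. good G k (G k)\<close> by (auto simp: good_def lessThan_Suc)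
  qed auto
  ultimately have G: "G k \<in> J - ideal_gen P ?T (G ` {..<k})"
    and least: "\<And>g'. g' \<in> J - ideal_gen P ?T (G ` {..<k}) \<Longrightarrow> deg (G k) \<le> deg g'" for k
    unfolding good_def by blast+
  have GT: "G k \<in> ?T" for k using G JT by blast
  have deg_mono: "deg (G i) \<le> deg (G k)" if "i \<le> k" for i k
  proof (rule least)
    have "ideal_gen P ?T (G ` {..<i}) \<subseteq> ideal_gen P ?T (G ` {..<k})"
      by (rule ideal_gen_mono) (use that in auto)
    then show "G k \<in> J - ideal_gen P ?T (G ` {..<i})" using G[of k] by blast
  qed
  have "deg (G k) \<noteq> 0" for k
  proof
    assume "deg (G k) = 0"
    then have "G k x = 0" if "x \<in> P" for x
      using deg[OF GT[of k]] that by (simp add: poly_below_def)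
    then have "G k \<in> ideal_gen P ?T (G ` {..<k})" by (rule ideal_gen.zero)
    then show False using G by blast
  qed
  then have "\<forall>k. \<exists>d. deg (G k) = Suc d" using not0_implies_Suc by blast
  then obtain d where d: "\<And>k. deg (G k) = Suc (d k)" by metis
  have "\<forall>k. \<exists>a\<in>?R. (\<lambda>x. G k x - a x * t x ^ d k) \<in> poly_below P ?R t (d k)"
    using deg[OF GT] d R.poly_below_Suc by metis
  then obtain a where a: "\<And>k. a k \<in> ?R"
      "\<And>k. (\<lambda>x. G k x - a k x * t x ^ d k) \<in> poly_below P ?R t (d k)" by metis
  obtain k where "a k \<in> ideal_gen P ?R (a ` {..<k})"
    using R a(1) unfolding noetherian_def by blast
  from R.ideal_gen_sequence[OF this] obtain r where r: "\<And>i. i < k \<Longrightarrow> r i \<in> ?R"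
      "\<And>x. x \<in> P \<Longrightarrow> a k x = (\<Sum>i<k. r i x * a i x)" by blast
  \<comment> \<open>The shift by \<open>t ^ (d k - d i)\<close> brings all leading terms to degree \<open>d k\<close>.\<close>
  define c where "c = (\<lambda>x. \<Sum>i<k. r i x * t x ^ (d k - d i) * G i x)"
  have dk: "d i \<le> d k" if "i < k" for i using deg_mono[of i k] d that by auto
  have summand: "(\<lambda>x. r i x * t x ^ (d k - d i) * G i x) \<in> ideal_gen P ?T (G ` {..<k})" if "i < k" for i
    by (intro T.ideal_gen_mult T.mult tpow T.ideal_gen_base) (use that r(1) RT in auto)
  have c: "c \<in> ideal_gen P ?T (G ` {..<k})"
  proof -
    have "(\<lambda>x. \<Sum>i\<in>I. r i x * t x ^ (d k - d i) * G i x) \<in> ideal_gen P ?T (G ` {..<k})"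
      if "finite I" "I \<subseteq> {..<k}" for I
      using that by (induction I) (auto intro: ideal_gen.zero ideal_gen_add summand)
    then show ?thesis unfolding c_def by blast
  qed
  have cJ: "c \<in> J" using c T.ideal_gen_idem[of "G ` {..<k}" "range s"] GJ unfolding J_def by blast
  define g where "g = (\<lambda>x. G k x - c x)"
  have mc: "(\<lambda>x. (-1) * c x) \<in> ideal_gen P ?T (G ` {..<k})" "(\<lambda>x. (-1) * c x) \<in> J"
    using T.ideal_gen_mult[OF T.const[of "-1"] c] T.ideal_gen_mult[OF T.const[of "-1"], of c] cJ
    unfolding J_def by blast+
  have "g \<in> J" unfolding J_def
    by (rule ideal_gen_cong[OF ideal_gen_add[of "G k" _ _ _ "\<lambda>x. (-1) * c x"]])
      (use G[of k] mc in \<open>auto simp: J_def g_def\<close>)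
  moreover have "g \<notin> ideal_gen P ?T (G ` {..<k})"
  proof
    assume "g \<in> ideal_gen P ?T (G ` {..<k})"
    from ideal_gen_add[OF this c] have "G k \<in> ideal_gen P ?T (G ` {..<k})" by (simp add: g_def)
    then show False using G by blast
  qed
  ultimately have "deg (G k) \<le> deg g" using least by blast
  moreover have "g \<in> poly_below P ?R t (d k)"
  proof -
    let ?l = "\<lambda>i x. G i x - a i x * t x ^ d i"
    have "(\<lambda>x. ?l k x + (\<Sum>i<k. (- 1) * r i x * (t x ^ (d k - d i) * ?l i x))) \<in> poly_below P ?R t (d k)"
      by (intro R.poly_below_add R.poly_below_sum R.poly_below_scale R.poly_below_power[OF a(2)] a(2)
          R.mult R.const r(1)) (use dk in auto)
    then show ?thesis
    proof (rule R.poly_below_cong)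
      fix x assume x: "x \<in> P"
      have "t x ^ (d k - d i) * t x ^ d i = t x ^ d k" if "i < k" for i
        using dk[OF that] by (simp flip: power_add)
      then have "(\<Sum>i<k. (- 1) * r i x * (t x ^ (d k - d i) * ?l i x)) =
          (\<Sum>i<k. r i x * a i x * t x ^ d k - r i x * t x ^ (d k - d i) * G i x)"
        by (intro sum.cong) (auto simp: algebra_simps)
      then show "g x = ?l k x + (\<Sum>i<k. (- 1) * r i x * (t x ^ (d k - d i) * ?l i x))"
        using r(2)[OF x] by (simp add: g_def c_def sum_subtractf sum_distrib_right)
    qed
  qed
  then have "deg g \<le> d k" unfolding deg_def by (rule Least_le)
  ultimately show False using d by simp
qed

lemma generated_empty_const:
  "f \<in> generated_algebra P {} \<Longrightarrow> \<exists>c. \<forall>x\<in>P. f x = c"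
proof (induction rule: generated_algebra.induct)
  case (cong f g) then show ?case by auto
next
  case (add f g) then show ?case by metis
next
  case (mult f g) then show ?case by metis
qed auto

theorem hilbert_basis:
  assumes "finite F"
  shows "noetherian P (generated_algebra P F)"
  using assms
proof induction
  case empty
  interpret function_algebra P "generated_algebra P {}" by (rule function_algebra_generated)
  show ?case unfolding noetherian_def
  proof (intro allI impI)
    fix s :: "nat \<Rightarrow> 'a \<Rightarrow> complex" assume s: "range s \<subseteq> generated_algebra P {}"
    have c: "\<exists>c. \<forall>x\<in>P. s k x = c" for k using generated_empty_const s by blast
    show "\<exists>k. s k \<in> ideal_gen P (generated_algebra P {}) (s ` {..<k})"
    proof (cases "\<forall>x\<in>P. s 0 x = 0")
      case True then show ?thesis by (intro exI[of _ 0] ideal_gen.zero) auto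
    next
      case False
      obtain c0 where c0: "\<forall>x\<in>P. s 0 x = c0" using c by blast
      then have "c0 \<noteq> 0" using False by auto
      obtain c1 where c1: "\<forall>x\<in>P. s 1 x = c1" using c by blast
      have "s 1 \<in> ideal_gen P (generated_algebra P {}) (s ` {..<1})"
        by (rule ideal_gen.step[OF ideal_gen.zero[of P "\<lambda>x. 0"] const[of "c1 / c0"], of "s 0"])
          (use c0 c1 \<open>c0 \<noteq> 0\<close> in auto)
      then show ?thesis by blast
    qed
  qed
next
  case (insert t F)
  then show ?case using noetherian_insert by blast
qed

text \<open>
  Strictly decreasing closed sets would yield functions \<open>f k\<close> vanishing on the next set but not
  at some point of the current one, so none would lie in the ideal of its predecessors.
\<close>

lemma noetherian_minimal_closed:
  assumes B: "fspace_algebra B" and N: "noetherian (pts B) (reg B)"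
    and "\<C> \<noteq> {}" and closed: "\<And>Z. Z \<in> \<C> \<Longrightarrow> closedin (zariski B) Z"
  shows "\<exists>Z\<in>\<C>. \<forall>W\<in>\<C>. \<not> W \<subset> Z"
proof (rule ccontr)
  assume "\<not> ?thesis"
  then have "\<forall>Z\<in>\<C>. \<exists>W. W \<in> \<C> \<and> W \<subset> Z" by blast
  moreover obtain Z0 where "Z0 \<in> \<C>" using \<open>\<C> \<noteq> {}\<close> by blast
  ultimately obtain Z :: "nat \<Rightarrow> _" where Z: "\<And>k. Z k \<in> \<C>" "\<And>k. Z (Suc k) \<subset> Z k"
    using dependent_nat_choice[of "\<lambda>_ W. W \<in> \<C>" "\<lambda>_ W W'. W' \<subset> W"] by metis
  have "\<exists>f z. f \<in> reg B \<and> z \<in> Z k \<and> f z \<noteq> 0 \<and> (\<forall>w\<in>Z (Suc k). f w = 0)" for k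
  proof -
    obtain z where z: "z \<in> Z k" "z \<notin> Z (Suc k)" using Z(2) by blast
    moreover have "Z k \<subseteq> pts B" "closedin (zariski B) (Z (Suc k))"
      using closed[OF Z(1)] closedin_zariski[OF B] by blast+
    ultimately show ?thesis unfolding closedin_zariski[OF B] by blast
  qed
  then obtain f z where fz: "\<And>k. f k \<in> reg B" "\<And>k. z k \<in> Z k" "\<And>k. f k (z k) \<noteq> 0"
      "\<And>k w. w \<in> Z (Suc k) \<Longrightarrow> f k w = 0" by metis
  obtain k where k: "f k \<in> ideal_gen (pts B) (reg B) (f ` {..<k})"
    using N fz(1) unfolding noetherian_def by blast
  have anti: "Z k \<subseteq> Z (Suc i)" if "i < k" for i
    using lift_Suc_antimono_le[of Z "Suc i" k] Z(2) that by auto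
  have "z k \<in> pts B" using closed[OF Z(1)] fz(2) closedin_zariski[OF B] by blast
  then have "f k (z k) = 0"
    by (rule ideal_gen_vanish[OF k]) (use fz(2,4) anti in blast)
  then show False using fz(3) by blast
qed

text \<open>A minimal clopen set around \<open>x\<close> is connected, hence is the component of \<open>x\<close>.\<close>

lemma clopen_component:
  assumes B: "fspace_algebra B" and N: "noetherian (pts B) (reg B)"
    and Y: "closedin (zariski B) Y" and x: "x \<in> Y"
  defines "C \<equiv> connected_component_of_set (subtopology (zariski B) Y) x"
  shows "openin (subtopology (zariski B) Y) C" "closedin (subtopology (zariski B) Y) C"
proof -
  let ?T = "subtopology (zariski B) Y"
  have top: "topspace ?T = Y"
    using Y closedin_subset by (fastforce simp: topspace_subtopology)
  define \<C> where "\<C> = {U. openin ?T U \<and> closedin ?T U \<and> x \<in> U}"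
  have "Y \<in> \<C>" using x top openin_topspace[of ?T] closedin_topspace[of ?T] by (simp add: \<C>_def)
  then obtain U where U: "U \<in> \<C>" "\<And>W. W \<in> \<C> \<Longrightarrow> \<not> W \<subset> U"
    using noetherian_minimal_closed[OF B N, of \<C>] closedin_trans_full[OF _ Y]
    unfolding \<C>_def by blast
  have conn: "connectedin ?T U"
  proof (rule ccontr)
    assume "\<not> connectedin ?T U"
    then obtain V W where VW: "closedin (subtopology ?T U) V" "closedin (subtopology ?T U) W"
        "V \<union> W = U" "V \<inter> W = {}" "V \<noteq> {}" "W \<noteq> {}"
      using U(1) unfolding connectedin_def connected_space_closedin_eq \<C>_def
      by (metis (no_types, lifting) closedin_subset mem_Collect_eq topspace_subtopology_subset)
    have cl: "closedin ?T V" "closedin ?T W"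
      using VW U(1) closedin_trans_full unfolding \<C>_def by blast+
    have "V = U - W" "W = U - V" using VW by blast+
    then have op: "openin ?T V" "openin ?T W"
      using cl U(1) unfolding \<C>_def by (metis mem_Collect_eq openin_diff)+
    have "x \<in> V \<or> x \<in> W" using U(1) VW(3) unfolding \<C>_def by blast
    then have "V \<in> \<C> \<or> W \<in> \<C>" using cl op unfolding \<C>_def by blast
    moreover have "V \<subset> U" "W \<subset> U" using VW by blast+
    ultimately show False using U(2) by blast
  qed
  have "C = U"
  proof
    show "U \<subseteq> C" unfolding C_def
      by (rule connected_component_of_maximal[OF conn]) (use U(1) in \<open>auto simp: \<C>_def\<close>)
    have "connectedin ?T C" unfolding C_def by (rule connectedin_connected_component_of)
    moreover have "x \<in> C" unfolding C_def using x top by (simp add: connected_component_of_refl)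
    ultimately show "C \<subseteq> U"
      using connectedin_clopen_cases[of ?T C U] U(1) unfolding \<C>_def disjnt_def by blast
  qed
  then show "openin ?T C" "closedin ?T C" using U(1) by (auto simp: \<C>_def)
qed

section \<open>A Nullstellensatz for complex function algebras\<close>

lemma vector_space_functions: "vector_space (\<lambda>(c::complex) f (x::'a). c * f x)"
  by unfold_locales (auto simp: fun_eq_iff algebra_simps)

text \<open>
  A countable set has only countably many finite subsets, and the span of each of them contains only
  finitely many vectors of an independent set.
\<close>

lemma (in vector_space) countable_independent:
  assumes "countable B" "independent S" "S \<subseteq> span B"
  shows "countable S"
proof -
  have "S \<subseteq> (\<Union>T\<in>{T. finite T \<and> T \<subseteq> B}. S \<inter> span T)"
  proof
    fix v assume v: "v \<in> S"
    then obtain T where "finite T" "T \<subseteq> B" "v \<in> span T"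
      using assms(3) unfolding span_explicit[of B]
      by (auto simp: subset_eq) (metis (no_types, lifting) span_base span_scale span_sum)
    then show "v \<in> (\<Union>T\<in>{T. finite T \<and> T \<subseteq> B}. S \<inter> span T)" using v by blast
  qed
  moreover have "countable (\<Union>T\<in>{T. finite T \<and> T \<subseteq> B}. S \<inter> span T)"
  proof (rule countable_UN)
    show "countable {T. finite T \<and> T \<subseteq> B}" by (rule countable_Collect_finite_subset[OF assms(1)])
    fix T assume "T \<in> {T. finite T \<and> T \<subseteq> B}"
    then have "finite (S \<inter> span T)"
      using independent_span_bound[of T "S \<inter> span T"] independent_mono[OF assms(2), of "S \<inter> span T"]
      by blast
    then show "countable (S \<inter> span T)" by (rule countable_finite)
  qed
  ultimately show ?thesis by (rule countable_subset)
qed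

text \<open>
  The monomials in the generators span the algebra. Functions are cut off outside \<open>P\<close>, so that
  agreement on \<open>P\<close> becomes equality in the vector space of functions.
\<close>

lemma generated_countable_span:
  fixes P :: "'a set"
  assumes "countable F"
  shows "\<exists>M. countable M \<and> (\<forall>g\<in>generated_algebra P F.
    (\<lambda>x. if x \<in> P then g x else 0) \<in> module.span (\<lambda>(c::complex) f (x::'a). c * f x) M)"
proof -
  interpret vector_space "\<lambda>(c::complex) f (x::'a). c * f x" by (rule vector_space_functions)
  define mon where "mon l = (\<lambda>x. if x \<in> P then prod_list (map (\<lambda>f. f x) l) else (0::complex))"
    for l :: "('a \<Rightarrow> complex) list"
  define M where "M = mon ` lists F"
  have subsp: "subspace {v. (\<lambda>x. w x * v x) \<in> span M}" for w :: "'a \<Rightarrow> complex"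
  proof (rule subspaceI)
    show "0 \<in> {v. (\<lambda>x. w x * v x) \<in> span M}" using span_zero by (simp add: zero_fun_def)
  next
    fix u v assume "u \<in> {v. (\<lambda>x. w x * v x) \<in> span M}" "v \<in> {v. (\<lambda>x. w x * v x) \<in> span M}"
    then show "u + v \<in> {v. (\<lambda>x. w x * v x) \<in> span M}"
      using span_add[of "\<lambda>x. w x * u x" M "\<lambda>x. w x * v x"] by (simp add: plus_fun_def algebra_simps)
  next
    fix c v assume "v \<in> {v. (\<lambda>x. w x * v x) \<in> span M}"
    then show "(\<lambda>x. c * v x) \<in> {v. (\<lambda>x. w x * v x) \<in> span M}"
      using span_scale[of "\<lambda>x. w x * v x" M c] by (simp add: algebra_simps)
  qed
  have mult_mon: "(\<lambda>x. mon l x * v x) \<in> span M" if "l \<in> lists F" "v \<in> span M" for l v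
    using that(2)
  proof (rule span_induct[OF _ subsp])
    fix v assume "v \<in> M"
    then obtain l' where "l' \<in> lists F" "v = mon l'" by (auto simp: M_def)
    then have "(\<lambda>x. mon l x * v x) = mon (l @ l')" "l @ l' \<in> lists F"
      using that(1) by (auto simp: mon_def)
    then show "(\<lambda>x. mon l x * v x) \<in> span M" using span_base[of "mon (l @ l')" M] by (auto simp: M_def)
  qed
  have mult_span: "(\<lambda>x. v x * w x) \<in> span M" if "v \<in> span M" "w \<in> span M" for v w
  proof -
    have "(\<lambda>x. w x * v x) \<in> span M"
      using that(1)
    proof (rule span_induct[OF _ subsp])
      fix v assume "v \<in> M"
      then obtain l where "l \<in> lists F" "v = mon l" by (auto simp: M_def)
      then show "(\<lambda>x. w x * v x) \<in> span M"
        using mult_mon[OF _ that(2), of l] by (simp add: mult.commute)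
    qed
    then show ?thesis by (simp add: mult.commute)
  qed
  have "(\<lambda>x. if x \<in> P then g x else 0) \<in> span M" if "g \<in> generated_algebra P F" for g
    using that
  proof induction
    case (base f)
    then have "mon [f] \<in> span M" by (intro span_base) (auto simp: M_def)
    then show ?case by (simp add: mon_def cong: if_cong)
  next
    case (const c)
    have "mon [] \<in> span M" by (intro span_base) (auto simp: M_def)
    then have "(\<lambda>x. c * mon [] x) \<in> span M" by (rule span_scale)
    moreover have "(\<lambda>x. c * mon [] x) = (\<lambda>x. if x \<in> P then c else 0)" by (auto simp: mon_def)
    ultimately show ?case by simp
  next
    case (add f g)
    have "(\<lambda>x. if x \<in> P then f x + g x else 0) =
        (\<lambda>x. if x \<in> P then f x else 0) + (\<lambda>x. if x \<in> P then g x else 0)"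
      by (auto simp: plus_fun_def)
    then show ?case using span_add[OF add.IH] by simp
  next
    case (mult f g)
    have "(\<lambda>x. if x \<in> P then f x * g x else 0) =
        (\<lambda>x. (if x \<in> P then f x else 0) * (if x \<in> P then g x else 0))"
      by auto
    then show ?case using mult_span[OF mult.IH] by simp
  next
    case (cong f g)
    have "(\<lambda>x. if x \<in> P then g x else 0) = (\<lambda>x. if x \<in> P then f x else 0)" using cong(2) by auto
    then show ?case using cong.IH by simp
  qed
  moreover have "countable M" unfolding M_def using assms by (intro countable_image countable_lists)
  ultimately show ?thesis by blast
qed

context function_algebra
begin

lemma poly_mem: "g \<in> R \<Longrightarrow> (\<lambda>x. poly p (g x)) \<in> R"
proof (induction p)
  case 0
  show ?case using const[of 0] by simp
next
  case (pCons a p)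
  then show ?case using add[OF const[of a] mult[of g "\<lambda>x. poly p (g x)"]] by simp
qed

lemma ideal_gen_insert:
  assumes M: "ideal_gen P R M \<subseteq> M" and "h \<in> ideal_gen P R (insert g M)"
  shows "\<exists>m\<in>M. \<exists>r\<in>R. \<forall>x\<in>P. h x = m x + r x * g x"
  using assms(2)
proof induction
  case (zero h)
  have "(\<lambda>x. 0) \<in> M" using M ideal_gen.zero[of P "\<lambda>x. 0" R M] by auto
  then show ?case using zero const[of 0] by (intro bexI[of _ "\<lambda>x. 0"]) auto
next
  case (step h r s h')
  then obtain m r' where mr: "m \<in> M" "r' \<in> R" "\<forall>x\<in>P. h x = m x + r' x * g x" by blast
  show ?case
  proof (cases "s = g")
    case True
    then show ?thesis using mr step(2,4) add[OF mr(2) step(2)]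
      by (intro bexI[OF _ mr(1)] bexI[of _ "\<lambda>x. r' x + r x"]) (auto simp: algebra_simps)
  next
    case False
    then have "(\<lambda>x. m x + r x * s x) \<in> ideal_gen P R M"
      using step(2,3) mr(1) by (intro ideal_gen_add ideal_gen_mult ideal_gen_base) auto
    then have "(\<lambda>x. m x + r x * s x) \<in> M" using M by blast
    then show ?thesis using mr step(4)
      by (intro bexI[of _ "\<lambda>x. m x + r x * s x"] bexI[OF _ mr(2)]) auto
  qed
qed

end

text \<open>
  The residue field of a maximal ideal \<open>M\<close> is the complex numbers. If no \<open>g - c\<close> lies in \<open>M\<close>, each
  has an inverse \<open>r c\<close> modulo \<open>M\<close>. These uncountably many functions live in a space of countable
  dimension, so they satisfy a linear relation; clearing denominators gives a nonzero polynomial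
  \<open>p\<close> with \<open>p(g)\<close> in \<open>M\<close>, which splits into linear factors, none of which is in \<open>M\<close>.
\<close>

lemma maximal_ideal_residue:
  fixes P :: "'a set"
  assumes F: "countable F" and R_def: "R = generated_algebra P F"
    and ideal: "ideal_gen P R M \<subseteq> M" and proper: "(\<lambda>x. 1) \<notin> M"
    and maximal: "\<And>g. g \<in> R \<Longrightarrow> g \<notin> M \<Longrightarrow> (\<lambda>x. 1) \<in> ideal_gen P R (insert g M)"
    and g: "g \<in> R"
  shows "\<exists>c. (\<lambda>x. g x - c) \<in> M"
proof (rule ccontr)
  assume no: "\<nexists>c. (\<lambda>x. g x - c) \<in> M"
  interpret R: function_algebra P R unfolding R_def by (rule function_algebra_generated)
  interpret V: vector_space "\<lambda>(c::complex) f (x::'a). c * f x" by (rule vector_space_functions)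
  have M_mult: "(\<lambda>x. r x * m x) \<in> M" if "r \<in> R" "m \<in> M" for r m
    using R.ideal_gen_mult[OF that(1) R.ideal_gen_base[OF that(2)]] ideal by blast
  have M_add: "(\<lambda>x. l x + m x) \<in> M" if "l \<in> M" "m \<in> M" for l m
    using ideal_gen_add[OF R.ideal_gen_base[OF that(1)] R.ideal_gen_base[OF that(2)]] ideal by blast
  have M_zero: "h \<in> M" if "\<And>x. x \<in> P \<Longrightarrow> h x = 0" for h
    using ideal_gen.zero[of P h R M, OF that] ideal by blast
  have M_cong: "h \<in> M" if "m \<in> M" "\<And>x. x \<in> P \<Longrightarrow> h x = m x" for h m
    using ideal_gen_cong[OF R.ideal_gen_base[OF that(1)] that(2)] ideal by blast
  have M_sum: "(\<lambda>x. \<Sum>i\<in>I. f i x) \<in> M" if "\<And>i. i \<in> I \<Longrightarrow> f i \<in> M" for I and f :: "complex \<Rightarrow> _"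
    using that by (induction I rule: infinite_finite_induct) (auto intro: M_zero M_add)
  have "\<exists>r m. r \<in> R \<and> m \<in> M \<and> (\<forall>x\<in>P. 1 = m x + r x * (g x - c))" for c
  proof -
    have "(\<lambda>x. g x - c) \<in> R" "(\<lambda>x. g x - c) \<notin> M" using no g by (auto intro: R.diff R.const)
    from R.ideal_gen_insert[OF ideal maximal[OF this]] show ?thesis by blast
  qed
  then obtain r m where r: "\<And>c. r c \<in> R" and m: "\<And>c. m c \<in> M"
    and inv: "\<And>c x. x \<in> P \<Longrightarrow> 1 = m c x + r c x * (g x - c)" by metis
  have poly_notin: "p = 0" if "(\<lambda>x. poly p (g x)) \<in> M" for p
    using that
  proof (induction "degree p" arbitrary: p)
    case 0
    then obtain a where a: "p = [:a:]" by (metis degree_eq_zeroE)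
    show ?case
    proof (rule ccontr)
      assume "p \<noteq> 0"
      then have "a \<noteq> 0" using a by auto
      have "(\<lambda>x. (1 / a) * poly p (g x)) \<in> M" by (rule M_mult[OF R.const 0(2)])
      then show False using proper a \<open>a \<noteq> 0\<close> by simp
    qed
  next
    case (Suc n)
    then have "\<not> constant (poly p)" by (simp add: constant_degree)
    then obtain c where "poly p c = 0" using fundamental_theorem_of_algebra by blast
    then obtain q where q: "p = [:- c, 1:] * q" by (auto simp: poly_eq_0_iff_dvd)
    have "q \<noteq> 0" using q Suc(2) by auto
    then have "degree p = degree [:- c, 1:] + degree q" unfolding q by (intro degree_mult_eq) auto
    then have "n = degree q" using Suc(2) by simp
    moreover have "(\<lambda>x. poly q (g x)) \<in> M"
    proof (rule M_cong)
      show "(\<lambda>x. poly q (g x) * m c x + r c x * poly p (g x)) \<in> M"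
        by (intro M_add M_mult R.poly_mem g m r Suc.prems)
      fix x assume "x \<in> P"
      then have "poly q (g x) = poly q (g x) * (m c x + r c x * (g x - c))" using inv by simp
      also have "\<dots> = poly q (g x) * m c x + r c x * poly p (g x)"
        by (simp add: q algebra_simps)
      finally show "poly q (g x) = poly q (g x) * m c x + r c x * poly p (g x)" .
    qed
    ultimately have "q = 0" by (rule Suc(1))
    then show ?case using q by simp
  qed
  \<comment> \<open>Inverses for different \<open>c\<close> differ: a common one, multiplied by \<open>d - c\<close>, would lie in \<open>M\<close>.\<close>
  define \<rho> where "\<rho> c = (\<lambda>x. if x \<in> P then r c x else 0)" for c
  have inj: "inj \<rho>"
  proof (rule injI, rule ccontr)
    fix c d assume eq: "\<rho> c = \<rho> d" "c \<noteq> d"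
    have rcd: "r c x = r d x" if "x \<in> P" for x using fun_cong[OF eq(1), of x] that by (simp add: \<rho>_def)
    have "(\<lambda>x. (1 / (d - c)) * (m d x + (-1) * m c x)) \<in> M"
      by (intro M_mult M_add m R.const)
    then have "r c \<in> M"
    proof (rule M_cong)
      fix x assume x: "x \<in> P"
      have mc: "m c x = 1 - r c x * (g x - c)" using inv[OF x, of c] by (metis add_diff_cancel_right')
      have md: "m d x = 1 - r c x * (g x - d)"
        using inv[OF x, of d] rcd[OF x] by (metis add_diff_cancel_right')
      have "m d x - m c x = r c x * (d - c)" unfolding mc md by (simp add: algebra_simps)
      then show "r c x = (1 / (d - c)) * (m d x + (-1) * m c x)" using eq(2) by simp
    qed
    have "(\<lambda>x. m c x + (g x - c) * r c x) \<in> M"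
      by (intro M_add m M_mult \<open>r c \<in> M\<close> R.diff g R.const)
    then have "(\<lambda>x. 1) \<in> M" by (rule M_cong) (use inv in \<open>simp add: mult.commute\<close>)
    then show False using proper by blast
  qed
  have "uncountable (range \<rho>)"
  proof
    assume "countable (range \<rho>)"
    then have "countable (UNIV :: complex set)" using inj by (rule countable_image_inj_on)
    then show False using uncountable_UNIV_complex by blast
  qed
  moreover obtain B where "countable B" "\<And>g. g \<in> R \<Longrightarrow> (\<lambda>x. if x \<in> P then g x else 0) \<in> V.span B"
    using generated_countable_span[OF F, of P] unfolding R_def by blast
  moreover have "range \<rho> \<subseteq> V.span B" using calculation(3) r unfolding \<rho>_def by blast
  ultimately have "V.dependent (range \<rho>)" using V.countable_independent by blast
  then obtain T u where T: "finite T" "T \<subseteq> range \<rho>" "\<exists>v\<in>T. u v \<noteq> 0" "(\<Sum>v\<in>T. (\<lambda>x. u v * v x)) = 0"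
    unfolding V.dependent_explicit by blast
  obtain D where D: "finite D" "T = \<rho> ` D" using T(1,2) finite_subset_image by meson
  define a where "a c = u (\<rho> c)" for c
  have rel: "(\<Sum>c\<in>D. a c * r c x) = 0" if "x \<in> P" for x
  proof -
    have "(\<Sum>v\<in>T. (\<lambda>x. u v * v x)) x = (\<Sum>v\<in>T. u v * v x)"
      using T(1) by (induction T) auto
    also have "\<dots> = (\<Sum>c\<in>D. u (\<rho> c) * \<rho> c x)"
      unfolding D(2) by (subst sum.reindex) (use inj in \<open>auto intro: inj_on_subset\<close>)
    finally show ?thesis using T(4) that by (simp add: a_def \<rho>_def)
  qed
  \<comment> \<open>The linear relation multiplied by the common denominator; \<open>p\<close> does not vanish at a \<open>c\<close> with \<open>a c \<noteq> 0\<close>.\<close>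
  define p where "p = (\<Sum>c\<in>D. Polynomial.smult (a c) (\<Prod>d\<in>D - {c}. [:- d, 1:]))"
  have "(\<lambda>x. \<Sum>c\<in>D. (a c * (\<Prod>d\<in>D - {c}. (g x - d))) * m c x) \<in> M"
    by (intro M_sum M_mult R.mult R.const R.prod R.diff g m)
  then have "(\<lambda>x. poly p (g x)) \<in> M"
  proof (rule M_cong)
    fix x assume x: "x \<in> P"
    have "poly p (g x) = (\<Sum>c\<in>D. a c * (\<Prod>d\<in>D - {c}. (g x - d)) * 1)"
      by (simp add: p_def poly_sum poly_prod)
    also have "\<dots> = (\<Sum>c\<in>D. a c * (\<Prod>d\<in>D - {c}. (g x - d)) * (m c x + r c x * (g x - c)))"
      using inv[OF x] by simp
    also have "\<dots> = (\<Sum>c\<in>D. a c * (\<Prod>d\<in>D - {c}. (g x - d)) * m c x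
        + (\<Prod>d\<in>D. (g x - d)) * (a c * r c x))"
    proof (rule sum.cong[OF refl])
      fix c assume "c \<in> D"
      then have pr: "(\<Prod>d\<in>D. (g x - d)) = (g x - c) * (\<Prod>d\<in>D - {c}. (g x - d))"
        using D(1) by (rule prod.remove[rotated])
      show "a c * (\<Prod>d\<in>D - {c}. (g x - d)) * (m c x + r c x * (g x - c)) =
        a c * (\<Prod>d\<in>D - {c}. (g x - d)) * m c x + (\<Prod>d\<in>D. (g x - d)) * (a c * r c x)"
        unfolding pr by (simp add: algebra_simps)
    qed
    also have "\<dots> = (\<Sum>c\<in>D. (a c * (\<Prod>d\<in>D - {c}. (g x - d))) * m c x)"
      by (simp add: sum.distrib rel[OF x] flip: sum_distrib_left)
    finally show "poly p (g x) = (\<Sum>c\<in>D. (a c * (\<Prod>d\<in>D - {c}. (g x - d))) * m c x)" .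
  qed
  then have "p = 0" by (rule poly_notin)
  obtain c where c: "c \<in> D" "a c \<noteq> 0" using T(3) D(2) by (auto simp: a_def)
  have "poly p c = (\<Sum>e\<in>D. if e = c then a c * (\<Prod>d\<in>D - {c}. (c - d)) else 0)"
    unfolding p_def poly_sum
  proof (rule sum.cong[OF refl])
    fix e assume "e \<in> D"
    have "(\<Prod>d\<in>D - {e}. (c - d)) = 0" if "e \<noteq> c" using D(1) c(1) that by (auto simp: prod_zero_iff)
    then show "poly (Polynomial.smult (a e) (\<Prod>d\<in>D - {e}. [:- d, 1:])) c =
      (if e = c then a c * (\<Prod>d\<in>D - {c}. (c - d)) else 0)"
      by (auto simp: poly_prod)
  qed
  also have "\<dots> \<noteq> 0" using D(1) c by auto
  finally show False using \<open>p = 0\<close> by simp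
qed

text \<open>
  Here \<open>\<theta>\<close> ranges over the algebra homomorphisms from the coordinate ring to the complex numbers; the
  last of the three conditions says that \<open>\<theta> f\<close> depends only on the values of \<open>f\<close> on \<open>pts B\<close>.
\<close>

definition characters_are_points :: "'a fspace \<Rightarrow> bool" where
  "characters_are_points B \<longleftrightarrow> (\<forall>\<theta>.
     (\<forall>c. \<theta> (\<lambda>x. c) = (c::complex)) \<and>
     (\<forall>f\<in>reg B. \<forall>g\<in>reg B. \<theta> (\<lambda>x. f x + g x) = \<theta> f + \<theta> g \<and> \<theta> (\<lambda>x. f x * g x) = \<theta> f * \<theta> g) \<and>
     (\<forall>f\<in>reg B. \<forall>g. (\<forall>x\<in>pts B. g x = f x) \<longrightarrow> \<theta> g = \<theta> f) \<longrightarrow>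
     (\<exists>p\<in>pts B. \<forall>f\<in>reg B. \<theta> f = f p))"

text \<open>
  A proper ideal lies in a maximal one, whose residue field is the complex numbers; reduction modulo
  the maximal ideal is thus a character, that is, evaluation at a point.
\<close>

theorem nullstellensatz:
  assumes F: "countable F" and gen: "reg B = generated_algebra (pts B) F"
    and pt: "characters_are_points B"
    and JR: "J \<subseteq> reg B" and proper: "(\<lambda>x. 1) \<notin> ideal_gen (pts B) (reg B) J"
  shows "\<exists>p\<in>pts B. \<forall>f\<in>J. f p = 0"
proof -
  let ?R = "reg B" and ?I = "ideal_gen (pts B) (reg B)"
  interpret R: function_algebra "pts B" ?R unfolding gen by (rule function_algebra_generated)
  define \<I> where "\<I> = {I. I \<subseteq> ?R \<and> ?I I \<subseteq> I \<and> J \<subseteq> I \<and> (\<lambda>x. 1) \<notin> I}"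
  have "\<exists>M\<in>\<I>. \<forall>I\<in>\<I>. M \<subseteq> I \<longrightarrow> I = M"
  proof (rule subset_Zorn_nonempty)
    show "\<I> \<noteq> {}"
    proof -
      have "?I J \<in> \<I>"
        using proper R.ideal_gen_subset[OF JR] R.ideal_gen_idem[of "?I J" J] R.ideal_gen_base[of _ J]
        unfolding \<I>_def by blast
      then show ?thesis by blast
    qed
    fix \<C> assume ne: "\<C> \<noteq> {}" and chain: "subset.chain \<I> \<C>"
    then have CI: "\<And>I. I \<in> \<C> \<Longrightarrow> I \<in> \<I>" unfolding subset_chain_def by blast
    have "?I (\<Union>\<C>) \<subseteq> \<Union>\<C>"
    proof
      fix h assume "h \<in> ?I (\<Union>\<C>)"
      from ideal_gen_finite[OF this]
      obtain T where T: "T \<subseteq> \<Union>\<C>" "finite T" "h \<in> ?I T" by blast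
      obtain I where I: "I \<in> \<C>" "T \<subseteq> I"
        using finite_subset_Union_chain[OF T(2,1) ne chain] by blast
      have "h \<in> ?I I" using T(3) by (rule subsetD[OF ideal_gen_mono[OF I(2)]])
      moreover have "?I I \<subseteq> I" using CI[OF I(1)] unfolding \<I>_def by simp
      ultimately show "h \<in> \<Union>\<C>" using I(1) by blast
    qed
    moreover have "J \<subseteq> \<Union>\<C>" "\<Union>\<C> \<subseteq> ?R" "(\<lambda>x. 1) \<notin> \<Union>\<C>" using ne CI unfolding \<I>_def by blast+
    ultimately show "\<Union>\<C> \<in> \<I>" unfolding \<I>_def by blast
  qed
  then obtain M where "M \<in> \<I>" and max: "\<And>I. I \<in> \<I> \<Longrightarrow> M \<subseteq> I \<Longrightarrow> I = M" by blast
  then have M: "M \<subseteq> ?R" "?I M \<subseteq> M" "J \<subseteq> M" "(\<lambda>x. 1) \<notin> M" unfolding \<I>_def by blast+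
  have maximal: "(\<lambda>x. 1) \<in> ?I (insert g M)" if g: "g \<in> ?R" "g \<notin> M" for g
  proof (rule ccontr)
    assume "(\<lambda>x. 1) \<notin> ?I (insert g M)"
    moreover have sub: "insert g M \<subseteq> ?I (insert g M)"
      using R.ideal_gen_base[of _ "insert g M"] by (rule subsetI)
    moreover have "J \<subseteq> ?I (insert g M)" using M(3) sub by (meson insert_subset order_trans)
    moreover have "?I (insert g M) \<subseteq> ?R" using R.ideal_gen_subset[of "insert g M"] g M(1) by simp
    ultimately have "?I (insert g M) \<in> \<I>"
      using R.ideal_gen_idem[of "?I (insert g M)" "insert g M"] unfolding \<I>_def by simp
    then have "?I (insert g M) = M" by (rule max) (use sub in simp)
    then show False using sub g(2) by simp
  qed
  have M_mult: "(\<lambda>x. r x * m x) \<in> M" if "r \<in> ?R" "m \<in> M" for r m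
    using R.ideal_gen_mult[OF that(1) R.ideal_gen_base[OF that(2)]] M(2) by (rule subsetD[rotated])
  have M_add: "(\<lambda>x. l x + m x) \<in> M" if "l \<in> M" "m \<in> M" for l m
    using ideal_gen_add[OF R.ideal_gen_base[OF that(1)] R.ideal_gen_base[OF that(2)]] M(2)
    by (rule subsetD[rotated])
  have M_cong: "h \<in> M" if "m \<in> M" "\<And>x. x \<in> pts B \<Longrightarrow> h x = m x" for h m
    using ideal_gen_cong[OF R.ideal_gen_base[OF that(1)] that(2)] M(2) by (rule subsetD[rotated])
  have "\<exists>c. (\<lambda>x. g x - c) \<in> M" if "g \<in> ?R" for g
    using maximal_ideal_residue[OF F gen M(2,4) maximal that] by simp
  then obtain \<theta> where \<theta>: "\<And>g. g \<in> ?R \<Longrightarrow> (\<lambda>x. g x - \<theta> g) \<in> M" by metis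
  have unique: "\<theta> g = c" if "g \<in> ?R" "(\<lambda>x. g x - c) \<in> M" for g c
  proof (rule ccontr)
    assume "\<theta> g \<noteq> c"
    have "(\<lambda>x. (1 / (\<theta> g - c)) * ((g x - c) + (-1) * (g x - \<theta> g))) \<in> M"
      by (intro M_mult R.const M_add that(2) \<theta> that(1))
    then have "(\<lambda>x. 1) \<in> M" by (rule M_cong) (use \<open>\<theta> g \<noteq> c\<close> in \<open>simp add: field_simps\<close>)
    then show False using M(4) by contradiction
  qed
  have M_zero: "(\<lambda>x. 0) \<in> M" using ideal_gen.zero[of "pts B" "\<lambda>x. 0" ?R M] M(2) by auto
  have \<theta>_const: "\<theta> (\<lambda>x. c) = c" for c by (rule unique[OF R.const]) (simp add: M_zero)
  have \<theta>_add: "\<theta> (\<lambda>x. f x + g x) = \<theta> f + \<theta> g" if "f \<in> ?R" "g \<in> ?R" for f g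
  proof (rule unique)
    have "(\<lambda>x. (f x - \<theta> f) + (g x - \<theta> g)) \<in> M" by (intro M_add \<theta> that)
    then show "(\<lambda>x. f x + g x - (\<theta> f + \<theta> g)) \<in> M" by (simp add: algebra_simps)
  qed (intro R.add that)
  have \<theta>_mult: "\<theta> (\<lambda>x. f x * g x) = \<theta> f * \<theta> g" if "f \<in> ?R" "g \<in> ?R" for f g
  proof (rule unique)
    have "(\<lambda>x. g x * (f x - \<theta> f) + \<theta> f * (g x - \<theta> g)) \<in> M"
      by (intro M_add M_mult R.const \<theta> that)
    then show "(\<lambda>x. f x * g x - \<theta> f * \<theta> g) \<in> M" by (simp add: algebra_simps)
  qed (intro R.mult that)
  have \<theta>_cong: "\<theta> g = \<theta> f" if "f \<in> ?R" "\<forall>x\<in>pts B. g x = f x" for f g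
  proof (rule unique)
    show "g \<in> ?R" using R.cong[OF that(1)] that(2) by blast
    show "(\<lambda>x. g x - \<theta> f) \<in> M" by (rule M_cong[OF \<theta>[OF that(1)]]) (use that(2) in auto)
  qed
  have "\<forall>c. \<theta> (\<lambda>x. c) = c" by (intro allI \<theta>_const)
  moreover have "\<forall>f\<in>?R. \<forall>g\<in>?R. \<theta> (\<lambda>x. f x + g x) = \<theta> f + \<theta> g \<and>
      \<theta> (\<lambda>x. f x * g x) = \<theta> f * \<theta> g"
    by (intro ballI conjI \<theta>_add \<theta>_mult)
  moreover have "\<forall>f\<in>?R. \<forall>g. (\<forall>x\<in>pts B. g x = f x) \<longrightarrow> \<theta> g = \<theta> f"
    by (intro ballI allI impI) (rule \<theta>_cong)
  ultimately have "\<exists>p\<in>pts B. \<forall>f\<in>?R. \<theta> f = f p"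
    by (intro pt[unfolded characters_are_points_def, THEN spec[of _ \<theta>], THEN mp] conjI)
  then obtain p where p: "p \<in> pts B" "\<And>f. f \<in> ?R \<Longrightarrow> \<theta> f = f p" by (elim bexE) (rule that, simp_all)
  have "f p = 0" if "f \<in> J" for f
  proof -
    have "f \<in> M" "f \<in> ?R" using that M(1,3) by auto
    then have "\<theta> f = 0" by (intro unique) auto
    then show ?thesis using p(2)[OF \<open>f \<in> ?R\<close>] by simp
  qed
  then show ?thesis using p(1) by blast
qed

text \<open>
  By the Nullstellensatz the ideals of two disjoint closed sets are comaximal; a decomposition of
  \<open>1\<close> separates the sets.
\<close>

lemma closed_separation:
  assumes F: "countable F" and gen: "reg B = generated_algebra (pts B) F"
    and pt: "characters_are_points B"
    and Z: "closedin (zariski B) Z" and W: "closedin (zariski B) W" and ZW: "Z \<inter> W = {}"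
  shows "\<exists>e\<in>reg B. (\<forall>x\<in>Z. e x = 1) \<and> (\<forall>x\<in>W. e x = 0)"
proof -
  have B: "fspace_algebra B" unfolding gen by (rule function_algebra_generated)
  interpret R: function_algebra "pts B" "reg B" by (rule B)
  define I where "I Y = {f \<in> reg B. \<forall>y\<in>Y. f y = 0}" for Y
  have sub: "Z \<subseteq> pts B" "W \<subseteq> pts B" using Z W closedin_zariski[OF B] by blast+
  have "(\<lambda>x. 1) \<in> ideal_gen (pts B) (reg B) (I Z \<union> I W)"
  proof (rule ccontr)
    assume "\<not> ?thesis"
    moreover have "I Z \<union> I W \<subseteq> reg B" by (auto simp: I_def)
    ultimately obtain p where p: "p \<in> pts B" "\<And>f. f \<in> I Z \<union> I W \<Longrightarrow> f p = 0"
      using nullstellensatz[OF F gen pt, of "I Z \<union> I W"] by blast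
    have "p \<in> Y" if Y: "closedin (zariski B) Y" "I Y \<subseteq> I Z \<union> I W" for Y
    proof (rule ccontr)
      assume "p \<notin> Y"
      then obtain f where "f \<in> reg B" "f p \<noteq> 0" "\<forall>z\<in>Y. f z = 0"
        using Y(1) p(1) unfolding closedin_zariski[OF B] by blast
      then show False using p(2)[of f] Y(2) unfolding I_def by blast
    qed
    from this[OF Z] this[OF W] show False using ZW by blast
  qed
  moreover have "\<exists>a\<in>I Z. \<exists>b\<in>I W. \<forall>x\<in>pts B. h x = a x + b x"
    if "h \<in> ideal_gen (pts B) (reg B) (I Z \<union> I W)" for h
    using that
  proof induction
    case (zero h)
    then show ?case by (intro bexI[of _ "\<lambda>x. 0"]) (auto simp: I_def intro: R.const)
  next
    case (step h r s h')
    then obtain a b where ab: "a \<in> I Z" "b \<in> I W" "\<forall>x\<in>pts B. h x = a x + b x" by blast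
    show ?case
    proof (cases "s \<in> I Z")
      case True
      then have "(\<lambda>x. a x + r x * s x) \<in> I Z" using ab(1) step(2) by (auto simp: I_def intro: R.add R.mult)
      then show ?thesis using ab step(4) by (intro bexI[of _ "\<lambda>x. a x + r x * s x"] bexI[of _ b]) auto
    next
      case False
      then have "(\<lambda>x. b x + r x * s x) \<in> I W"
        using ab(2) step(2,3) by (auto simp: I_def intro: R.add R.mult)
      then show ?thesis using ab step(4) by (intro bexI[of _ a] bexI[of _ "\<lambda>x. b x + r x * s x"]) auto
    qed
  qed
  ultimately obtain a b where ab: "a \<in> I Z" "b \<in> I W" "\<forall>x\<in>pts B. 1 = a x + b x" by blast
  have "b x = 1" if "x \<in> Z" for x
  proof -
    have "a x = 0" "x \<in> pts B" using ab(1) that sub by (auto simp: I_def)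
    then show ?thesis using ab(3)[THEN bspec, of x] by simp
  qed
  then show ?thesis using ab(2) by (intro bexI[of _ b]) (auto simp: I_def)
qed

lemma affine_algebraic_set_generated:
  assumes "affine_algebraic_set A"
  shows "\<exists>F. finite F \<and> reg A = generated_algebra (pts A) F"
proof -
  obtain n e where e: "closedin (zariski (affine_space n)) (e ` pts A)"
    and A: "A = induced_space (pts A) e (affine_space n)"
    using assms unfolding affine_algebraic_set_def by blast
  let ?F = "{(\<lambda>x. e x i) | i. i < n}"
  interpret A: function_algebra "pts A" "reg A"
    using fspace_algebra_induced[OF fspace_algebra_affine[of n], of "pts A" e] by (simp only: A[symmetric])
  have sub: "e ` pts A \<subseteq> {..<n} \<rightarrow>\<^sub>E UNIV"
    using e closedin_zariski[OF fspace_algebra_affine, of n] by (metis pts_simps(1))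
  have "reg A \<subseteq> generated_algebra (pts A) ?F"
  proof
    interpret G: function_algebra "pts A" "generated_algebra (pts A) ?F" by (rule function_algebra_generated)
    fix f assume "f \<in> reg A"
    then obtain g where g: "g \<in> reg (affine_space n)" "\<forall>x\<in>pts A. f x = g (e x)"
      by (subst (asm) A) (auto simp: reg_induced)
    have "morphism \<lparr>pts = pts A, reg = generated_algebra (pts A) ?F\<rparr> (affine_space n) e"
      by (rule morphism_into_generated[where F = "{(\<lambda>x. x i) | i. i < n}"])
        (use sub in \<open>auto simp: function_algebra_generated affine_space_def intro!: generated_algebra.base\<close>)
    then have "(\<lambda>x. g (e x)) \<in> generated_algebra (pts A) ?F" using g(1) by (auto dest: morphismD)
    then show "f \<in> generated_algebra (pts A) ?F" by (rule G.cong) (use g(2) in auto)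
  qed
  moreover have "generated_algebra (pts A) ?F \<subseteq> reg A"
  proof
    have "(\<lambda>x. e x i) \<in> reg A" if "i < n" for i
    proof -
      have "(\<lambda>x. x i) \<in> reg (affine_space n)"
        using that by (auto simp: affine_space_def intro: generated_algebra.base)
      then show ?thesis by (subst A) (auto simp: reg_induced)
    qed
    then have "?F \<subseteq> reg A" by blast
    then show "f \<in> reg A" if "f \<in> generated_algebra (pts A) ?F" for f
      using A.generated_subset that by blast
  qed
  ultimately show ?thesis by (intro exI[of _ ?F]) auto
qed

lemma affine_algebraic_set_algebra: "affine_algebraic_set A \<Longrightarrow> fspace_algebra A"
  using affine_algebraic_set_generated function_algebra_generated by metis

lemma affine_algebraic_set_separated:
  assumes "affine_algebraic_set A" "x \<in> pts A" "y \<in> pts A" "x \<noteq> y"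
  shows "\<exists>f\<in>reg A. f x \<noteq> f y"
proof -
  obtain n e where inj: "inj_on e (pts A)" and e: "closedin (zariski (affine_space n)) (e ` pts A)"
    and A: "A = induced_space (pts A) e (affine_space n)"
    using assms(1) unfolding affine_algebraic_set_def by blast
  have "e ` pts A \<subseteq> {..<n} \<rightarrow>\<^sub>E UNIV"
    using e closedin_zariski[OF fspace_algebra_affine, of n] by (metis pts_simps(1))
  then have "e x \<in> {..<n} \<rightarrow>\<^sub>E UNIV" "e y \<in> {..<n} \<rightarrow>\<^sub>E UNIV" using assms by blast+
  moreover have "e x \<noteq> e y" using inj assms by (meson inj_onD)
  ultimately obtain i where i: "i < n" "e x i \<noteq> e y i" by (metis PiE_ext lessThan_iff)
  have "(\<lambda>x. x i) \<in> reg (affine_space n)"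
    using i(1) by (auto simp: affine_space_def intro: generated_algebra.base)
  then have "(\<lambda>x. e x i) \<in> reg A" by (subst A) (auto simp: reg_induced)
  then show ?thesis using i(2) by (intro bexI[of _ "\<lambda>x. e x i"])
qed

text \<open>
  The values of a character at the coordinates form a point \<open>a\<close> of affine space, and the character is
  evaluation at \<open>a\<close>. A polynomial vanishing on the set has value \<open>0\<close> at \<open>a\<close>, so \<open>a\<close> lies in the set.
\<close>

lemma affine_algebraic_set_characters:
  assumes "affine_algebraic_set A"
  shows "characters_are_points A"
  unfolding characters_are_points_def
proof (intro allI impI, elim conjE)
  obtain n e where e: "closedin (zariski (affine_space n)) (e ` pts A)"
    and A: "A = induced_space (pts A) e (affine_space n)"
    using assms unfolding affine_algebraic_set_def by blast
  have sub: "e ` pts A \<subseteq> {..<n} \<rightarrow>\<^sub>E UNIV"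
    using e closedin_zariski[OF fspace_algebra_affine, of n] by (metis pts_simps(1))
  have regA: "reg A = {f. \<exists>g\<in>reg (affine_space n). \<forall>x\<in>pts A. f x = g (e x)}"
    by (subst A) (rule reg_induced)
  have reg: "(\<lambda>x. g (e x)) \<in> reg A" if "g \<in> reg (affine_space n)" for g
    by (subst A) (use that in \<open>auto simp: reg_induced\<close>)
  fix \<theta> assume c: "\<forall>c. \<theta> (\<lambda>x. c) = (c::complex)"
    and hom: "\<forall>f\<in>reg A. \<forall>g\<in>reg A. \<theta> (\<lambda>x. f x + g x) = \<theta> f + \<theta> g \<and> \<theta> (\<lambda>x. f x * g x) = \<theta> f * \<theta> g"
    and cg: "\<forall>f\<in>reg A. \<forall>g. (\<forall>x\<in>pts A. g x = f x) \<longrightarrow> \<theta> g = \<theta> f"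
  have cg': "\<theta> g = \<theta> f" if "f \<in> reg A" "\<And>x. x \<in> pts A \<Longrightarrow> g x = f x" for f g
    by (rule cg[THEN bspec, OF that(1), THEN spec[of _ g], THEN mp]) (intro ballI that(2))
  define a where "a = (\<lambda>i\<in>{..<n}. \<theta> (\<lambda>x. e x i))"
  have val: "\<theta> (\<lambda>x. g (e x)) = g a" if "g \<in> reg (affine_space n)" for g
  proof -
    have "g \<in> generated_algebra ({..<n} \<rightarrow>\<^sub>E UNIV) {(\<lambda>x. x i) | i. i < n}"
      using that by (simp add: affine_space_def)
    then show ?thesis
    proof induction
      case (cong f g)
      then have "(\<lambda>x. f (e x)) \<in> reg A" by (intro reg) (simp add: affine_space_def)
      then have "\<theta> (\<lambda>x. g (e x)) = \<theta> (\<lambda>x. f (e x))"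
        by (rule cg') (rule cong(2), use sub in auto)
      moreover have "g a = f a" by (rule cong(2)) (auto simp: a_def)
      ultimately show ?case using cong(3) by simp
    next
      case (add f g)
      then have "(\<lambda>x. f (e x)) \<in> reg A" "(\<lambda>x. g (e x)) \<in> reg A" by (auto intro!: reg simp: affine_space_def)
      then show ?case using hom add by simp
    next
      case (mult f g)
      then have "(\<lambda>x. f (e x)) \<in> reg A" "(\<lambda>x. g (e x)) \<in> reg A" by (auto intro!: reg simp: affine_space_def)
      then show ?case using hom mult by simp
    qed (auto simp: c a_def)
  qed
  have "a \<in> e ` pts A"
  proof (rule ccontr)
    assume "a \<notin> e ` pts A"
    moreover have "a \<in> pts (affine_space n)" by (auto simp: a_def)
    ultimately have "a \<in> pts (affine_space n) - e ` pts A" by blast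
    with e[unfolded closedin_zariski[OF fspace_algebra_affine], THEN conjunct2]
    have "\<exists>g\<in>reg (affine_space n). g a \<noteq> 0 \<and> (\<forall>z\<in>e ` pts A. g z = 0)" by (rule bspec)
    then obtain g where g: "g \<in> reg (affine_space n)" "g a \<noteq> 0" "\<forall>z\<in>e ` pts A. g z = 0"
      by blast
    have "\<theta> (\<lambda>x. 0) = \<theta> (\<lambda>x. g (e x))" by (rule cg'[OF reg[OF g(1)]]) (use g(3) in auto)
    then show False using val[OF g(1)] g(2) c by simp
  qed
  then obtain p where p: "p \<in> pts A" "a = e p" by blast
  have "\<theta> f = f p" if "f \<in> reg A" for f
  proof -
    obtain g where g: "g \<in> reg (affine_space n)" "\<forall>x\<in>pts A. f x = g (e x)"
      using \<open>f \<in> reg A\<close> unfolding regA by blast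
    have "\<theta> f = \<theta> (\<lambda>x. g (e x))" by (rule cg'[OF reg[OF g(1)]]) (use g(2) in auto)
    then show ?thesis using val[OF g(1)] g(2) p by simp
  qed
  then show "\<exists>p\<in>pts A. \<forall>f\<in>reg A. \<theta> f = f p" using p(1) by blast
qed

lemma power_space_generated:
  assumes "reg A = generated_algebra (pts A) F"
  shows "reg (power_space n A) = generated_algebra (pts (power_space n A)) {(\<lambda>x. f (x i)) | f i. f \<in> F \<and> i < n}"
    (is "_ = generated_algebra ?P ?F")
proof
  have "F \<subseteq> reg A" using assms by (auto intro: generated_algebra.base)
  then show "generated_algebra ?P ?F \<subseteq> reg (power_space n A)"
    unfolding power_space_def by simp (rule generated_algebra_mono, blast)
  interpret G: function_algebra ?P "generated_algebra ?P ?F" by (rule function_algebra_generated)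
  have "(\<lambda>x. f (x i)) \<in> generated_algebra ?P ?F" if "f \<in> reg A" "i < n" for f i
  proof -
    have "morphism \<lparr>pts = ?P, reg = generated_algebra ?P ?F\<rparr> A (\<lambda>x. x i)"
      by (rule morphism_into_generated[where F = F])
        (use that(2) in \<open>auto simp: function_algebra_generated assms intro!: generated_algebra.base\<close>)
    then show ?thesis using morphismD[OF _ that(1)] by fastforce
  qed
  then have "{(\<lambda>x. f (x i)) | f i. f \<in> reg A \<and> i < n} \<subseteq> generated_algebra ?P ?F" by blast
  from G.generated_subset[OF this] show "reg (power_space n A) \<subseteq> generated_algebra ?P ?F"
    by (intro subsetI) (simp add: power_space_def)
qed

text \<open>
  A character of a power restricts to a character of each factor, which gives the coordinates of a
  point.
\<close>

lemma power_space_characters: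
  assumes A: "fspace_algebra A" "characters_are_points A"
  shows "characters_are_points (power_space n A)"
  unfolding characters_are_points_def
proof (intro allI impI, elim conjE)
  let ?B = "power_space n A"
  fix \<theta> assume c: "\<forall>c. \<theta> (\<lambda>x. c) = (c::complex)"
    and hom: "\<forall>f\<in>reg ?B. \<forall>g\<in>reg ?B. \<theta> (\<lambda>x. f x + g x) = \<theta> f + \<theta> g \<and> \<theta> (\<lambda>x. f x * g x) = \<theta> f * \<theta> g"
    and cg: "\<forall>f\<in>reg ?B. \<forall>g. (\<forall>x\<in>pts ?B. g x = f x) \<longrightarrow> \<theta> g = \<theta> f"
  have reg: "(\<lambda>x. f (x i)) \<in> reg ?B" if "f \<in> reg A" "i < n" for f i
    using morphismD[OF morphism_coordinate[OF that(2)] that(1)] .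
  have "\<exists>p\<in>pts A. \<forall>f\<in>reg A. \<theta> (\<lambda>x. f (x i)) = f p" if i: "i < n" for i
  proof (rule A(2)[unfolded characters_are_points_def, rule_format, of "\<lambda>f. \<theta> (\<lambda>x. f (x i))"], intro conjI ballI allI impI)
    fix f g assume "f \<in> reg A" "\<forall>x\<in>pts A. g x = f x"
    then show "\<theta> (\<lambda>x. g (x i)) = \<theta> (\<lambda>x. f (x i))"
      by (intro cg[rule_format] reg i) (use i in auto)
  qed (use c hom reg i in auto)
  then obtain p where p: "\<And>i. i < n \<Longrightarrow> p i \<in> pts A" "\<And>i f. i < n \<Longrightarrow> f \<in> reg A \<Longrightarrow> \<theta> (\<lambda>x. f (x i)) = f (p i)"
    by metis
  let ?p = "\<lambda>i\<in>{..<n}. p i"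
  have "\<theta> f = f ?p" if "f \<in> reg ?B" for f
  proof -
    have "f \<in> generated_algebra ({..<n} \<rightarrow>\<^sub>E pts A) {(\<lambda>x. f (x i)) | f i. f \<in> reg A \<and> i < n}"
      using that by (simp add: power_space_def)
    then show ?thesis
    proof induction
      case (cong f g)
      have "f \<in> reg ?B" using cong(1) by (simp add: power_space_def)
      then have "\<theta> g = \<theta> f"
        by (rule cg[THEN bspec, THEN spec[of _ g], THEN mp]) (use cong(2) in auto)
      moreover have "g ?p = f ?p" by (rule cong(2)) (use p(1) in auto)
      ultimately show ?case using cong(3) by (simp only:)
    next
      case (add f g)
      then have "f \<in> reg ?B" "g \<in> reg ?B" by (simp_all add: power_space_def)
      then show ?case using hom add by simp
    next
      case (mult f g)
      then have "f \<in> reg ?B" "g \<in> reg ?B" by (simp_all add: power_space_def)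
      then show ?case using hom mult by simp
    qed (auto simp: c p)
  qed
  moreover have "?p \<in> pts ?B" using p(1) by auto
  ultimately show "\<exists>p\<in>pts ?B. \<forall>f\<in>reg ?B. \<theta> f = f p" by blast
qed

section \<open>Quotients by finite groups\<close>

text \<open>
  The quotient of \<open>B\<close> by the finite group \<open>K\<close>, presented by any map \<open>q\<close> whose fibres are the orbits.
\<close>

locale finite_quotient = B: function_algebra "pts B" "reg B" + K: group K
  for B :: "'a fspace" and K :: "'k monoid" +
  fixes act :: "'k \<Rightarrow> 'a \<Rightarrow> 'a" and q :: "'a \<Rightarrow> 'b"
  assumes finite_K: "finite (carrier K)"
    and act_morphism: "k \<in> carrier K \<Longrightarrow> morphism B B (act k)"
    and act_one: "x \<in> pts B \<Longrightarrow> act \<one>\<^bsub>K\<^esub> x = x"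
    and act_mult: "k \<in> carrier K \<Longrightarrow> j \<in> carrier K \<Longrightarrow> x \<in> pts B \<Longrightarrow> act (k \<otimes>\<^bsub>K\<^esub> j) x = act k (act j x)"
    and q_eq: "x \<in> pts B \<Longrightarrow> y \<in> pts B \<Longrightarrow> q x = q y \<longleftrightarrow> (\<exists>k\<in>carrier K. y = act k x)"
begin

abbreviation "Q \<equiv> quotient_space q B"

lemma act_pts: "k \<in> carrier K \<Longrightarrow> x \<in> pts B \<Longrightarrow> act k x \<in> pts B"
  using act_morphism by (rule morphism_pts)

lemma q_act: "k \<in> carrier K \<Longrightarrow> x \<in> pts B \<Longrightarrow> q (act k x) = q x"
  using q_eq[of x "act k x"] act_pts by auto

lemma invariant_descends:
  assumes F: "F \<in> reg B" and inv: "\<And>k x. k \<in> carrier K \<Longrightarrow> x \<in> pts B \<Longrightarrow> F (act k x) = F x"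
  shows "\<exists>g\<in>reg Q. \<forall>x\<in>pts B. g (q x) = F x"
proof -
  define g where "g y = F (SOME x. x \<in> pts B \<and> q x = y)" for y
  have g: "g (q x) = F x" if x: "x \<in> pts B" for x
  proof -
    let ?x = "SOME x'. x' \<in> pts B \<and> q x' = q x"
    have "?x \<in> pts B \<and> q ?x = q x" by (rule someI[of _ x]) (use x in simp)
    then obtain k where "k \<in> carrier K" "x = act k ?x" using q_eq[of ?x x] x by blast
    then show ?thesis using inv[of k ?x] \<open>?x \<in> pts B \<and> q ?x = q x\<close> by (simp add: g_def)
  qed
  then have "(\<lambda>x. g (q x)) \<in> reg B" by (intro B.cong[OF F])
  then show ?thesis using g by (intro bexI[of _ g]) (auto simp: reg_quotient)
qed

lemma reindex_translation: "j \<in> carrier K \<Longrightarrow> bij_betw (\<lambda>k. k \<otimes>\<^bsub>K\<^esub> j) (carrier K) (carrier K)"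
  by (rule bij_betwI[where g = "\<lambda>k. k \<otimes>\<^bsub>K\<^esub> inv\<^bsub>K\<^esub> j"]) (auto simp: K.m_assoc)

lemma orbit_sum_descends:
  assumes F: "F \<in> reg B"
  shows "\<exists>g\<in>reg Q. \<forall>x\<in>pts B. g (q x) = (\<Sum>k\<in>carrier K. F (act k x))"
proof (rule invariant_descends)
  show "(\<lambda>x. \<Sum>k\<in>carrier K. F (act k x)) \<in> reg B"
    by (intro B.sum morphismD[OF act_morphism F])
  fix j x assume j: "j \<in> carrier K" and x: "x \<in> pts B"
  have "(\<Sum>k\<in>carrier K. F (act k (act j x))) = (\<Sum>k\<in>carrier K. F (act (k \<otimes>\<^bsub>K\<^esub> j) x))"
    by (intro sum.cong) (auto simp: act_mult j x)
  also have "\<dots> = (\<Sum>k\<in>carrier K. F (act k x))"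
    by (rule sum.reindex_bij_betw[OF reindex_translation[OF j]])
  finally show "(\<Sum>k\<in>carrier K. F (act k (act j x))) = (\<Sum>k\<in>carrier K. F (act k x))" .
qed

lemma orbit_prod_descends:
  assumes F: "F \<in> reg B"
  shows "\<exists>g\<in>reg Q. \<forall>x\<in>pts B. g (q x) = (\<Prod>k\<in>carrier K. F (act k x))"
proof (rule invariant_descends)
  show "(\<lambda>x. \<Prod>k\<in>carrier K. F (act k x)) \<in> reg B"
    by (intro B.prod morphismD[OF act_morphism F])
  fix j x assume j: "j \<in> carrier K" and x: "x \<in> pts B"
  have "(\<Prod>k\<in>carrier K. F (act k (act j x))) = (\<Prod>k\<in>carrier K. F (act (k \<otimes>\<^bsub>K\<^esub> j) x))"
    by (intro prod.cong) (auto simp: act_mult j x)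
  also have "\<dots> = (\<Prod>k\<in>carrier K. F (act k x))"
    by (rule prod.reindex_bij_betw[OF reindex_translation[OF j]])
  finally show "(\<Prod>k\<in>carrier K. F (act k (act j x))) = (\<Prod>k\<in>carrier K. F (act k x))" .
qed

lemma algebra_Q: "fspace_algebra Q"
  by (rule fspace_algebra_quotient[OF B.function_algebra_axioms])

lemma continuous_q: "continuous_map (zariski B) (zariski Q) q"
  by (rule continuous_map_morphism[OF B.function_algebra_axioms algebra_Q])
    (auto simp: morphism_def reg_quotient)

lemma continuous_act: "k \<in> carrier K \<Longrightarrow> continuous_map (zariski B) (zariski B) (act k)"
  by (rule continuous_map_morphism[OF B.function_algebra_axioms B.function_algebra_axioms act_morphism])

text \<open>
  A point outside the image of \<open>Z\<close> has its whole (finite) orbit outside \<open>Z\<close>. The orbit product of a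
  function vanishing on \<open>Z\<close> but nowhere on that orbit separates the point from the image.
\<close>

lemma closed_image:
  assumes Z: "closedin (zariski B) Z"
  shows "closedin (zariski Q) (q ` Z)"
proof -
  have ZB: "Z \<subseteq> pts B" using Z closedin_zariski[OF B.function_algebra_axioms] by blast
  have "\<exists>f\<in>reg Q. f (q x) \<noteq> 0 \<and> (\<forall>z\<in>q ` Z. f z = 0)" if x: "x \<in> pts B" "q x \<notin> q ` Z" for x
  proof -
    let ?I = "{f \<in> reg B. \<forall>z\<in>Z. f z = 0}" and ?O = "(\<lambda>k. act k x) ` carrier K"
    have "\<exists>f\<in>?I. \<forall>y\<in>?O. f y \<noteq> 0"
    proof (rule common_nonvanishing)
      show "(\<lambda>x. f x + c * g x) \<in> ?I" if "f \<in> ?I" "g \<in> ?I" for f g c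
        using that by (auto intro: B.add B.scale)
      fix y assume "y \<in> ?O"
      then obtain k where k: "k \<in> carrier K" "y = act k x" by blast
      have "y \<notin> Z"
      proof
        assume "y \<in> Z"
        then have "q y \<in> q ` Z" by (rule imageI)
        then show False using x q_act[OF k(1) x(1)] k(2) by simp
      qed
      then have "y \<in> pts B - Z" using act_pts[OF k(1) x(1)] k(2) by simp
      with Z[unfolded closedin_zariski[OF B.function_algebra_axioms], THEN conjunct2]
      have "\<exists>f\<in>reg B. f y \<noteq> 0 \<and> (\<forall>z\<in>Z. f z = 0)" by (rule bspec)
      then show "\<exists>f\<in>?I. f y \<noteq> 0" by blast
    qed (use finite_K in \<open>auto intro: B.const\<close>)
    then obtain f where f: "f \<in> reg B" "\<forall>z\<in>Z. f z = 0" "\<forall>k\<in>carrier K. f (act k x) \<noteq> 0" by auto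
    obtain g where g: "g \<in> reg Q" "\<forall>x\<in>pts B. g (q x) = (\<Prod>k\<in>carrier K. f (act k x))"
      using orbit_prod_descends[OF f(1)] by blast
    have "g (q z) = 0" if "z \<in> Z" for z
    proof -
      have "f (act \<one>\<^bsub>K\<^esub> z) = 0" using that ZB f(2) act_one by auto
      then have "(\<Prod>k\<in>carrier K. f (act k z)) = 0" using finite_K by (intro prod_zero) auto
      then show ?thesis using g(2) that ZB by auto
    qed
    moreover have "g (q x) \<noteq> 0" using g(2) x(1) f(3) finite_K by simp
    ultimately show ?thesis using g(1) by (intro bexI[of _ g]) auto
  qed
  then show ?thesis unfolding closedin_zariski[OF algebra_Q] using ZB by auto
qed

end

locale noetherian_finite_quotient = finite_quotient +
  fixes F and Y y0
  assumes finite_F: "finite F" and generated: "reg B = generated_algebra (pts B) F"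
    and characters: "characters_are_points B"
    and closed_Y: "closedin (zariski B) Y"
    and stable_Y: "k \<in> carrier K \<Longrightarrow> y \<in> Y \<Longrightarrow> act k y \<in> Y"
    and y0: "y0 \<in> Y"
begin

definition "C = connected_component_of_set (subtopology (zariski B) Y) y0"

lemma Y_subset: "Y \<subseteq> pts B"
  using closed_Y closedin_zariski[OF B.function_algebra_axioms] by blast

lemma topspace_Y: "topspace (subtopology (zariski B) Y) = Y"
  using Y_subset by (auto simp: topspace_zariski[OF B.function_algebra_axioms])

lemma C_clopen:
  "openin (subtopology (zariski B) Y) C" "closedin (subtopology (zariski B) Y) C"
proof -
  have "noetherian (pts B) (reg B)" unfolding generated by (rule hilbert_basis[OF finite_F])
  from clopen_component[OF B.function_algebra_axioms this closed_Y y0]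
  show "openin (subtopology (zariski B) Y) C" "closedin (subtopology (zariski B) Y) C"
    by (simp_all add: C_def)
qed

lemma C_subset: "C \<subseteq> Y"
  using C_clopen(1) openin_subset topspace_Y by fastforce

lemma closed_C: "closedin (zariski B) C"
  using C_clopen(2) closed_Y by (rule closedin_trans_full)

lemma closed_diff: "closedin (zariski B) (Y - C)"
proof -
  have "closedin (subtopology (zariski B) Y) (Y - C)"
    using closedin_diff[OF closedin_topspace C_clopen(1)] unfolding topspace_Y .
  then show ?thesis using closed_Y by (rule closedin_trans_full)
qed

lemma y0_C: "y0 \<in> C"
  unfolding C_def mem_Collect_eq connected_component_of_refl topspace_Y by (rule y0)

lemma connected_C: "connectedin (subtopology (zariski B) Y) C"
  unfolding C_def by (rule connectedin_connected_component_of)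

text \<open>The group permutes the components.\<close>

lemma act_C:
  assumes k: "k \<in> carrier K" and c: "c \<in> C" "act k c \<in> C" and d: "d \<in> C"
  shows "act k d \<in> C"
proof -
  have "continuous_map (subtopology (zariski B) Y) (subtopology (zariski B) Y) (act k)"
    using stable_Y[OF k]
    by (intro continuous_map_into_subtopology continuous_map_from_subtopology continuous_act k)
      (auto simp: topspace_Y)
  then have "connectedin (subtopology (zariski B) Y) (act k ` C)"
    using connected_C by (rule connectedin_continuous_map_image)
  then have "act k ` C \<subseteq> C \<or> disjnt (act k ` C) C"
    using C_clopen(2,1) by (rule connectedin_clopen_cases)
  then show ?thesis using c d by (auto simp: disjnt_def)
qed

definition "W = {x \<in> pts B. \<forall>k\<in>carrier K. act k x \<in> Y - C}"

lemma closed_W: "closedin (zariski B) W"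
proof -
  have "W = (\<Inter>k\<in>carrier K. {x \<in> topspace (zariski B). act k x \<in> Y - C})"
    using K.one_closed by (auto simp: W_def topspace_zariski[OF B.function_algebra_axioms])
  moreover have "closedin (zariski B) \<dots>"
    by (intro closedin_INT closedin_continuous_map_preimage[OF continuous_act] closed_diff)
      (use K.one_closed in auto)
  ultimately show ?thesis by simp
qed

lemma q_Y: "q ` Y = q ` C \<union> q ` W"
proof (intro equalityI subsetI)
  fix z assume "z \<in> q ` Y"
  then obtain y where y: "y \<in> Y" "z = q y" by blast
  show "z \<in> q ` C \<union> q ` W"
  proof (cases "y \<in> W")
    case False
    then obtain k where k: "k \<in> carrier K" "act k y \<notin> Y - C" using y Y_subset by (auto simp: W_def)
    then have "act k y \<in> C" using stable_Y y by blast
    moreover have "q (act k y) = z" using q_act k(1) y Y_subset by auto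
    ultimately show ?thesis by blast
  qed (use y in blast)
next
  fix z assume "z \<in> q ` C \<union> q ` W"
  moreover have "W \<subseteq> Y"
  proof
    fix w assume w: "w \<in> W"
    then have "act \<one>\<^bsub>K\<^esub> w \<in> Y" using K.one_closed unfolding W_def by blast
    then show "w \<in> Y" using w act_one[of w] by (simp add: W_def)
  qed
  ultimately show "z \<in> q ` Y" using C_subset by blast
qed

lemma q_disjoint: "q ` C \<inter> q ` W = {}"
proof -
  have False if "c \<in> C" "w \<in> W" "q c = q w" for c w
  proof -
    have "q w = q c" "w \<in> pts B" "c \<in> pts B" using that C_subset Y_subset by (auto simp: W_def)
    then obtain k where "k \<in> carrier K" "c = act k w" using q_eq[of w c] by blast
    then show False using that by (auto simp: W_def)
  qed
  then show ?thesis by blast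
qed

text \<open>
  The image of \<open>C\<close> is connected, and it is clopen because both it and its complement, the image of
  the set \<open>W\<close> of points whose orbit avoids \<open>C\<close>, are images of closed sets.
\<close>

theorem component_image:
  "q ` C = connected_component_of_set (subtopology (zariski Q) (q ` Y)) (q y0)"
proof -
  let ?T = "subtopology (zariski Q) (q ` Y)"
  have qY: "q ` Y \<subseteq> pts Q" using Y_subset by auto
  have top: "topspace ?T = q ` Y"
    using qY by (auto simp: topspace_zariski[OF algebra_Q])
  have cl: "closedin ?T (q ` C)" "closedin ?T (q ` W)"
    using closed_image[OF closed_C] closed_image[OF closed_W] q_Y
    by (auto intro: closedin_subset_topspace)
  have eq: "q ` C = topspace ?T - q ` W"
    by (simp only: top) (simp only: q_Y Un_Diff Diff_triv[OF q_disjoint] Diff_cancel Un_empty_right)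
  have op: "openin ?T (q ` C)" unfolding eq by (rule openin_diff[OF openin_topspace cl(2)])
  have "continuous_map (subtopology (zariski B) Y) ?T q"
    by (intro continuous_map_into_subtopology continuous_map_from_subtopology continuous_q)
      (auto simp: topspace_Y)
  then have conn: "connectedin ?T (q ` C)"
    using connected_C by (rule connectedin_continuous_map_image)
  show ?thesis
  proof (rule equalityI)
    show "q ` C \<subseteq> connected_component_of_set ?T (q y0)"
      by (rule connected_component_of_maximal[OF conn]) (use y0_C in blast)
    have "connected_component_of_set ?T (q y0) \<subseteq> q ` C \<or>
        disjnt (connected_component_of_set ?T (q y0)) (q ` C)"
      by (rule connectedin_clopen_cases[OF connectedin_connected_component_of cl(1) op])
    moreover have "q y0 \<in> connected_component_of_set ?T (q y0)"
      unfolding mem_Collect_eq connected_component_of_refl top using y0 by (rule imageI)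
    ultimately show "connected_component_of_set ?T (q y0) \<subseteq> q ` C"
      using y0_C unfolding disjnt_iff by blast
  qed
qed

text \<open>
  An idempotent \<open>e\<close> cuts \<open>h\<close> off outside \<open>C\<close>. In the orbit sum of \<open>e h\<close> at a point of \<open>C\<close> exactly
  the elements mapping \<open>C\<close> to itself contribute, each the same amount.
\<close>

theorem extension:
  assumes h: "h \<in> reg B" and inv: "\<And>c d. c \<in> C \<Longrightarrow> d \<in> C \<Longrightarrow> q c = q d \<Longrightarrow> h c = h d"
  shows "\<exists>g\<in>reg Q. (\<forall>c\<in>C. g (q c) = h c) \<and> (\<forall>z\<in>q ` Y - q ` C. g z = 0)"
proof -
  obtain e where e: "e \<in> reg B" "\<forall>x\<in>C. e x = 1" "\<forall>x\<in>Y - C. e x = 0"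
    using closed_separation[OF countable_finite[OF finite_F] generated characters closed_C closed_diff]
    by blast
  have "(\<lambda>x. e x * h x) \<in> reg B" using e(1) h by (rule B.mult)
  from orbit_sum_descends[OF this] obtain g where g: "g \<in> reg Q"
      "\<And>x. x \<in> pts B \<Longrightarrow> g (q x) = (\<Sum>k\<in>carrier K. e (act k x) * h (act k x))" by blast
  \<comment> \<open>The stabilizer of the component \<open>C\<close>; by \<open>act_C\<close> it can be tested at a single point.\<close>
  define S where "S = {k \<in> carrier K. act k y0 \<in> C}"
  have "\<one>\<^bsub>K\<^esub> \<in> S" using y0_C act_one y0 Y_subset by (auto simp: S_def)
  then have S: "card S \<noteq> 0" using finite_K by (auto simp: S_def)
  have "g (q c) = of_nat (card S) * h c" if c: "c \<in> C" for c
  proof -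
    have cB: "c \<in> pts B" using c C_subset Y_subset by blast
    have "e (act k c) * h (act k c) = (if k \<in> S then h c else 0)" if k: "k \<in> carrier K" for k
    proof (cases "act k c \<in> C")
      case True
      then have "k \<in> S" using act_C[OF k c True y0_C] k by (simp add: S_def)
      then show ?thesis using inv[OF True c q_act[OF k cB]] e(2) True by simp
    next
      case False
      then have "k \<notin> S" using act_C[OF k y0_C _ c] by (auto simp: S_def)
      moreover have "act k c \<in> Y - C" using False stable_Y[OF k] c C_subset by blast
      ultimately show ?thesis using e(3) by simp
    qed
    then have "g (q c) = (\<Sum>k\<in>carrier K. if k \<in> S then h c else 0)"
      using g(2)[OF cB] by simp
    also have "\<dots> = of_nat (card S) * h c"
    proof -
      have "carrier K \<inter> S = S" by (auto simp: S_def)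
      then show ?thesis using finite_K by (simp flip: sum.inter_restrict)
    qed
    finally show ?thesis .
  qed
  moreover have "g z = 0" if z: "z \<in> q ` Y - q ` C" for z
  proof -
    have "z \<in> q ` C \<union> q ` W" using z unfolding q_Y by (rule DiffD1)
    moreover have "z \<notin> q ` C" using z by simp
    ultimately have "z \<in> q ` W" by (elim UnE) simp_all
    then obtain w where w: "w \<in> W" "z = q w" by blast
    then have "e (act k w) = 0" if "k \<in> carrier K" for k using e(3) that by (auto simp: W_def)
    then show ?thesis using g(2)[of w] w by (simp add: W_def)
  qed
  moreover have "(\<lambda>y. (1 / of_nat (card S)) * g y) \<in> reg Q"
    by (rule function_algebra.scale[OF algebra_Q g(1)])
  ultimately show ?thesis
    using S by (intro bexI[of _ "\<lambda>y. (1 / of_nat (card S)) * g y"]) auto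
qed

end

section \<open>Powers of a group modulo a finite central subgroup\<close>

locale central_quotient = group G + subgroup H G for G :: "'g monoid" (structure) and H +
  fixes A :: "'g fspace"
  assumes algebraic: "affine_algebraic_group G A"
    and finite_H: "finite H"
    and central: "h \<in> H \<Longrightarrow> g \<in> carrier G \<Longrightarrow> h \<otimes> g = g \<otimes> h"
begin

lemma pts_A: "pts A = carrier G" and affine_A: "affine_algebraic_set A"
  and morphism_mult: "morphism (prod_space A A) A (\<lambda>z. fst z \<otimes> snd z)"
  and morphism_inv: "morphism A A (\<lambda>x. inv x)"
  using algebraic by (auto simp: affine_algebraic_group_def)

lemma algebra_A: "fspace_algebra A"
  by (rule affine_algebraic_set_algebra[OF affine_A])

lemma morphism_product:
  assumes "fspace_algebra B" "morphism B A u" "morphism B A v"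
  shows "morphism B A (\<lambda>x. u x \<otimes> v x)"
  using morphism_compose[OF morphism_into_prod[OF assms] morphism_mult] by simp

lemma translation: "a \<in> carrier G \<Longrightarrow> morphism A A (\<lambda>x. a \<otimes> x)"
  by (intro morphism_product algebra_A morphism_const) (auto simp: pts_A morphism_def)

lemma normal_H: "H \<lhd> G"
proof (rule normalI[OF subgroup_axioms], intro ballI)
  fix g assume g: "g \<in> carrier G"
  then show "H #> g = g <# H" unfolding r_coset_def l_coset_def by (intro SUP_cong refl arg_cong[where f = "\<lambda>x. {x}"]) (rule central)
qed

lemma coset_eq:
  assumes "x \<in> carrier G" "y \<in> carrier G"
  shows "H #> x = H #> y \<longleftrightarrow> (\<exists>h\<in>H. y = h \<otimes> x)"
proof
  assume "H #> x = H #> y"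
  then have "y \<in> H #> x" using rcos_self[OF assms(2) subgroup_axioms] by simp
  then show "\<exists>h\<in>H. y = h \<otimes> x" by (auto simp: r_coset_def)
next
  assume "\<exists>h\<in>H. y = h \<otimes> x"
  then have "y \<in> H #> x" by (auto simp: r_coset_def)
  then show "H #> x = H #> y" using repr_independence[OF _ assms(1) subgroup_axioms] by blast
qed

lemma group_H: "group (G\<lparr>carrier := H\<rparr>)"
  by (rule subgroup.subgroup_is_group[OF subgroup_axioms is_group])

sublocale single: finite_quotient A "G\<lparr>carrier := H\<rparr>" "(\<otimes>)" "\<lambda>g. H #> g"
proof (intro finite_quotient.intro finite_quotient_axioms.intro algebra_A group_H)
  show "morphism A A ((\<otimes>) k)" if "k \<in> carrier (G\<lparr>carrier := H\<rparr>)" for k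
    using translation[of k] that by (simp add: subset)
qed (auto simp: finite_H pts_A m_assoc coset_eq)

definition KN :: "nat \<Rightarrow> (nat \<Rightarrow> 'g) monoid" where
  "KN n = product_group {..<n} (\<lambda>_. G\<lparr>carrier := H\<rparr>)"

definition actN :: "nat \<Rightarrow> (nat \<Rightarrow> 'g) \<Rightarrow> (nat \<Rightarrow> 'g) \<Rightarrow> nat \<Rightarrow> 'g" where
  "actN n k x = (\<lambda>i\<in>{..<n}. k i \<otimes> x i)"

definition qN :: "nat \<Rightarrow> (nat \<Rightarrow> 'g) \<Rightarrow> nat \<Rightarrow> 'g set" where
  "qN n x = (\<lambda>i\<in>{..<n}. H #> x i)"

lemma carrier_KN: "carrier (KN n) = {..<n} \<rightarrow>\<^sub>E H"
  by (simp add: KN_def)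

lemma group_KN: "group (KN n)"
  unfolding KN_def by (rule product_group) (rule group_H)

sublocale power: finite_quotient "power_space n A" "KN n" "actN n" "qN n"
proof (intro finite_quotient.intro finite_quotient_axioms.intro fspace_algebra_power group_KN)
  show "finite (carrier (KN n))" unfolding carrier_KN by (intro finite_PiE) (auto simp: finite_H)
  show "morphism (power_space n A) (power_space n A) (actN n k)" if "k \<in> carrier (KN n)" for k
  proof (rule morphism_into_power[OF fspace_algebra_power])
    fix i assume i: "i < n"
    then have "k i \<in> H" using that unfolding carrier_KN by (intro PiE_mem[of k "{..<n}"]) auto
    then have "morphism A A (\<lambda>x. k i \<otimes> x)" by (intro translation mem_carrier)
    from morphism_compose[OF morphism_coordinate[OF i] this]
    show "morphism (power_space n A) A (\<lambda>x. actN n k x i)" using i by (simp add: actN_def)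
  qed (simp add: actN_def)
  show "actN n \<one>\<^bsub>KN n\<^esub> x = x" if "x \<in> pts (power_space n A)" for x
    using that by (intro extensionalityI[of _ "{..<n}"]) (auto simp: actN_def KN_def pts_A PiE_def Pi_def)
  show "actN n (k \<otimes>\<^bsub>KN n\<^esub> j) x = actN n k (actN n j x)"
    if "k \<in> carrier (KN n)" "j \<in> carrier (KN n)" "x \<in> pts (power_space n A)" for k j x
    unfolding actN_def KN_def
    by (rule restrict_ext) (use that in \<open>auto simp: carrier_KN pts_A PiE_def Pi_def m_assoc subset\<close>)
  show "qN n x = qN n y \<longleftrightarrow> (\<exists>k\<in>carrier (KN n). y = actN n k x)"
    if x: "x \<in> pts (power_space n A)" and y: "y \<in> pts (power_space n A)" for x y
  proof
    assume eq: "qN n x = qN n y"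
    have "\<exists>h\<in>H. y i = h \<otimes> x i" if i: "i < n" for i
    proof -
      have "H #> x i = H #> y i" using fun_cong[OF eq, of i] i by (simp add: qN_def)
      then show ?thesis using coset_eq[of "x i" "y i"] x y i by (auto simp: pts_A PiE_def Pi_def)
    qed
    then obtain k where k: "\<And>i. i < n \<Longrightarrow> k i \<in> H \<and> y i = k i \<otimes> x i" by metis
    then have "y = actN n (\<lambda>i\<in>{..<n}. k i) x"
      using y by (intro extensionalityI[of _ "{..<n}"]) (auto simp: actN_def PiE_def)
    moreover have "(\<lambda>i\<in>{..<n}. k i) \<in> carrier (KN n)" using k by (auto simp: carrier_KN)
    ultimately show "\<exists>k\<in>carrier (KN n). y = actN n k x" by blast
  next
    assume "\<exists>k\<in>carrier (KN n). y = actN n k x"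
    then obtain k where k: "k \<in> {..<n} \<rightarrow>\<^sub>E H" "y = actN n k x" by (auto simp: carrier_KN)
    have "H #> x i = H #> y i" if "i < n" for i
    proof -
      have "x i \<in> carrier G" "y i \<in> carrier G" "k i \<in> H" "y i = k i \<otimes> x i"
        using that x y k(1) by (auto simp: pts_A PiE_def Pi_def k(2) actN_def)
      then show ?thesis using coset_eq by blast
    qed
    then show "qN n x = qN n y" unfolding qN_def by (intro restrict_ext) auto
  qed
qed

end

text \<open>
  The coordinate ring of a power is spanned by the products of functions of one coordinate each. The
  scalar \<open>a\<close> supplies the constants when there are no coordinates.
\<close>

inductive_set product_span :: "nat \<Rightarrow> 'a fspace \<Rightarrow> ((nat \<Rightarrow> 'a) \<Rightarrow> complex) set"
  for n A where
  product: "(\<And>i. i < n \<Longrightarrow> c i \<in> reg A) \<Longrightarrow>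
    (\<And>x. x \<in> {..<n} \<rightarrow>\<^sub>E pts A \<Longrightarrow> f x = a * (\<Prod>i<n. c i (x i))) \<Longrightarrow> f \<in> product_span n A"
| plus: "f \<in> product_span n A \<Longrightarrow> g \<in> product_span n A \<Longrightarrow>
    (\<And>x. x \<in> {..<n} \<rightarrow>\<^sub>E pts A \<Longrightarrow> h x = f x + g x) \<Longrightarrow> h \<in> product_span n A"

lemma product_span_cong:
  assumes "f \<in> product_span n A" "\<And>x. x \<in> {..<n} \<rightarrow>\<^sub>E pts A \<Longrightarrow> g x = f x"
  shows "g \<in> product_span n A"
  using assms(1)
proof cases
  case (product c a)
  then show ?thesis by (intro product_span.product[of n c A g a]) (auto simp: assms(2))
next
  case (plus f1 f2)
  then show ?thesis by (intro product_span.plus[OF plus(1,2)]) (auto simp: assms(2))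
qed

lemma product_span_mult:
  assumes A: "fspace_algebra A" and "f \<in> product_span n A" "g \<in> product_span n A"
  shows "(\<lambda>x. f x * g x) \<in> product_span n A"
  using assms(2)
proof induction
  case (product c f a)
  note cf = product
  show ?case using assms(3)
  proof induction
    case (product d g b)
    then show ?case using cf
      by (intro product_span.product[of n "\<lambda>i x. c i x * d i x" A _ "a * b"])
        (auto simp: prod.distrib function_algebra.mult[OF A])
  next
    case (plus g1 g2 g)
    show ?case by (rule product_span.plus[OF plus(4,5)]) (simp add: plus(3) algebra_simps)
  qed
next
  case (plus f1 f2 f)
  show ?case by (rule product_span.plus[OF plus(4,5)]) (simp add: plus(3) algebra_simps)
qed

lemma power_reg_product_span:
  assumes A: "fspace_algebra A" and f: "f \<in> reg (power_space n A)"
  shows "f \<in> product_span n A"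
proof -
  have prod: "(\<lambda>x. f (x i)) \<in> product_span n A" if f: "f \<in> reg A" and i: "i < n" for f i
  proof (rule product_span.product[of n "\<lambda>j x. if j = i then f x else 1" A _ 1])
    show "(\<lambda>x. if j = i then f x else 1) \<in> reg A" for j
      using f function_algebra.const[OF A] by (cases "j = i") auto
    show "f (x i) = 1 * (\<Prod>j<n. if j = i then f (x j) else 1)" for x
      using i by (simp add: prod.delta)
  qed
  have "f \<in> generated_algebra ({..<n} \<rightarrow>\<^sub>E pts A) {(\<lambda>x. f (x i)) | f i. f \<in> reg A \<and> i < n}"
    using f by (simp add: power_space_def)
  then show ?thesis
  proof induction
    case (base f)
    then show ?case using prod by auto
  next
    case (const c)
    show ?case
      by (rule product_span.product[of n "\<lambda>i x. 1" A _ c]) (auto intro: function_algebra.const[OF A])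
  next
    case (add f g)
    show ?case by (rule product_span.plus[OF add.IH]) simp
  next
    case (mult f g)
    show ?case by (rule product_span_mult[OF A mult.IH])
  next
    case (cong f g)
    show ?case by (rule product_span_cong[OF cong.IH cong(2)])
  qed
qed


context central_quotient
begin

lemma coset_space_quotient: "coset_space G A H = quotient_space (\<lambda>g. H #> g) A"
  by (simp add: coset_space_def)

text \<open>
  Expanding a product of sums over \<open>H\<close> gives the sum over \<open>H\<^sup>n\<close>, so the orbit sum of a product of
  functions of single coordinates is the product of their orbit sums.
\<close>

lemma orbit_sum_power:
  assumes "F \<in> product_span n A"
  shows "\<exists>g\<in>reg (power_space n (coset_space G A H)). \<forall>x\<in>pts (power_space n A).
    g (qN n x) = (\<Sum>k\<in>carrier (KN n). F (actN n k x))"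
  using assms
proof induction
  interpret P: function_algebra "pts (power_space n (coset_space G A H))" "reg (power_space n (coset_space G A H))"
    by (rule fspace_algebra_power)
  case (product c f a)
  have "\<exists>d\<in>reg (coset_space G A H). \<forall>x\<in>pts A. d (H #> x) = (\<Sum>h\<in>H. c i (h \<otimes> x))" if "i < n" for i
    using single.orbit_sum_descends[OF product(1)[OF that]] by (simp add: coset_space_quotient)
  then obtain d where d: "\<And>i. i < n \<Longrightarrow> d i \<in> reg (coset_space G A H)"
    "\<And>i x. i < n \<Longrightarrow> x \<in> pts A \<Longrightarrow> d i (H #> x) = (\<Sum>h\<in>H. c i (h \<otimes> x))" by metis
  let ?g = "\<lambda>y. a * (\<Prod>i<n. d i (y i))"
  have "?g \<in> reg (power_space n (coset_space G A H))"
    by (intro P.scale P.prod morphismD[OF morphism_coordinate d(1)]) auto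
  moreover have "?g (qN n x) = (\<Sum>k\<in>carrier (KN n). f (actN n k x))"
    if x: "x \<in> pts (power_space n A)" for x
  proof -
    have "(\<Prod>i<n. d i (qN n x i)) = (\<Prod>i<n. \<Sum>h\<in>H. c i (h \<otimes> x i))"
      by (rule prod.cong) (use x d(2) in \<open>auto simp: qN_def\<close>)
    also have "\<dots> = (\<Sum>k\<in>{..<n} \<rightarrow>\<^sub>E H. \<Prod>i<n. c i (k i \<otimes> x i))"
      by (rule prod_sum_PiE) (auto simp: finite_H)
    also have "a * \<dots> = (\<Sum>k\<in>carrier (KN n). f (actN n k x))"
      unfolding sum_distrib_left carrier_KN
    proof (rule sum.cong[OF refl])
      fix k assume k: "k \<in> {..<n} \<rightarrow>\<^sub>E H"
      have "actN n k x \<in> pts (power_space n A)"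
        using power.act_pts[of k n x] k x by (simp add: carrier_KN)
      then have "f (actN n k x) = a * (\<Prod>i<n. c i (actN n k x i))" using product(2) by simp
      then show "a * (\<Prod>i<n. c i (k i \<otimes> x i)) = f (actN n k x)" by (simp add: actN_def)
    qed
    finally show ?thesis .
  qed
  ultimately show ?case by (intro bexI[of _ ?g]) auto
next
  interpret P: function_algebra "pts (power_space n (coset_space G A H))" "reg (power_space n (coset_space G A H))"
    by (rule fspace_algebra_power)
  case (plus f1 f2 f)
  then obtain g1 g2 where g: "g1 \<in> reg (power_space n (coset_space G A H))"
      "g2 \<in> reg (power_space n (coset_space G A H))"
      "\<forall>x\<in>pts (power_space n A). g1 (qN n x) = (\<Sum>k\<in>carrier (KN n). f1 (actN n k x))"
      "\<forall>x\<in>pts (power_space n A). g2 (qN n x) = (\<Sum>k\<in>carrier (KN n). f2 (actN n k x))" by blast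
  have "g1 (qN n x) + g2 (qN n x) = (\<Sum>k\<in>carrier (KN n). f (actN n k x))"
    if x: "x \<in> pts (power_space n A)" for x
    using g(3,4) x plus(3) power.act_pts[OF _ x] by (simp flip: sum.distrib)
  then show ?case using P.add[OF g(1,2)] by (intro bexI[of _ "\<lambda>y. g1 y + g2 y"]) auto
qed

lemma qN_pts: "x \<in> pts (power_space n A) \<Longrightarrow> qN n x \<in> pts (power_space n (coset_space G A H))"
  by (auto simp: qN_def coset_space_quotient)

text \<open>
  A function on the quotient that pulls back to a regular function \<open>F\<close> equals the mean of \<open>F\<close> over the
  orbits, and orbit sums come from the coordinate ring of the power of the quotient.
\<close>

theorem power_coset_space: "power_space n (coset_space G A H) = quotient_space (qN n) (power_space n A)"
proof (rule fspace.equality)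
  let ?L = "power_space n (coset_space G A H)" and ?R = "quotient_space (qN n) (power_space n A)"
  have q: "morphism (power_space n A) ?L (qN n)"
  proof (rule morphism_into_power[OF fspace_algebra_power])
    fix i assume i: "i < n"
    have "morphism A (coset_space G A H) (\<lambda>g. H #> g)"
      by (auto simp: morphism_def coset_space_quotient reg_quotient)
    from morphism_compose[OF morphism_coordinate[OF i] this]
    show "morphism (power_space n A) (coset_space G A H) (\<lambda>x. qN n x i)" using i by (simp add: qN_def)
  qed (simp add: qN_def)
  show "pts ?L = pts ?R"
  proof (intro equalityI subsetI)
    fix y assume y: "y \<in> pts ?L"
    then have "\<forall>i<n. \<exists>x\<in>pts A. y i = H #> x" by (fastforce simp: coset_space_quotient PiE_def Pi_def)
    then obtain x where x: "\<And>i. i < n \<Longrightarrow> x i \<in> pts A \<and> y i = H #> x i" by metis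
    have "y = qN n (\<lambda>i\<in>{..<n}. x i)"
      using y x by (intro extensionalityI[of _ "{..<n}"]) (auto simp: qN_def PiE_def)
    then show "y \<in> pts ?R" using x by auto
  next
    fix y assume "y \<in> pts ?R"
    then show "y \<in> pts ?L" using qN_pts by auto
  qed
  show "reg ?L = reg ?R"
  proof (intro equalityI subsetI)
    fix f assume "f \<in> reg ?L"
    then show "f \<in> reg ?R" using morphismD[OF q] by (simp add: reg_quotient)
  next
    fix f assume "f \<in> reg ?R"
    then have "(\<lambda>x. f (qN n x)) \<in> reg (power_space n A)" by (simp add: reg_quotient)
    from orbit_sum_power[OF power_reg_product_span[OF algebra_A this]]
    obtain g where g: "g \<in> reg ?L" "\<forall>x\<in>pts (power_space n A). g (qN n x) =
        (\<Sum>k\<in>carrier (KN n). f (qN n (actN n k x)))" by blast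
    define N where "N = card (carrier (KN n))"
    have N: "N \<noteq> 0" using power.finite_K[of n] group.is_monoid[OF group_KN[of n]] monoid.one_closed
      unfolding N_def by (metis card_eq_0_iff empty_iff)
    have gf: "g (qN n x) = of_nat N * f (qN n x)" if "x \<in> pts (power_space n A)" for x
      using g(2) that power.q_act[OF _ that] by (simp add: N_def)
    show "f \<in> reg ?L"
    proof (rule function_algebra.cong[OF fspace_algebra_power])
      show "(\<lambda>y. (1 / of_nat N) * g y) \<in> reg ?L"
        by (rule function_algebra.scale[OF fspace_algebra_power g(1)])
      fix y assume "y \<in> pts ?L"
      then obtain x where "x \<in> pts (power_space n A)" "y = qN n x"
        using \<open>pts ?L = pts ?R\<close> by auto
      then show "f y = (1 / of_nat N) * g y" using gf N by simp
    qed
  qed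
qed simp

end

section \<open>Words and representation spaces\<close>

text \<open>A letter \<open>(b, i)\<close> stands for the \<open>i\<close>-th generator if \<open>b\<close> holds and for its inverse otherwise.\<close>

primrec word_eval :: "('a, 'm) monoid_scheme \<Rightarrow> (nat \<Rightarrow> 'a) \<Rightarrow> (bool \<times> nat) list \<Rightarrow> 'a" where
  "word_eval M x [] = \<one>\<^bsub>M\<^esub>"
| "word_eval M x (l # w) =
     (if fst l then x (snd l) else inv\<^bsub>M\<^esub> x (snd l)) \<otimes>\<^bsub>M\<^esub> word_eval M x w"

definition words :: "nat \<Rightarrow> (bool \<times> nat) list set" where
  "words n = lists (UNIV \<times> {..<n})"

definition word_inverse :: "(bool \<times> nat) list \<Rightarrow> (bool \<times> nat) list" where
  "word_inverse w = rev (map (\<lambda>l. (\<not> fst l, snd l)) w)"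

lemma words_simps [simp]:
  "[] \<in> words n" "l # w \<in> words n \<longleftrightarrow> snd l < n \<and> w \<in> words n"
  "v @ w \<in> words n \<longleftrightarrow> v \<in> words n \<and> w \<in> words n"
  by (auto simp: words_def mem_Times_iff)

lemma word_inverse_words: "w \<in> words n \<Longrightarrow> word_inverse w \<in> words n"
  by (auto simp: words_def word_inverse_def mem_Times_iff)

lemma word_eval_cong:
  "w \<in> words n \<Longrightarrow> (\<And>i. i < n \<Longrightarrow> x i = y i) \<Longrightarrow> word_eval M x w = word_eval M y w"
  by (induction w) auto

context group
begin

lemma word_eval_closed:
  assumes "\<And>i. i < n \<Longrightarrow> x i \<in> carrier G"
  shows "w \<in> words n \<Longrightarrow> word_eval G x w \<in> carrier G"
  by (induction w) (auto simp: assms)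

lemma word_eval_append:
  assumes "\<And>i. i < n \<Longrightarrow> x i \<in> carrier G" "w \<in> words n"
  shows "v \<in> words n \<Longrightarrow> word_eval G x (v @ w) = word_eval G x v \<otimes> word_eval G x w"
proof (induction v)
  case (Cons l v)
  then show ?case using word_eval_closed[OF assms(1)] assms by (auto simp: m_assoc)
qed (simp add: word_eval_closed[OF assms])

lemma word_eval_inverse:
  assumes "\<And>i. i < n \<Longrightarrow> x i \<in> carrier G"
  shows "w \<in> words n \<Longrightarrow> word_eval G x (word_inverse w) = inv (word_eval G x w)"
proof (induction w)
  case (Cons l w)
  have "word_eval G x (word_inverse w @ [(\<not> fst l, snd l)]) =
      word_eval G x (word_inverse w) \<otimes> word_eval G x [(\<not> fst l, snd l)]"
    by (rule word_eval_append[OF assms]) (use Cons word_inverse_words in auto)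
  moreover have "word_inverse (l # w) = word_inverse w @ [(\<not> fst l, snd l)]"
    by (simp add: word_inverse_def)
  ultimately show ?case
    using Cons word_eval_closed[of n x w, OF assms] assms[of "snd l"] by (auto simp: inv_mult_group)
qed (simp add: word_inverse_def)

lemma word_eval_hom:
  assumes M: "group M" and f: "f \<in> hom G M" and x: "\<And>i. i < n \<Longrightarrow> x i \<in> carrier G"
  shows "w \<in> words n \<Longrightarrow> f (word_eval G x w) = word_eval M (\<lambda>i. f (x i)) w"
proof -
  note closed = word_eval_closed[of n x, OF x]
  interpret group_hom G M f using M f is_group by (simp add: group_hom_def group_hom_axioms_def)
  show "w \<in> words n \<Longrightarrow> f (word_eval G x w) = word_eval M (\<lambda>i. f (x i)) w"
    by (induction w) (auto simp: x closed)
qed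

lemma generate_words:
  assumes "set xs \<subseteq> carrier G" "c \<in> generate G (set xs)"
  shows "\<exists>w\<in>words (length xs). word_eval G (\<lambda>i. xs ! i) w = c"
  using assms(2)
proof induction
  case one
  then show ?case by (intro bexI[of _ "[]"]) auto
next
  case (incl h)
  then obtain i where "i < length xs" "xs ! i = h" by (auto simp: in_set_conv_nth)
  then show ?case using assms(1) incl by (intro bexI[of _ "[(True, i)]"]) auto
next
  case (inv h)
  then obtain i where "i < length xs" "xs ! i = h" by (auto simp: in_set_conv_nth)
  then show ?case using assms(1) inv by (intro bexI[of _ "[(False, i)]"]) auto
next
  case (eng h1 h2)
  then obtain w1 w2 where "w1 \<in> words (length xs)" "word_eval G ((!) xs) w1 = h1"
    "w2 \<in> words (length xs)" "word_eval G ((!) xs) w2 = h2" by auto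
  moreover have "\<And>i. i < length xs \<Longrightarrow> xs ! i \<in> carrier G" using assms(1) by auto
  ultimately show ?case using word_eval_append[of "length xs" "(!) xs" w2 w1]
    by (intro bexI[of _ "w1 @ w2"]) auto
qed

end

locale generated_group = \<Gamma>: group \<Gamma> for \<Gamma> :: "'c monoid" and \<gamma>s :: "'c list" +
  assumes generators: "set \<gamma>s \<subseteq> carrier \<Gamma>" and generating: "generate \<Gamma> (set \<gamma>s) = carrier \<Gamma>"
begin

abbreviation "N \<equiv> length \<gamma>s"

definition ev :: "('c \<Rightarrow> 'a) \<Rightarrow> nat \<Rightarrow> 'a" where
  "ev \<rho> = (\<lambda>i\<in>{..<N}. \<rho> (\<gamma>s ! i))"

definition relators :: "(bool \<times> nat) list set" where
  "relators = {w \<in> words N. word_eval \<Gamma> (\<lambda>i. \<gamma>s ! i) w = \<one>\<^bsub>\<Gamma>\<^esub>}"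

lemma generator_mem: "i < N \<Longrightarrow> \<gamma>s ! i \<in> carrier \<Gamma>"
  using generators by auto

lemma word_exists: "c \<in> carrier \<Gamma> \<Longrightarrow> \<exists>w\<in>words N. word_eval \<Gamma> (\<lambda>i. \<gamma>s ! i) w = c"
  using \<Gamma>.generate_words[OF generators] generating by simp

lemma ev_pts:
  assumes "\<rho> \<in> Homs \<Gamma> M"
  shows "ev \<rho> \<in> {..<N} \<rightarrow>\<^sub>E carrier M"
  using assms generator_mem by (auto simp: ev_def Homs_def hom_def)

lemma word_eval_ev:
  assumes M: "group M" and \<rho>: "\<rho> \<in> Homs \<Gamma> M" and w: "w \<in> words N"
  shows "word_eval M (ev \<rho>) w = \<rho> (word_eval \<Gamma> (\<lambda>i. \<gamma>s ! i) w)"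
proof -
  have "\<rho> (word_eval \<Gamma> (\<lambda>i. \<gamma>s ! i) w) = word_eval M (\<lambda>i. \<rho> (\<gamma>s ! i)) w"
    using \<rho> by (intro \<Gamma>.word_eval_hom[OF M _ generator_mem w]) (auto simp: Homs_def)
  also have "\<dots> = word_eval M (ev \<rho>) w" by (rule word_eval_cong[OF w]) (simp add: ev_def)
  finally show ?thesis by simp
qed

lemma ev_inj:
  assumes M: "group M"
  shows "inj_on ev (Homs \<Gamma> M)"
proof (rule inj_onI)
  fix \<rho> \<rho>' assume \<rho>: "\<rho> \<in> Homs \<Gamma> M" "\<rho>' \<in> Homs \<Gamma> M" "ev \<rho> = ev \<rho>'"
  have "\<rho> c = \<rho>' c" if c: "c \<in> carrier \<Gamma>" for c
  proof -
    obtain w where "w \<in> words N" "word_eval \<Gamma> (\<lambda>i. \<gamma>s ! i) w = c" using word_exists[OF c] by blast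
    then show ?thesis using word_eval_ev[OF M \<rho>(1)] word_eval_ev[OF M \<rho>(2)] \<rho>(3) by metis
  qed
  then show "\<rho> = \<rho>'" using \<rho> by (intro extensionalityI[of _ "carrier \<Gamma>"]) (auto simp: Homs_def)
qed

text \<open>
  Words with the same value in \<open>\<Gamma>\<close> differ by a relator, so if \<open>x\<close> satisfies the relators they also have
  the same value at \<open>x\<close>. Sending an element of \<open>\<Gamma>\<close> to the value at \<open>x\<close> of any word for it is then
  well defined.
\<close>

lemma ev_image:
  assumes M: "group M" and x: "x \<in> {..<N} \<rightarrow>\<^sub>E carrier M"
  shows "x \<in> ev ` Homs \<Gamma> M \<longleftrightarrow> (\<forall>w\<in>relators. word_eval M x w = \<one>\<^bsub>M\<^esub>)"
proof
  assume "x \<in> ev ` Homs \<Gamma> M"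
  then obtain \<rho> where \<rho>: "\<rho> \<in> Homs \<Gamma> M" "x = ev \<rho>" by blast
  have "\<rho> \<one>\<^bsub>\<Gamma>\<^esub> = \<one>\<^bsub>M\<^esub>" using \<rho>(1) by (intro hom_one[OF _ \<Gamma>.is_group M]) (simp add: Homs_def)
  then show "\<forall>w\<in>relators. word_eval M x w = \<one>\<^bsub>M\<^esub>"
    using word_eval_ev[OF M \<rho>(1)] \<rho>(2) by (simp add: relators_def)
next
  interpret M: group M by (rule M)
  let ?e = "word_eval \<Gamma> (\<lambda>i. \<gamma>s ! i)"
  assume rel: "\<forall>w\<in>relators. word_eval M x w = \<one>\<^bsub>M\<^esub>"
  have xi: "\<And>i. i < N \<Longrightarrow> x i \<in> carrier M" using x by auto
  have closed: "word_eval M x w \<in> carrier M" if "w \<in> words N" for w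
    using xi that by (rule M.word_eval_closed)
  have eq: "word_eval M x v = word_eval M x w" if v: "v \<in> words N" and w: "w \<in> words N" and "?e v = ?e w" for v w
  proof -
    have "?e (v @ word_inverse w) = ?e v \<otimes>\<^bsub>\<Gamma>\<^esub> inv\<^bsub>\<Gamma>\<^esub> ?e w"
      using \<Gamma>.word_eval_append[OF generator_mem word_inverse_words[OF w] v]
        \<Gamma>.word_eval_inverse[OF generator_mem w] by simp
    then have "v @ word_inverse w \<in> relators"
      using that \<Gamma>.word_eval_closed[OF generator_mem w] word_inverse_words[OF w] by (simp add: relators_def)
    then have "word_eval M x v \<otimes>\<^bsub>M\<^esub> inv\<^bsub>M\<^esub> word_eval M x w = \<one>\<^bsub>M\<^esub>"
      using rel M.word_eval_append[of N x, OF xi word_inverse_words[OF w] v] M.word_eval_inverse[of N x, OF xi w] by simp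
    then show ?thesis using closed[OF v] closed[OF w] by (metis M.inv_equality M.inv_inv M.inv_closed)
  qed
  define wd where "wd c = (SOME w. w \<in> words N \<and> ?e w = c)" for c
  have wd: "wd c \<in> words N" "?e (wd c) = c" if "c \<in> carrier \<Gamma>" for c
    using someI_ex[of "\<lambda>w. w \<in> words N \<and> ?e w = c"] word_exists[OF that] unfolding wd_def by blast+
  define \<rho> where "\<rho> = (\<lambda>c\<in>carrier \<Gamma>. word_eval M x (wd c))"
  have "\<rho> \<in> hom \<Gamma> M"
  proof (rule homI)
    show "\<rho> c \<in> carrier M" if "c \<in> carrier \<Gamma>" for c using that wd closed by (simp add: \<rho>_def)
    fix c d assume cd: "c \<in> carrier \<Gamma>" "d \<in> carrier \<Gamma>"
    have e: "?e (wd (c \<otimes>\<^bsub>\<Gamma>\<^esub> d)) = ?e (wd c @ wd d)"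
      using cd wd \<Gamma>.word_eval_append[OF generator_mem wd(1)[OF cd(2)] wd(1)[OF cd(1)]] by simp
    have "word_eval M x (wd (c \<otimes>\<^bsub>\<Gamma>\<^esub> d)) = word_eval M x (wd c @ wd d)"
      by (rule eq[OF _ _ e]) (use cd wd(1) in simp_all)
    then show "\<rho> (c \<otimes>\<^bsub>\<Gamma>\<^esub> d) = \<rho> c \<otimes>\<^bsub>M\<^esub> \<rho> d"
      using cd M.word_eval_append[of N x, OF xi wd(1)[OF cd(2)] wd(1)[OF cd(1)]] by (simp add: \<rho>_def)
  qed
  then have "\<rho> \<in> Homs \<Gamma> M" by (simp add: Homs_def \<rho>_def)
  moreover have "ev \<rho> = x"
  proof (rule extensionalityI[of _ "{..<N}"])
    show "ev \<rho> \<in> extensional {..<N}" by (simp add: ev_def)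
    show "x \<in> extensional {..<N}" using x by (simp add: PiE_iff)
    fix i assume "i \<in> {..<N}"
    then have i: "i < N" by simp
    have "word_eval M x (wd (\<gamma>s ! i)) = word_eval M x [(True, i)]"
      using i wd[OF generator_mem[OF i]] generator_mem[OF i] by (intro eq) auto
    then show "ev \<rho> i = x i" using i xi generator_mem[OF i] by (simp add: ev_def \<rho>_def)
  qed
  ultimately show "x \<in> ev ` Homs \<Gamma> M" by blast
qed

lemma rep_space_ev: "rep_space \<Gamma> \<gamma>s M B = induced_space (Homs \<Gamma> M) ev (power_space N B)"
  by (simp add: rep_space_def ev_def[abs_def])

end

lemma (in generated_group) component_Homs: "pts (rep_space0 \<Gamma> \<gamma>s M E) \<subseteq> Homs \<Gamma> M"
  using connected_component_of_subset_topspace[of "zariski (rep_space \<Gamma> \<gamma>s M E)" "trivial_rep \<Gamma> M"]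
  by (simp add: rep_space0_def rep_space_ev topspace_zariski[OF fspace_algebra_induced[OF fspace_algebra_power]])

locale representation_quotient = central_quotient G H A + generated_group \<Gamma> \<gamma>s
  for G :: "'g monoid" (structure) and H A and \<Gamma> :: "'c monoid" and \<gamma>s
begin

abbreviation "B \<equiv> power_space N A"
abbreviation "GH \<equiv> G Mod H"
abbreviation "AH \<equiv> coset_space G A H"
abbreviation "R \<equiv> rep_space \<Gamma> \<gamma>s G A"
abbreviation "R' \<equiv> rep_space \<Gamma> \<gamma>s GH AH"
abbreviation "R0 \<equiv> pts (rep_space0 \<Gamma> \<gamma>s G A)"
abbreviation "R0' \<equiv> pts (rep_space0 \<Gamma> \<gamma>s GH AH)"
abbreviation "proj \<equiv> proj_rep \<Gamma> G H"
abbreviation "q \<equiv> qN N"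

text \<open>The preimage under \<open>q\<close> of the representation space of \<open>G/H\<close>, see \<open>q_image_Y\<close> below.\<close>

definition "Y = {x \<in> pts B. \<forall>w\<in>relators. word_eval G x w \<in> H}"

definition "one_tuple = (\<lambda>i\<in>{..<N}. \<one>)"

lemma group_GH: "group GH"
  by (rule normal.factorgroup_is_group[OF normal_H])

lemma coset_hom: "(\<lambda>g. H #> g) \<in> hom G GH"
  by (rule normal.r_coset_hom_Mod[OF normal_H])

lemma carrier_GH: "carrier GH = (\<lambda>g. H #> g) ` carrier G"
  by (auto simp: FactGroup_def RCOSETS_def)

lemma coset_one: "g \<in> carrier G \<Longrightarrow> H #> g = H \<longleftrightarrow> g \<in> H"
  using coset_join1[OF _ _ subgroup_axioms] coset_join2[OF _ subgroup_axioms] subset by blast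

lemma q_tuple: "x \<in> pts B \<Longrightarrow> q x \<in> {..<N} \<rightarrow>\<^sub>E carrier GH"
  by (auto simp: qN_def pts_A carrier_GH)

lemma word_eval_q:
  assumes "x \<in> pts B" "w \<in> words N"
  shows "word_eval GH (q x) w = H #> word_eval G x w"
proof -
  have "H #> word_eval G x w = word_eval GH (\<lambda>i. H #> x i) w"
    using assms(1) by (intro word_eval_hom[OF group_GH coset_hom _ assms(2)]) (auto simp: pts_A)
  also have "\<dots> = word_eval GH (q x) w" by (rule word_eval_cong[OF assms(2)]) (simp add: qN_def)
  finally show ?thesis by simp
qed

text \<open>
  A relator takes a value in \<open>H\<close> at \<open>x\<close> if and only if it is trivial at the image of \<open>x\<close> in \<open>G/H\<close>.
\<close>

lemma Y_iff:
  assumes x: "x \<in> pts B"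
  shows "x \<in> Y \<longleftrightarrow> q x \<in> ev ` Homs \<Gamma> GH"
proof -
  have "word_eval GH (q x) w = \<one>\<^bsub>GH\<^esub> \<longleftrightarrow> word_eval G x w \<in> H" if "w \<in> relators" for w
  proof -
    have w: "w \<in> words N" using that by (simp add: relators_def)
    have "word_eval G x w \<in> carrier G" using x by (intro word_eval_closed[OF _ w]) (auto simp: pts_A)
    then show ?thesis using word_eval_q[OF x w] coset_one by (simp add: FactGroup_def)
  qed
  then show ?thesis using x by (simp add: Y_def ev_image[OF group_GH q_tuple[OF x]] del: pts_simps)
qed

lemma q_image_Y: "q ` Y = ev ` Homs \<Gamma> GH"
proof (intro equalityI subsetI)
  fix z assume "z \<in> q ` Y"
  then show "z \<in> ev ` Homs \<Gamma> GH" using Y_iff by (auto simp: Y_def)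
next
  fix z assume z: "z \<in> ev ` Homs \<Gamma> GH"
  then have "z \<in> pts (power_space N AH)" using ev_pts
    by (fastforce simp: coset_space_quotient pts_A carrier_GH)
  then obtain x where "x \<in> pts B" "z = q x" unfolding power_coset_space by auto
  then show "z \<in> q ` Y" using Y_iff z by blast
qed

lemma morphism_word:
  "w \<in> words N \<Longrightarrow> morphism B A (\<lambda>x. word_eval G x w)"
proof (induction w)
  case Nil
  show ?case by (simp add: morphism_const[OF fspace_algebra_power] pts_A)
next
  case (Cons l w)
  have i: "snd l < N" and w: "w \<in> words N" using Cons.prems by simp_all
  have "morphism B A (\<lambda>x. if fst l then x (snd l) else inv x (snd l))"
    using morphism_coordinate[OF i] morphism_compose[OF morphism_coordinate[OF i] morphism_inv]
    by (cases "fst l") simp_all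
  from morphism_product[OF fspace_algebra_power this Cons.IH[OF w]] show ?case by simp
qed

lemma closed_finite:
  assumes "finite Z" "Z \<subseteq> carrier G"
  shows "closedin (zariski A) Z"
  by (rule closedin_finite_zariski[OF algebra_A assms(1)])
    (use assms(2) affine_algebraic_set_separated[OF affine_A] in \<open>auto simp: pts_A\<close>)

lemma closed_word_preimage:
  assumes "w \<in> words N" "Z \<subseteq> H"
  shows "closedin (zariski B) {x \<in> pts B. word_eval G x w \<in> Z}"
proof -
  have "continuous_map (zariski B) (zariski A) (\<lambda>x. word_eval G x w)"
    by (rule continuous_map_morphism[OF fspace_algebra_power algebra_A morphism_word[OF assms(1)]])
  moreover have "closedin (zariski A) Z"
    using assms(2) finite_H subset by (intro closed_finite) (auto intro: finite_subset)
  ultimately show ?thesis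
    using closedin_continuous_map_preimage topspace_zariski[OF fspace_algebra_power, of N A] by fastforce
qed

lemma closed_Y: "closedin (zariski B) Y"
proof -
  have "[] \<in> relators" by (simp add: relators_def)
  then have "Y = (\<Inter>w\<in>relators. {x \<in> pts B. word_eval G x w \<in> H})" by (auto simp: Y_def)
  moreover have "closedin (zariski B) \<dots>"
  proof (rule closedin_INT)
    show "relators \<noteq> {}" using \<open>[] \<in> relators\<close> by blast
    show "closedin (zariski B) {x \<in> pts B. word_eval G x w \<in> H}" if "w \<in> relators" for w
      by (rule closed_word_preimage) (use that in \<open>simp_all add: relators_def\<close>)
  qed
  ultimately show ?thesis by simp
qed

lemma ev_Homs_subset: "ev ` Homs \<Gamma> G \<subseteq> Y"
proof
  fix x assume x: "x \<in> ev ` Homs \<Gamma> G"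
  then have "x \<in> {..<N} \<rightarrow>\<^sub>E carrier G" using ev_pts by blast
  then have "\<forall>w\<in>relators. word_eval G x w = \<one>" using ev_image[OF is_group] x by blast
  then show "x \<in> Y" using \<open>x \<in> {..<N} \<rightarrow>\<^sub>E carrier G\<close> by (simp add: Y_def pts_A)
qed

lemma trivial_rep_Homs:
  assumes "group M"
  shows "trivial_rep \<Gamma> M \<in> Homs \<Gamma> M"
proof -
  interpret M: group M by fact
  show ?thesis by (auto simp: trivial_rep_def Homs_def hom_def)
qed

lemma ev_trivial: "ev (trivial_rep \<Gamma> M) = (\<lambda>i\<in>{..<N}. \<one>\<^bsub>M\<^esub>)"
  using generator_mem by (auto simp: ev_def trivial_rep_def)

lemma one_tuple_ev: "one_tuple = ev (trivial_rep \<Gamma> G)"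
  by (simp add: ev_trivial one_tuple_def)

lemma q_one_tuple: "q one_tuple = ev (trivial_rep \<Gamma> GH)"
  unfolding ev_trivial qN_def
proof (rule restrict_ext)
  fix i assume "i \<in> {..<N}"
  then show "H #> one_tuple i = \<one>\<^bsub>GH\<^esub>"
    using coset_mult_one[OF subset] by (simp add: one_tuple_def FactGroup_def)
qed

definition "generating_functions = (SOME F. finite F \<and> reg B = generated_algebra (pts B) F)"

lemma generating_functions:
  "finite generating_functions" "reg B = generated_algebra (pts B) generating_functions"
proof -
  obtain F where F: "finite F" "reg A = generated_algebra (pts A) F"
    using affine_algebraic_set_generated[OF affine_A] by blast
  have "{(\<lambda>x. f (x i)) | f i. f \<in> F \<and> i < N} = (\<lambda>(f, i) x. f (x i)) ` (F \<times> {..<N})" by auto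
  then have "finite {(\<lambda>x. f (x i)) | f i. f \<in> F \<and> i < N}" using F(1) by simp
  then have "\<exists>F. finite F \<and> reg B = generated_algebra (pts B) F"
    using power_space_generated[OF F(2), of N] by blast
  from someI_ex[OF this]
  show "finite generating_functions" "reg B = generated_algebra (pts B) generating_functions"
    unfolding generating_functions_def by blast+
qed

sublocale components: noetherian_finite_quotient B "KN N" "actN N" q generating_functions Y one_tuple
proof (intro noetherian_finite_quotient.intro noetherian_finite_quotient_axioms.intro
    power.finite_quotient_axioms generating_functions closed_Y)
  show "characters_are_points B"
    by (rule power_space_characters[OF algebra_A affine_algebraic_set_characters[OF affine_A]])
  show "actN N k y \<in> Y" if "k \<in> carrier (KN N)" "y \<in> Y" for k y
  proof -
    have "y \<in> pts B" using that(2) by (simp add: Y_def)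
    then show ?thesis
      using Y_iff[of y] Y_iff[OF power.act_pts[OF that(1)]] power.q_act[OF that(1)] that(2) by simp
  qed
  show "one_tuple \<in> Y"
    unfolding one_tuple_ev using ev_Homs_subset trivial_rep_Homs[OF is_group] by blast
qed

abbreviation "C \<equiv> components.C"

text \<open>
  On \<open>Y\<close> a relator takes values in the finite set \<open>H\<close>, so the condition that it takes the value \<open>1\<close>
  is both open and closed. Hence the component of the trivial tuple consists of representations.
\<close>

lemma C_subset_Homs: "C \<subseteq> ev ` Homs \<Gamma> G"
proof
  fix x assume x: "x \<in> C"
  let ?T = "subtopology (zariski B) Y"
  have xB: "x \<in> pts B" using x components.C_subset components.Y_subset by blast
  have "word_eval G x w = \<one>" if w: "w \<in> relators" for w
  proof -
    have wN: "w \<in> words N" using w by (simp add: relators_def)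
    let ?Z = "\<lambda>Z. {x \<in> Y. word_eval G x w \<in> Z}"
    have cl: "closedin ?T (?Z Z)" if "Z \<subseteq> H" for Z
    proof -
      have "?Z Z = {x \<in> pts B. word_eval G x w \<in> Z} \<inter> Y" using components.Y_subset by auto
      then show ?thesis using closed_word_preimage[OF wN that] closedin_subtopology by blast
    qed
    have "?Z {\<one>} = topspace ?T - ?Z (H - {\<one>})"
      unfolding components.topspace_Y using w by (auto simp: Y_def)
    then have op: "openin ?T (?Z {\<one>})" using openin_diff[OF openin_topspace cl[of "H - {\<one>}"]] by auto
    have "C \<subseteq> ?Z {\<one>} \<or> disjnt C (?Z {\<one>})"
      by (rule connectedin_clopen_cases[OF components.connected_C cl op]) simp
    moreover have "one_tuple \<in> ?Z {\<one>}"
    proof -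
      have "one_tuple \<in> ev ` Homs \<Gamma> G" "one_tuple \<in> {..<N} \<rightarrow>\<^sub>E carrier G"
        using trivial_rep_Homs[OF is_group] by (simp add: one_tuple_ev) (simp add: one_tuple_def)
      then show ?thesis using ev_image[OF is_group, of one_tuple] w components.y0 by simp
    qed
    ultimately show ?thesis using components.y0_C x unfolding disjnt_iff by blast
  qed
  then show "x \<in> ev ` Homs \<Gamma> G" using ev_image[OF is_group, of x] xB by (simp add: pts_A)
qed

lemma R0_subset: "R0 \<subseteq> Homs \<Gamma> G" and R0'_subset: "R0' \<subseteq> Homs \<Gamma> GH"
  by (rule component_Homs)+

text \<open>
  The component of the trivial tuple is the same in the space of representations as in the larger set
  \<open>Y\<close>, because the component in \<open>Y\<close> consists of representations.
\<close>

lemma ev_R0: "ev ` R0 = C"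
proof -
  let ?S = "ev ` Homs \<Gamma> G"
  have S: "?S \<subseteq> pts B" using ev_Homs_subset components.Y_subset by blast
  have "ev ` R0 = connected_component_of_set (subtopology (zariski B) ?S) (ev (trivial_rep \<Gamma> G))"
    using connected_component_induced[OF fspace_algebra_power S ev_inj[OF is_group] trivial_rep_Homs[OF is_group]]
    by (simp add: rep_space0_def rep_space_ev)
  also have "ev (trivial_rep \<Gamma> G) = one_tuple" by (rule one_tuple_ev[symmetric])
  also have "connected_component_of_set (subtopology (zariski B) ?S) one_tuple = C"
  proof (rule equalityI)
    show "connected_component_of_set (subtopology (zariski B) ?S) one_tuple \<subseteq> C"
      unfolding components.C_def using connected_component_of_mono[OF _ ev_Homs_subset] by blast
    have "connectedin (subtopology (zariski B) ?S) C"
      using components.connected_C C_subset_Homs by (simp add: connectedin_subtopology)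
    then show "C \<subseteq> connected_component_of_set (subtopology (zariski B) ?S) one_tuple"
      using components.y0_C by (rule connected_component_of_maximal)
  qed
  finally show ?thesis .
qed

lemma ev_R0': "ev ` R0' = q ` C"
proof -
  let ?S = "ev ` Homs \<Gamma> GH"
  have S: "?S \<subseteq> pts (power_space N AH)"
    unfolding q_image_Y[symmetric] power_coset_space using components.Y_subset by auto
  have "ev ` R0' = connected_component_of_set (subtopology (zariski (power_space N AH)) ?S) (ev (trivial_rep \<Gamma> GH))"
    using connected_component_induced[OF fspace_algebra_power S ev_inj[OF group_GH] trivial_rep_Homs[OF group_GH]]
    by (simp add: rep_space0_def rep_space_ev)
  also have "\<dots> = q ` C"
    unfolding components.component_image q_one_tuple q_image_Y power_coset_space ..
  finally show ?thesis .
qed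

lemma proj_Homs:
  assumes "\<rho> \<in> Homs \<Gamma> G"
  shows "proj \<rho> \<in> Homs \<Gamma> GH"
proof -
  have "proj \<rho> \<in> hom \<Gamma> GH"
  proof (rule homI)
    fix c d assume "c \<in> carrier \<Gamma>" "d \<in> carrier \<Gamma>"
    moreover from this have "\<rho> c \<in> carrier G" "\<rho> d \<in> carrier G" "\<rho> (c \<otimes>\<^bsub>\<Gamma>\<^esub> d) = \<rho> c \<otimes> \<rho> d"
      using assms by (auto simp: Homs_def hom_def)
    ultimately show "proj \<rho> (c \<otimes>\<^bsub>\<Gamma>\<^esub> d) = proj \<rho> c \<otimes>\<^bsub>GH\<^esub> proj \<rho> d"
      using hom_mult[OF coset_hom] by (simp add: proj_rep_def)
  qed (use assms in \<open>auto simp: proj_rep_def Homs_def hom_def carrier_GH\<close>)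
  then show ?thesis by (simp add: Homs_def proj_rep_def)
qed

lemma ev_proj: "ev (proj \<rho>) = q (ev \<rho>)"
  by (rule ext) (simp add: ev_def proj_rep_def qN_def generator_mem)

lemma proj_R0: "proj ` R0 = R0'"
proof (rule inj_on_image_eq_iff[THEN iffD1, OF ev_inj[OF group_GH]])
  show "proj ` R0 \<subseteq> Homs \<Gamma> GH" using proj_Homs R0_subset by blast
  show "ev ` proj ` R0 = ev ` R0'"
    unfolding ev_R0' ev_R0[symmetric] by (simp add: image_image ev_proj)
qed (rule R0'_subset)

text \<open>
  A function on \<open>R0\<close> that is constant on the fibres of the projection is, on tuples, a function on \<open>C\<close>
  that is constant on the fibres of \<open>q\<close>, so the extension theorem applies to it.
\<close>

lemma descent:
  assumes F: "F \<in> reg R" and u: "\<And>\<rho>. \<rho> \<in> R0 \<Longrightarrow> u (proj \<rho>) = F \<rho>"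
  shows "\<exists>g\<in>reg R'. (\<forall>\<rho>'\<in>R0'. g \<rho>' = u \<rho>') \<and> (\<forall>\<rho>'\<in>Homs \<Gamma> GH - R0'. g \<rho>' = 0)"
proof -
  obtain h where h: "h \<in> reg B" "\<forall>\<rho>\<in>Homs \<Gamma> G. F \<rho> = h (ev \<rho>)"
    using F by (auto simp: rep_space_ev reg_induced)
  have "h c = h d" if cd: "c \<in> C" "d \<in> C" "q c = q d" for c d
  proof -
    obtain \<rho> \<sigma> where \<rho>: "\<rho> \<in> R0" "c = ev \<rho>" "\<sigma> \<in> R0" "d = ev \<sigma>" using cd ev_R0 by blast
    then have "ev (proj \<rho>) = ev (proj \<sigma>)" using cd(3) by (simp add: ev_proj)
    then have "proj \<rho> = proj \<sigma>" using \<rho> R0_subset proj_Homs inj_onD[OF ev_inj[OF group_GH]] by blast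
    moreover have "h (ev \<rho>) = u (proj \<rho>)" "h (ev \<sigma>) = u (proj \<sigma>)"
      using h(2) u[OF \<rho>(1)] u[OF \<rho>(3)] \<rho>(1,3) R0_subset by auto
    ultimately show ?thesis using \<rho>(2,4) by simp
  qed
  from components.extension[OF h(1) this] obtain g where g: "g \<in> reg (power_space N AH)"
      "\<forall>c\<in>C. g (q c) = h c" "\<forall>z\<in>q ` Y - q ` C. g z = 0"
    unfolding power_coset_space by blast
  have "(\<lambda>\<rho>'. g (ev \<rho>')) \<in> reg R'" using g(1) by (auto simp: rep_space_ev reg_induced)
  moreover have "g (ev \<rho>') = u \<rho>'" if \<rho>': "\<rho>' \<in> R0'" for \<rho>'
  proof -
    obtain \<rho> where \<rho>: "\<rho> \<in> R0" "\<rho>' = proj \<rho>" using \<rho>' proj_R0 by blast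
    have "g (ev \<rho>') = h (ev \<rho>)" using g(2) \<rho> ev_R0 by (auto simp: ev_proj)
    then show ?thesis using h(2) u[OF \<rho>(1)] \<rho> R0_subset by auto
  qed
  moreover have "g (ev \<rho>') = 0" if \<rho>': "\<rho>' \<in> Homs \<Gamma> GH - R0'" for \<rho>'
  proof -
    have "ev \<rho>' \<notin> ev ` R0'"
      using \<rho>' inj_on_image_mem_iff[OF ev_inj[OF group_GH] _ R0'_subset] by blast
    then have "ev \<rho>' \<in> q ` Y - q ` C" using \<rho>' ev_R0' q_image_Y by blast
    then show ?thesis using g(3) by blast
  qed
  ultimately show ?thesis by (intro bexI[of _ "\<lambda>\<rho>'. g (ev \<rho>')"]) auto
qed

abbreviation "S \<equiv> Homs' \<Gamma> \<gamma>s G A H"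
abbreviation "act \<equiv> mult_rep \<Gamma> G"

lemma mult_rep_Homs:
  assumes \<sigma>: "\<sigma> \<in> Homs \<Gamma> (G\<lparr>carrier := H\<rparr>)" and \<rho>: "\<rho> \<in> Homs \<Gamma> G"
  shows "act \<sigma> \<rho> \<in> Homs \<Gamma> G"
proof -
  have s: "\<sigma> c \<in> H" "\<sigma> c \<in> carrier G" "\<rho> c \<in> carrier G" if "c \<in> carrier \<Gamma>" for c
    using that \<sigma> \<rho> subset by (auto simp: Homs_def hom_def)
  have "act \<sigma> \<rho> \<in> hom \<Gamma> G"
  proof (rule homI)
    fix c d assume cd: "c \<in> carrier \<Gamma>" "d \<in> carrier \<Gamma>"
    have "\<sigma> c \<otimes> \<sigma> d \<otimes> (\<rho> c \<otimes> \<rho> d) = \<sigma> c \<otimes> (\<sigma> d \<otimes> \<rho> c) \<otimes> \<rho> d"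
      using s[OF cd(1)] s[OF cd(2)] by (simp add: m_assoc)
    also have "\<sigma> d \<otimes> \<rho> c = \<rho> c \<otimes> \<sigma> d" by (rule central[OF s(1)[OF cd(2)] s(3)[OF cd(1)]])
    also have "\<sigma> c \<otimes> (\<rho> c \<otimes> \<sigma> d) \<otimes> \<rho> d = \<sigma> c \<otimes> \<rho> c \<otimes> (\<sigma> d \<otimes> \<rho> d)"
      using s[OF cd(1)] s[OF cd(2)] by (simp add: m_assoc)
    finally show "act \<sigma> \<rho> (c \<otimes>\<^bsub>\<Gamma>\<^esub> d) = act \<sigma> \<rho> c \<otimes> act \<sigma> \<rho> d"
      using cd \<sigma> \<rho> by (simp add: mult_rep_def Homs_def hom_def)
  qed (simp add: mult_rep_def s)
  then show ?thesis by (simp add: Homs_def mult_rep_def)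
qed

lemma ev_mult_rep: "ev (act \<sigma> \<rho>) = actN N (ev \<sigma>) (ev \<rho>)"
  by (rule ext) (simp add: ev_def mult_rep_def actN_def generator_mem)

lemma proj_mult_rep:
  assumes "\<sigma> \<in> Homs \<Gamma> (G\<lparr>carrier := H\<rparr>)" "\<rho> \<in> Homs \<Gamma> G"
  shows "proj (act \<sigma> \<rho>) = proj \<rho>"
  unfolding proj_rep_def
proof (rule restrict_ext)
  fix c assume c: "c \<in> carrier \<Gamma>"
  then have "\<sigma> c \<in> H" "\<rho> c \<in> carrier G" "\<sigma> c \<in> carrier G"
    using assms subset by (auto simp: Homs_def hom_def)
  then have "H #> \<rho> c = H #> act \<sigma> \<rho> c" using coset_eq c by (auto simp: mult_rep_def)
  then show "H #> act \<sigma> \<rho> c = H #> \<rho> c" by simp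
qed

lemma S_Homs: "\<sigma> \<in> S \<Longrightarrow> \<sigma> \<in> Homs \<Gamma> (G\<lparr>carrier := H\<rparr>)"
  and S_R0: "\<sigma> \<in> S \<Longrightarrow> \<rho> \<in> R0 \<Longrightarrow> act \<sigma> \<rho> \<in> R0"
  by (auto simp: Homs'_def)

text \<open>
  Two representations with the same projection differ by a homomorphism to \<open>H\<close>. If both lie in the
  component of the trivial one, that homomorphism maps a point of this component, hence all of it,
  to the component.
\<close>

lemma fibre:
  assumes \<rho>: "\<rho> \<in> R0" and \<rho>': "\<rho>' \<in> R0"
  shows "proj \<rho> = proj \<rho>' \<longleftrightarrow> (\<exists>\<sigma>\<in>S. \<rho>' = act \<sigma> \<rho>)"
proof
  assume "\<exists>\<sigma>\<in>S. \<rho>' = act \<sigma> \<rho>"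
  then show "proj \<rho> = proj \<rho>'" using proj_mult_rep S_Homs \<rho> R0_subset by auto
next
  assume eq: "proj \<rho> = proj \<rho>'"
  have hom: "\<rho> \<in> Homs \<Gamma> G" "\<rho>' \<in> Homs \<Gamma> G" using \<rho> \<rho>' R0_subset by blast+
  then have car: "\<rho> c \<in> carrier G" "\<rho>' c \<in> carrier G" if "c \<in> carrier \<Gamma>" for c
    using that by (auto simp: Homs_def hom_def)
  have "\<exists>h\<in>H. \<rho>' c = h \<otimes> \<rho> c" if c: "c \<in> carrier \<Gamma>" for c
    using fun_cong[OF eq, of c] c coset_eq[OF car[OF c]] by (simp add: proj_rep_def)
  then obtain h where h: "\<And>c. c \<in> carrier \<Gamma> \<Longrightarrow> h c \<in> H" "\<And>c. c \<in> carrier \<Gamma> \<Longrightarrow> \<rho>' c = h c \<otimes> \<rho> c"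
    by metis
  have hG: "h c \<in> carrier G" if "c \<in> carrier \<Gamma>" for c using h(1)[OF that] subset by blast
  define \<sigma> where "\<sigma> = (\<lambda>c\<in>carrier \<Gamma>. h c)"
  have "\<sigma> \<in> hom \<Gamma> (G\<lparr>carrier := H\<rparr>)"
  proof (rule homI)
    fix c d assume cd: "c \<in> carrier \<Gamma>" "d \<in> carrier \<Gamma>"
    note cl = hG[OF cd(1)] hG[OF cd(2)] car[OF cd(1)] car[OF cd(2)]
    \<comment> \<open>Centrality of \<open>h d\<close> is what makes the quotient of two homomorphisms a homomorphism.\<close>
    have "h (c \<otimes>\<^bsub>\<Gamma>\<^esub> d) \<otimes> (\<rho> c \<otimes> \<rho> d) = \<rho>' c \<otimes> \<rho>' d"
      using h(2)[of "c \<otimes>\<^bsub>\<Gamma>\<^esub> d"] cd hom by (simp add: Homs_def hom_def)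
    also have "\<dots> = h c \<otimes> (\<rho> c \<otimes> h d) \<otimes> \<rho> d" using h(2) cd cl by (simp add: m_assoc)
    also have "\<rho> c \<otimes> h d = h d \<otimes> \<rho> c" by (rule central[OF h(1)[OF cd(2)] cl(3), symmetric])
    also have "h c \<otimes> (h d \<otimes> \<rho> c) \<otimes> \<rho> d = (h c \<otimes> h d) \<otimes> (\<rho> c \<otimes> \<rho> d)" using cl by (simp add: m_assoc)
    finally have "h (c \<otimes>\<^bsub>\<Gamma>\<^esub> d) = h c \<otimes> h d"
      using cl hG[of "c \<otimes>\<^bsub>\<Gamma>\<^esub> d"] cd by (subst (asm) right_cancel) auto
    then show "\<sigma> (c \<otimes>\<^bsub>\<Gamma>\<^esub> d) = \<sigma> c \<otimes>\<^bsub>G\<lparr>carrier := H\<rparr>\<^esub> \<sigma> d" using cd by (simp add: \<sigma>_def)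
  qed (simp add: \<sigma>_def h(1))
  then have \<sigma>: "\<sigma> \<in> Homs \<Gamma> (G\<lparr>carrier := H\<rparr>)" by (simp add: Homs_def \<sigma>_def)
  have act: "\<rho>' = act \<sigma> \<rho>"
    using hom(2) h(2) by (intro extensionalityI[of _ "carrier \<Gamma>"]) (auto simp: mult_rep_def \<sigma>_def Homs_def)
  have "ev \<sigma> \<in> carrier (KN N)" using ev_pts[OF \<sigma>] by (simp add: carrier_KN)
  have "act \<sigma> \<tau> \<in> R0" if \<tau>: "\<tau> \<in> R0" for \<tau>
  proof -
    have "ev (act \<sigma> \<tau>) \<in> C"
      unfolding ev_mult_rep
    proof (rule components.act_C[OF \<open>ev \<sigma> \<in> carrier (KN N)\<close>])
      show "ev \<rho> \<in> C" "ev \<tau> \<in> C" "actN N (ev \<sigma>) (ev \<rho>) \<in> C"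
        using \<rho> \<rho>' \<tau> act ev_R0 by (auto simp flip: ev_mult_rep)
    qed
    then show ?thesis
      using inj_on_image_mem_iff[OF ev_inj[OF is_group] mult_rep_Homs[OF \<sigma>] R0_subset] \<tau> R0_subset ev_R0
      by blast
  qed
  then have "\<sigma> \<in> S" using \<sigma> by (auto simp: Homs'_def)
  then show "\<exists>\<sigma>\<in>S. \<rho>' = act \<sigma> \<rho>" using act by blast
qed

end

section \<open>Maps out of quotients\<close>

text \<open>
  A section of \<open>p\<close> followed by \<open>orb\<close> is inverse to \<open>\<phi>\<close>, and on both sides regularity is tested by
  pulling back to \<open>X\<close>.
\<close>

lemma isomorphism_quotient:
  assumes X: "fspace_algebra X"
    and \<phi>: "\<And>x. x \<in> pts X \<Longrightarrow> \<phi> (orb x) = p x"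
    and surj: "p ` pts X = pts Z"
    and inj: "\<And>x y. x \<in> pts X \<Longrightarrow> y \<in> pts X \<Longrightarrow> p x = p y \<Longrightarrow> orb x = orb y"
    and reg: "\<And>u. u \<in> reg Z \<longleftrightarrow> (\<lambda>x. u (p x)) \<in> reg X"
  shows "isomorphism (quotient_space orb X) Z \<phi>"
proof -
  interpret function_algebra "pts X" "reg X" by fact
  define k where "k z = orb (SOME x. x \<in> pts X \<and> p x = z)" for z
  have k: "k (p x) = orb x" if x: "x \<in> pts X" for x
  proof -
    let ?x = "SOME y. y \<in> pts X \<and> p y = p x"
    have "?x \<in> pts X \<and> p ?x = p x" by (rule someI[of _ x]) (use x in simp)
    then show ?thesis unfolding k_def by (intro inj) (use x in auto)
  qed
  have "morphism (quotient_space orb X) Z \<phi>"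
    unfolding morphism_def
  proof (intro conjI ballI)
    show "\<phi> \<in> pts (quotient_space orb X) \<rightarrow> pts Z" using \<phi> surj by auto
    fix f assume "f \<in> reg Z"
    then have "(\<lambda>x. f (p x)) \<in> reg X" by (rule reg[THEN iffD1])
    then have "(\<lambda>x. f (\<phi> (orb x))) \<in> reg X" by (rule cong) (simp add: \<phi>)
    then show "(\<lambda>x. f (\<phi> x)) \<in> reg (quotient_space orb X)" by (simp add: reg_quotient)
  qed
  moreover have "morphism Z (quotient_space orb X) k"
    unfolding morphism_def
  proof (intro conjI ballI)
    show "k \<in> pts Z \<rightarrow> pts (quotient_space orb X)" using k by (auto simp flip: surj)
    fix f assume "f \<in> reg (quotient_space orb X)"
    then have "(\<lambda>x. f (orb x)) \<in> reg X" by (simp add: reg_quotient)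
    then have "(\<lambda>x. f (k (p x))) \<in> reg X" by (rule cong) (simp add: k)
    then show "(\<lambda>z. f (k z)) \<in> reg Z" by (rule reg[of "\<lambda>z. f (k z)", THEN iffD2])
  qed
  moreover have "k (\<phi> y) = y" if "y \<in> pts (quotient_space orb X)" for y
    using that k \<phi> by auto
  moreover have "\<phi> (k z) = z" if "z \<in> pts Z" for z
  proof -
    obtain x where "x \<in> pts X" "z = p x" using \<open>z \<in> pts Z\<close> surj by blast
    then show ?thesis using k \<phi> by simp
  qed
  ultimately show ?thesis unfolding isomorphism_def by blast
qed

lemma reg_subspaceI:
  "g \<in> reg B \<Longrightarrow> (\<And>x. x \<in> S \<Longrightarrow> f x = g x) \<Longrightarrow> f \<in> reg (subspace_of B S)"
  unfolding reg_subspace by (intro CollectI bexI ballI)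

lemma reg_subspaceD: "f \<in> reg (subspace_of B S) \<Longrightarrow> \<exists>g\<in>reg B. \<forall>x\<in>S. f x = g x"
  unfolding reg_subspace by (drule CollectD)

text \<open>
  The universal property, tested on the affine line, says that the invariant regular functions
  factor through the quotient.
\<close>

lemma categorical_quotient_invariant:
  assumes T: "fspace_algebra T" and quot: "categorical_quotient S act T X \<pi>"
    and f: "f \<in> reg T" and inv: "\<And>s a. s \<in> S \<Longrightarrow> a \<in> pts T \<Longrightarrow> f (act s a) = f a"
  shows "\<exists>w\<in>reg X. \<forall>a\<in>pts T. w (\<pi> a) = f a"
proof -
  let ?L = "affine_space 1" and ?V = "{..<1::nat} \<rightarrow>\<^sub>E (UNIV :: complex set)"
  let ?f = "\<lambda>a. \<lambda>i\<in>{..<1::nat}. f a"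
  have V: "closedin (zariski ?L) ?V"
    using closedin_topspace[of "zariski ?L"] by (simp add: topspace_zariski[OF fspace_algebra_affine])
  have coord: "(\<lambda>x. x 0) \<in> reg ?L"
    unfolding affine_space_def by simp (rule generated_algebra.base, blast)
  have "morphism T ?L ?f"
    by (rule morphism_into_generated[OF T, where F = "{(\<lambda>x. x i) | i. i < 1}"])
      (auto simp: affine_space_def f)
  then have mor: "morphism T (subspace_of ?L ?V) ?f"
    unfolding morphism_def reg_subspace pts_subspace
  proof (elim conjE, intro conjI ballI)
    fix g assume "\<forall>h\<in>reg ?L. (\<lambda>x. h (?f x)) \<in> reg T" "g \<in> {g. \<exists>h\<in>reg ?L. \<forall>x\<in>?V. g x = h x}"
    then obtain h where h: "(\<lambda>x. h (?f x)) \<in> reg T" "\<forall>x\<in>?V. g x = h x" by blast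
    show "(\<lambda>x. g (?f x)) \<in> reg T" by (rule function_algebra.cong[OF T h(1)]) (use h(2) in auto)
  qed auto
  have "\<forall>s\<in>S. \<forall>a\<in>pts T. ?f (act s a) = ?f a" using inv by simp
  with V mor have "closedin (zariski ?L) ?V \<and> morphism T (subspace_of ?L ?V) ?f \<and>
      (\<forall>s\<in>S. \<forall>a\<in>pts T. ?f (act s a) = ?f a)" by (intro conjI)
  then have "\<exists>h. morphism X (subspace_of ?L ?V) h \<and> (\<forall>a\<in>pts T. h (\<pi> a) = ?f a) \<and>
      (\<forall>h'. morphism X (subspace_of ?L ?V) h' \<and> (\<forall>a\<in>pts T. h' (\<pi> a) = ?f a) \<longrightarrow>
        (\<forall>x\<in>pts X. h' x = h x))"
    by (rule quot[unfolded categorical_quotient_def, THEN conjunct2, THEN conjunct2, THEN conjunct2,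
        THEN spec[of _ 1], THEN spec[of _ ?V], THEN spec[of _ ?f], THEN mp])
  then obtain h where h: "morphism X (subspace_of ?L ?V) h" "\<forall>a\<in>pts T. h (\<pi> a) = ?f a"
    by (elim exE conjE) (rule that)
  have "(\<lambda>x. h x 0) \<in> reg X"
    by (rule morphismD[OF h(1), of "\<lambda>x. x 0"]) (use coord in \<open>auto simp: reg_subspace\<close>)
  moreover have "h (\<pi> a) 0 = f a" if "a \<in> pts T" for a using h(2) that by simp
  ultimately show ?thesis by (intro bexI[of _ "\<lambda>x. h x 0"]) auto
qed

section \<open>Conjugation and the action of homomorphisms to the central subgroup\<close>

context generated_group
begin

lemma conj_Homs:
  assumes M: "group M" and g: "g \<in> carrier M" and \<rho>: "\<rho> \<in> Homs \<Gamma> M"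
  shows "conj_rep \<Gamma> M g \<rho> \<in> Homs \<Gamma> M"
proof -
  interpret M: group M by fact
  have "conj_rep \<Gamma> M g \<rho> \<in> hom \<Gamma> M"
  proof (rule homI)
    fix c d assume "c \<in> carrier \<Gamma>" "d \<in> carrier \<Gamma>"
    moreover from this have "\<rho> c \<in> carrier M" "\<rho> d \<in> carrier M" "\<rho> (c \<otimes>\<^bsub>\<Gamma>\<^esub> d) = \<rho> c \<otimes>\<^bsub>M\<^esub> \<rho> d"
      using \<rho> by (auto simp: Homs_def hom_def)
    moreover have "inv\<^bsub>M\<^esub> g \<otimes>\<^bsub>M\<^esub> (g \<otimes>\<^bsub>M\<^esub> y) = y" if "y \<in> carrier M" for y
      using that g by (simp flip: M.m_assoc)
    ultimately show "conj_rep \<Gamma> M g \<rho> (c \<otimes>\<^bsub>\<Gamma>\<^esub> d) = conj_rep \<Gamma> M g \<rho> c \<otimes>\<^bsub>M\<^esub> conj_rep \<Gamma> M g \<rho> d"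
      using g by (simp add: conj_rep_def M.m_assoc)
  qed (use \<rho> g in \<open>auto simp: conj_rep_def Homs_def hom_def\<close>)
  then show ?thesis by (simp add: Homs_def conj_rep_def)
qed

lemma conj_inverse:
  assumes M: "group M" and g: "g \<in> carrier M" and \<rho>: "\<rho> \<in> Homs \<Gamma> M"
  shows "conj_rep \<Gamma> M (inv\<^bsub>M\<^esub> g) (conj_rep \<Gamma> M g \<rho>) = \<rho>"
proof (rule extensionalityI[of _ "carrier \<Gamma>"])
  interpret M: group M by fact
  fix c assume c: "c \<in> carrier \<Gamma>"
  then have "\<rho> c \<in> carrier M" using \<rho> by (auto simp: Homs_def hom_def)
  moreover have "inv\<^bsub>M\<^esub> g \<otimes>\<^bsub>M\<^esub> (g \<otimes>\<^bsub>M\<^esub> y) = y" if "y \<in> carrier M" for y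
    using that g by (simp flip: M.m_assoc)
  ultimately show "conj_rep \<Gamma> M (inv\<^bsub>M\<^esub> g) (conj_rep \<Gamma> M g \<rho>) c = \<rho> c"
    using c g by (simp add: conj_rep_def M.m_assoc)
qed (use \<rho> in \<open>auto simp: conj_rep_def Homs_def\<close>)

end

context representation_quotient
begin

lemma algebra_R: "fspace_algebra R" and algebra_R': "fspace_algebra R'"
  unfolding rep_space_ev by (intro fspace_algebra_induced fspace_algebra_power)+

lemma pts_R: "pts R = Homs \<Gamma> G" and pts_R': "pts R' = Homs \<Gamma> GH"
  by (simp_all add: rep_space_ev)

text \<open>
  The regular functions on representations are restrictions of those on tuples, so regularity of a map
  follows from regularity on tuples.
\<close>

lemma morphism_R:
  assumes "\<And>\<rho>. \<rho> \<in> Homs \<Gamma> G \<Longrightarrow> f \<rho> \<in> Homs \<Gamma> G" and t: "morphism B B t"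
    and ev: "\<And>\<rho>. \<rho> \<in> Homs \<Gamma> G \<Longrightarrow> ev (f \<rho>) = t (ev \<rho>)"
  shows "morphism R R f"
  unfolding morphism_def
proof (intro conjI ballI)
  fix u assume "u \<in> reg R"
  then obtain h where h: "h \<in> reg B" "\<forall>\<rho>\<in>Homs \<Gamma> G. u \<rho> = h (ev \<rho>)" by (auto simp: rep_space_ev reg_induced)
  have "u (f \<rho>) = h (t (ev \<rho>))" if "\<rho> \<in> Homs \<Gamma> G" for \<rho> using h(2) assms(1)[OF that] ev[OF that] by simp
  then show "(\<lambda>\<rho>. u (f \<rho>)) \<in> reg R"
    using morphismD[OF t h(1)] unfolding rep_space_ev reg_induced
    by (intro CollectI bexI[of _ "\<lambda>x. h (t x)"]) auto
qed (use assms(1) in \<open>simp add: pts_R\<close>)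

lemma morphism_proj: "morphism R R' proj"
  unfolding morphism_def
proof (intro conjI ballI)
  fix u assume "u \<in> reg R'"
  then obtain h where h: "h \<in> reg (power_space N AH)" "\<forall>\<rho>\<in>Homs \<Gamma> GH. u \<rho> = h (ev \<rho>)"
    by (auto simp: rep_space_ev reg_induced)
  have "(\<lambda>x. h (q x)) \<in> reg B" using h(1) by (simp add: power_coset_space reg_quotient)
  moreover have "u (proj \<rho>) = h (q (ev \<rho>))" if "\<rho> \<in> Homs \<Gamma> G" for \<rho>
    using h(2) proj_Homs[OF that] by (simp add: ev_proj)
  ultimately show "(\<lambda>\<rho>. u (proj \<rho>)) \<in> reg R"
    unfolding rep_space_ev reg_induced by (intro CollectI bexI[of _ "\<lambda>x. h (q x)"]) auto
qed (use proj_Homs in \<open>simp add: pts_R pts_R'\<close>)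

lemma morphism_act:
  assumes "\<sigma> \<in> Homs \<Gamma> (G\<lparr>carrier := H\<rparr>)"
  shows "morphism R R (act \<sigma>)"
proof (rule morphism_R[OF mult_rep_Homs[OF assms] power.act_morphism[of "ev \<sigma>"]])
  show "ev \<sigma> \<in> carrier (KN N)" using ev_pts[OF assms] by (simp add: carrier_KN)
qed (simp_all add: ev_mult_rep)

lemma morphism_conj:
  assumes g: "g \<in> carrier G"
  shows "morphism R R (conj_rep \<Gamma> G g)"
proof (rule morphism_R[OF conj_Homs[OF is_group g], where t = "\<lambda>x. \<lambda>i\<in>{..<N}. g \<otimes> x i \<otimes> inv g"])
  show "morphism B B (\<lambda>x. \<lambda>i\<in>{..<N}. g \<otimes> x i \<otimes> inv g)"
  proof (rule morphism_into_power[OF fspace_algebra_power])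
    fix i assume i: "i < N"
    have "morphism B A (\<lambda>x. g \<otimes> x i \<otimes> inv g)"
      by (intro morphism_product fspace_algebra_power morphism_const morphism_coordinate i)
        (simp_all add: pts_A g)
    then show "morphism B A (\<lambda>x. (\<lambda>i\<in>{..<N}. g \<otimes> x i \<otimes> inv g) i)" using i by simp
  qed simp
  show "ev (conj_rep \<Gamma> G g \<rho>) = (\<lambda>i\<in>{..<N}. g \<otimes> ev \<rho> i \<otimes> inv g)" for \<rho>
    by (rule ext) (simp add: ev_def conj_rep_def generator_mem)
qed assumption

text \<open>
  Conjugation is continuous and fixes the trivial representation, so it preserves its component.
\<close>

lemma conj_R0:
  assumes g: "g \<in> carrier G" and \<rho>: "\<rho> \<in> R0"
  shows "conj_rep \<Gamma> G g \<rho> \<in> R0"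
proof -
  have R0: "R0 = connected_component_of_set (zariski R) (trivial_rep \<Gamma> G)" by (simp add: rep_space0_def)
  have "connectedin (zariski R) (conj_rep \<Gamma> G g ` R0)"
    by (rule connectedin_continuous_map_image[OF continuous_map_morphism[OF algebra_R algebra_R morphism_conj[OF g]]])
      (simp add: R0 connectedin_connected_component_of)
  moreover have "trivial_rep \<Gamma> G \<in> conj_rep \<Gamma> G g ` R0"
  proof (rule image_eqI)
    show "trivial_rep \<Gamma> G = conj_rep \<Gamma> G g (trivial_rep \<Gamma> G)"
      using g by (intro ext) (simp add: conj_rep_def trivial_rep_def)
    show "trivial_rep \<Gamma> G \<in> R0"
      unfolding R0 mem_Collect_eq connected_component_of_refl topspace_zariski[OF algebra_R] pts_R
      by (rule trivial_rep_Homs[OF is_group])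
  qed
  ultimately have "conj_rep \<Gamma> G g ` R0 \<subseteq> R0" unfolding R0 by (rule connected_component_of_maximal)
  then show ?thesis using \<rho> by blast
qed

lemma proj_conj:
  assumes g: "g \<in> carrier G" and \<rho>: "\<rho> \<in> Homs \<Gamma> G"
  shows "proj (conj_rep \<Gamma> G g \<rho>) = conj_rep \<Gamma> GH (H #> g) (proj \<rho>)"
  unfolding proj_rep_def[of _ _ _ "conj_rep \<Gamma> G g \<rho>"] conj_rep_def[of _ GH]
proof (rule restrict_ext)
  interpret h: group_hom G GH "\<lambda>g. H #> g"
    using group_GH coset_hom is_group by (simp add: group_hom_def group_hom_axioms_def)
  fix c assume c: "c \<in> carrier \<Gamma>"
  then have "\<rho> c \<in> carrier G" using \<rho> by (auto simp: Homs_def hom_def)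
  then show "H #> conj_rep \<Gamma> G g \<rho> c = (H #> g) \<otimes>\<^bsub>GH\<^esub> proj \<rho> c \<otimes>\<^bsub>GH\<^esub> inv\<^bsub>GH\<^esub> (H #> g)"
    using c g h.hom_mult h.hom_inv by (simp add: conj_rep_def proj_rep_def)
qed

lemma act_conj:
  assumes \<sigma>: "\<sigma> \<in> Homs \<Gamma> (G\<lparr>carrier := H\<rparr>)" and g: "g \<in> carrier G" and \<rho>: "\<rho> \<in> Homs \<Gamma> G"
  shows "act \<sigma> (conj_rep \<Gamma> G g \<rho>) = conj_rep \<Gamma> G g (act \<sigma> \<rho>)"
  unfolding mult_rep_def[of _ _ _ "conj_rep \<Gamma> G g \<rho>"] conj_rep_def[of _ _ _ "act \<sigma> \<rho>"]
proof (rule restrict_ext)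
  fix c assume c: "c \<in> carrier \<Gamma>"
  then have s: "\<sigma> c \<in> H" "\<sigma> c \<in> carrier G" "\<rho> c \<in> carrier G"
    using \<sigma> \<rho> subset by (auto simp: Homs_def hom_def)
  have "\<sigma> c \<otimes> (g \<otimes> \<rho> c \<otimes> inv g) = (\<sigma> c \<otimes> g) \<otimes> \<rho> c \<otimes> inv g" using s g by (simp add: m_assoc)
  also have "\<sigma> c \<otimes> g = g \<otimes> \<sigma> c" by (rule central[OF s(1) g])
  also have "(g \<otimes> \<sigma> c) \<otimes> \<rho> c \<otimes> inv g = g \<otimes> (\<sigma> c \<otimes> \<rho> c) \<otimes> inv g" using s g by (simp add: m_assoc)
  finally show "\<sigma> c \<otimes> conj_rep \<Gamma> G g \<rho> c = g \<otimes> act \<sigma> \<rho> c \<otimes> inv g"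
    using c by (simp add: conj_rep_def mult_rep_def)
qed

lemma finite_S: "finite S"
proof (rule finite_imageD)
  show "inj_on ev S"
    using ev_inj[OF group_H] S_Homs by (meson inj_on_subset subsetI)
  have "ev ` S \<subseteq> carrier (KN N)" using ev_pts[OF S_Homs] by (auto simp: carrier_KN)
  then show "finite (ev ` S)" using power.finite_K by (rule finite_subset)
qed

lemma trivial_S: "trivial_rep \<Gamma> G \<in> S"
  and act_trivial: "\<rho> \<in> Homs \<Gamma> G \<Longrightarrow> act (trivial_rep \<Gamma> G) \<rho> = \<rho>"
proof -
  have act: "act (trivial_rep \<Gamma> G) \<rho> = \<rho>" if "\<rho> \<in> Homs \<Gamma> G" for \<rho>
    using that by (intro extensionalityI[of _ "carrier \<Gamma>"])
      (auto simp: mult_rep_def trivial_rep_def Homs_def hom_def Pi_def)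
  then show "\<rho> \<in> Homs \<Gamma> G \<Longrightarrow> act (trivial_rep \<Gamma> G) \<rho> = \<rho>" .
  have "trivial_rep \<Gamma> G \<in> Homs \<Gamma> (G\<lparr>carrier := H\<rparr>)"
    using trivial_rep_Homs[OF group_H] by (simp add: trivial_rep_def)
  moreover have "act (trivial_rep \<Gamma> G) ` R0 \<subseteq> R0" using act R0_subset by auto
  ultimately show "trivial_rep \<Gamma> G \<in> S" by (simp add: Homs'_def)
qed

lemma act_act:
  assumes \<sigma>: "\<sigma> \<in> S" and \<tau>: "\<tau> \<in> S" and \<rho>: "\<rho> \<in> Homs \<Gamma> G"
  shows "act \<sigma> (act \<tau> \<rho>) = act (act \<sigma> \<tau>) \<rho>"
  unfolding mult_rep_def[of _ _ _ "act \<tau> \<rho>"] mult_rep_def[of _ _ "act \<sigma> \<tau>"]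
proof (rule restrict_ext)
  fix c assume c: "c \<in> carrier \<Gamma>"
  then have "\<sigma> c \<in> carrier G" "\<tau> c \<in> carrier G" "\<rho> c \<in> carrier G"
    using S_Homs[OF \<sigma>] S_Homs[OF \<tau>] \<rho> subset by (auto simp: Homs_def hom_def)
  then show "\<sigma> c \<otimes> act \<tau> \<rho> c = act \<sigma> \<tau> c \<otimes> \<rho> c" using c by (simp add: mult_rep_def m_assoc)
qed

lemma translation_S:
  assumes \<tau>: "\<tau> \<in> S"
  shows "bij_betw (\<lambda>\<sigma>. act \<sigma> \<tau>) S S"
proof -
  have closed: "act \<sigma> \<tau> \<in> S" if \<sigma>: "\<sigma> \<in> S" for \<sigma>
  proof -
    have "act \<sigma> \<tau> \<in> Homs \<Gamma> G"
      using S_Homs[OF \<tau>] subset by (intro mult_rep_Homs S_Homs \<sigma>) (auto simp: Homs_def hom_def)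
    moreover have "act \<sigma> \<tau> c \<in> H" if "c \<in> carrier \<Gamma>" for c
      using S_Homs[OF \<sigma>] S_Homs[OF \<tau>] that by (auto simp: mult_rep_def Homs_def hom_def)
    ultimately have "act \<sigma> \<tau> \<in> Homs \<Gamma> (G\<lparr>carrier := H\<rparr>)" by (auto simp: Homs_def hom_def)
    moreover have "act (act \<sigma> \<tau>) \<rho> \<in> R0" if "\<rho> \<in> R0" for \<rho>
      using S_R0[OF \<sigma> S_R0[OF \<tau> that]] act_act[OF \<sigma> \<tau>] that R0_subset by auto
    ultimately show ?thesis by (auto simp: Homs'_def)
  qed
  have inj: "inj_on (\<lambda>\<sigma>. act \<sigma> \<tau>) S"
  proof (rule inj_onI)
    fix \<sigma> \<sigma>' assume s: "\<sigma> \<in> S" "\<sigma>' \<in> S" "act \<sigma> \<tau> = act \<sigma>' \<tau>"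
    show "\<sigma> = \<sigma>'"
    proof (rule extensionalityI[of _ "carrier \<Gamma>"])
      fix c assume c: "c \<in> carrier \<Gamma>"
      then have "\<sigma> c \<in> carrier G" "\<sigma>' c \<in> carrier G" "\<tau> c \<in> carrier G"
        using S_Homs[OF s(1)] S_Homs[OF s(2)] S_Homs[OF \<tau>] subset by (auto simp: Homs_def hom_def)
      moreover have "\<sigma> c \<otimes> \<tau> c = \<sigma>' c \<otimes> \<tau> c" using fun_cong[OF s(3), of c] c by (simp add: mult_rep_def)
      ultimately show "\<sigma> c = \<sigma>' c" by simp
    qed (use S_Homs[OF s(1)] S_Homs[OF s(2)] in \<open>auto simp: Homs_def\<close>)
  qed
  have "(\<lambda>\<sigma>. act \<sigma> \<tau>) ` S \<subseteq> S" by (intro image_subsetI closed)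
  from endo_inj_surj[OF finite_S this inj] inj show ?thesis unfolding bij_betw_def by (intro conjI)
qed

lemma orbit_R0:
  assumes \<rho>: "\<rho> \<in> R0"
  shows "orbit_of S act \<rho> = {\<tau> \<in> R0. proj \<tau> = proj \<rho>}"
proof (intro equalityI subsetI)
  fix \<tau> assume "\<tau> \<in> orbit_of S act \<rho>"
  then obtain \<sigma> where "\<sigma> \<in> S" "\<tau> = act \<sigma> \<rho>" unfolding orbit_of_def by blast
  then have "\<tau> \<in> R0" "proj \<rho> = proj \<tau>"
    using S_R0[OF _ \<rho>] proj_mult_rep[OF S_Homs] \<rho> R0_subset by auto
  then show "\<tau> \<in> {\<tau> \<in> R0. proj \<tau> = proj \<rho>}" by simp
next
  fix \<tau> assume "\<tau> \<in> {\<tau> \<in> R0. proj \<tau> = proj \<rho>}"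
  then have "\<tau> \<in> R0" "proj \<rho> = proj \<tau>" by simp_all
  then obtain \<sigma> where "\<sigma> \<in> S" "\<tau> = act \<sigma> \<rho>" using fibre[OF \<rho>] by blast
  then show "\<tau> \<in> orbit_of S act \<rho>" unfolding orbit_of_def by blast
qed

section \<open>The isomorphism of representation spaces\<close>

definition "\<phi> U = proj (SOME \<rho>. \<rho> \<in> U)"

lemma \<phi>_orbit:
  assumes "\<rho> \<in> R0"
  shows "\<phi> (orbit_of S act \<rho>) = proj \<rho>"
proof -
  have "\<rho> \<in> orbit_of S act \<rho>" using assms by (simp add: orbit_R0)
  then have "(SOME \<tau>. \<tau> \<in> orbit_of S act \<rho>) \<in> orbit_of S act \<rho>"
    by (rule someI[of "\<lambda>\<tau>. \<tau> \<in> orbit_of S act \<rho>"])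
  then show ?thesis using assms by (simp add: orbit_R0 \<phi>_def)
qed

lemma reg_R0: "reg (rep_space0 \<Gamma> \<gamma>s G A) = {f. \<exists>F\<in>reg R. \<forall>\<rho>\<in>R0. f \<rho> = F \<rho>}"
  by (simp add: rep_space0_def reg_subspace)

lemma reg_R0': "reg (rep_space0 \<Gamma> \<gamma>s GH AH) = {f. \<exists>F\<in>reg R'. \<forall>\<rho>\<in>R0'. f \<rho> = F \<rho>}"
  by (simp add: rep_space0_def reg_subspace)

theorem representation_isomorphism:
  "isomorphism (orbit_space S act (rep_space0 \<Gamma> \<gamma>s G A)) (rep_space0 \<Gamma> \<gamma>s GH AH) \<phi>"
  unfolding orbit_space_def
proof (rule isomorphism_quotient[where p = proj])
  show "fspace_algebra (rep_space0 \<Gamma> \<gamma>s G A)"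
    unfolding rep_space0_def by (rule fspace_algebra_subspace[OF algebra_R])
  show "orbit_of S act \<rho> = orbit_of S act \<tau>" if "\<rho> \<in> R0" "\<tau> \<in> R0" "proj \<rho> = proj \<tau>" for \<rho> \<tau>
    using that by (simp add: orbit_R0)
  fix u
  show "u \<in> reg (rep_space0 \<Gamma> \<gamma>s GH AH) \<longleftrightarrow> (\<lambda>\<rho>. u (proj \<rho>)) \<in> reg (rep_space0 \<Gamma> \<gamma>s G A)"
  proof
    assume "u \<in> reg (rep_space0 \<Gamma> \<gamma>s GH AH)"
    then have "\<exists>F\<in>reg R'. \<forall>\<rho>\<in>R0'. u \<rho> = F \<rho>" unfolding reg_R0' by (rule CollectD)
    then obtain F where F: "F \<in> reg R'" "\<forall>\<rho>\<in>R0'. u \<rho> = F \<rho>" by (rule bexE)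
    have "u (proj \<rho>) = F (proj \<rho>)" if "\<rho> \<in> R0" for \<rho>
      using that proj_R0 by (intro F(2)[THEN bspec]) blast
    then show "(\<lambda>\<rho>. u (proj \<rho>)) \<in> reg (rep_space0 \<Gamma> \<gamma>s G A)"
      unfolding reg_R0
      by (intro CollectI bexI[OF _ morphismD[OF morphism_proj F(1)]] ballI)
  next
    assume "(\<lambda>\<rho>. u (proj \<rho>)) \<in> reg (rep_space0 \<Gamma> \<gamma>s G A)"
    then have "\<exists>F\<in>reg R. \<forall>\<rho>\<in>R0. u (proj \<rho>) = F \<rho>" unfolding reg_R0 by (rule CollectD)
    then obtain F where F: "F \<in> reg R" "\<forall>\<rho>\<in>R0. u (proj \<rho>) = F \<rho>" by (rule bexE)
    have "\<exists>g\<in>reg R'. (\<forall>\<rho>'\<in>R0'. g \<rho>' = u \<rho>') \<and> (\<forall>\<rho>'\<in>Homs \<Gamma> GH - R0'. g \<rho>' = 0)"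
      by (rule descent[OF F(1)]) (rule F(2)[THEN bspec])
    then obtain g where g: "g \<in> reg R'" "\<forall>\<rho>'\<in>R0'. g \<rho>' = u \<rho>'" by (elim bexE conjE) (rule that)
    show "u \<in> reg (rep_space0 \<Gamma> \<gamma>s GH AH)"
      unfolding reg_R0' by (intro CollectI bexI[OF _ g(1)] ballI) (simp add: g(2))
  qed
qed (simp_all add: \<phi>_orbit proj_R0)

end

section \<open>The isomorphism of character varieties\<close>

locale character_quotient = representation_quotient +
  fixes X :: "'x fspace" and \<pi> and X' :: "'y fspace" and \<pi>'
  assumes X: "is_character_variety \<Gamma> \<gamma>s G A X \<pi>"
    and X': "is_character_variety \<Gamma> \<gamma>s (G Mod H) (coset_space G A H) X' \<pi>'"
begin

lemma affine_X: "affine_algebraic_set X" and morphism_\<pi>: "morphism R X \<pi>"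
  and \<pi>_conj: "g \<in> carrier G \<Longrightarrow> \<rho> \<in> Homs \<Gamma> G \<Longrightarrow> \<pi> (conj_rep \<Gamma> G g \<rho>) = \<pi> \<rho>"
  using X unfolding is_character_variety_def categorical_quotient_def by (simp_all add: pts_R)

lemma affine_X': "affine_algebraic_set X'" and morphism_\<pi>': "morphism R' X' \<pi>'"
  and \<pi>'_conj: "g \<in> carrier GH \<Longrightarrow> \<rho> \<in> Homs \<Gamma> GH \<Longrightarrow> \<pi>' (conj_rep \<Gamma> GH g \<rho>) = \<pi>' \<rho>"
  using X' unfolding is_character_variety_def categorical_quotient_def by (simp_all add: pts_R')

lemma \<pi>_pts: "\<rho> \<in> Homs \<Gamma> G \<Longrightarrow> \<pi> \<rho> \<in> pts X" and \<pi>'_pts: "\<rho>' \<in> Homs \<Gamma> GH \<Longrightarrow> \<pi>' \<rho>' \<in> pts X'"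
  using morphism_pts[OF morphism_\<pi>] morphism_pts[OF morphism_\<pi>'] by (simp_all add: pts_R pts_R')

lemma invariant_factors:
  assumes "f \<in> reg R" "\<And>g \<rho>. g \<in> carrier G \<Longrightarrow> \<rho> \<in> Homs \<Gamma> G \<Longrightarrow> f (conj_rep \<Gamma> G g \<rho>) = f \<rho>"
  shows "\<exists>w\<in>reg X. \<forall>\<rho>\<in>Homs \<Gamma> G. w (\<pi> \<rho>) = f \<rho>"
  using categorical_quotient_invariant[OF algebra_R X[unfolded is_character_variety_def] assms(1)] assms(2)
  by (simp add: pts_R)

lemma invariant_factors':
  assumes "f \<in> reg R'" "\<And>g \<rho>. g \<in> carrier GH \<Longrightarrow> \<rho> \<in> Homs \<Gamma> GH \<Longrightarrow> f (conj_rep \<Gamma> GH g \<rho>) = f \<rho>"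
  shows "\<exists>w\<in>reg X'. \<forall>\<rho>\<in>Homs \<Gamma> GH. w (\<pi>' \<rho>) = f \<rho>"
  using categorical_quotient_invariant[OF algebra_R' X'[unfolded is_character_variety_def] assms(1)] assms(2)
  by (simp add: pts_R')

text \<open>
  Since the identity component downstairs is stable under conjugation, an invariant function on it
  stays invariant when it is extended by zero. The extension lives on the whole representation space,
  where the universal property of the quotient applies.
\<close>

lemma invariant_descent:
  assumes F: "F \<in> reg R"
    and conj: "\<And>g \<rho>. g \<in> carrier G \<Longrightarrow> \<rho> \<in> R0 \<Longrightarrow> F (conj_rep \<Gamma> G g \<rho>) = F \<rho>"
    and fib: "\<And>\<rho> \<tau>. \<rho> \<in> R0 \<Longrightarrow> \<tau> \<in> R0 \<Longrightarrow> proj \<rho> = proj \<tau> \<Longrightarrow> F \<rho> = F \<tau>"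
  shows "\<exists>w\<in>reg X'. \<forall>\<rho>\<in>R0. w (\<pi>' (proj \<rho>)) = F \<rho>"
proof -
  define u where "u \<rho>' = F (SOME \<rho>. \<rho> \<in> R0 \<and> proj \<rho> = \<rho>')" for \<rho>'
  have u: "u (proj \<rho>) = F \<rho>" if \<rho>: "\<rho> \<in> R0" for \<rho>
  proof -
    let ?\<tau> = "SOME \<tau>. \<tau> \<in> R0 \<and> proj \<tau> = proj \<rho>"
    have "?\<tau> \<in> R0 \<and> proj ?\<tau> = proj \<rho>" by (rule someI[of _ \<rho>]) (use \<rho> in simp)
    then show ?thesis unfolding u_def by (intro fib) (use \<rho> in auto)
  qed
  obtain g where g: "g \<in> reg R'" "\<forall>\<rho>'\<in>R0'. g \<rho>' = u \<rho>'" "\<forall>\<rho>'\<in>Homs \<Gamma> GH - R0'. g \<rho>' = 0"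
    using descent[OF F u] by blast
  have conj_R0': "conj_rep \<Gamma> GH (H #> s) (proj \<rho>) \<in> R0'" if "s \<in> carrier G" "\<rho> \<in> R0" for s \<rho>
    using conj_R0[OF that] proj_conj[OF that(1)] that(2) R0_subset proj_R0 by (metis image_eqI subsetD)
  have "g (conj_rep \<Gamma> GH s a) = g a" if s: "s \<in> carrier GH" and a: "a \<in> Homs \<Gamma> GH" for s a
  proof -
    obtain t where t: "t \<in> carrier G" "s = H #> t" using s carrier_GH by blast
    show ?thesis
    proof (cases "a \<in> R0'")
      case True
      then obtain \<rho> where \<rho>: "\<rho> \<in> R0" "a = proj \<rho>" using proj_R0 by blast
      have "g (conj_rep \<Gamma> GH s a) = u (proj (conj_rep \<Gamma> G t \<rho>))"
        using g(2) conj_R0'[OF t(1) \<rho>(1)] proj_conj[OF t(1)] \<rho> R0_subset t(2) by auto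
      also have "\<dots> = F \<rho>" using u[OF conj_R0[OF t(1) \<rho>(1)]] conj[OF t(1) \<rho>(1)] by simp
      finally show ?thesis using g(2) True u[OF \<rho>(1)] \<rho>(2) by simp
    next
      case False
      have "conj_rep \<Gamma> GH s a \<notin> R0'"
      proof
        assume "conj_rep \<Gamma> GH s a \<in> R0'"
        then obtain \<rho> where \<rho>: "\<rho> \<in> R0" "conj_rep \<Gamma> GH s a = proj \<rho>" using proj_R0 by blast
        have "inv\<^bsub>GH\<^esub> s \<in> carrier GH" using group.inv_closed[OF group_GH s] .
        then obtain r where "r \<in> carrier G" "inv\<^bsub>GH\<^esub> s = H #> r" using carrier_GH by blast
        then have "conj_rep \<Gamma> GH (inv\<^bsub>GH\<^esub> s) (conj_rep \<Gamma> GH s a) \<in> R0'"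
          using conj_R0'[of r \<rho>] \<rho> by simp
        then show False using conj_inverse[OF group_GH s a] False by simp
      qed
      then show ?thesis using g(3) False a conj_Homs[OF group_GH s a] by simp
    qed
  qed
  from invariant_factors'[OF g(1) this] obtain w where
    w: "w \<in> reg X'" "\<forall>\<rho>'\<in>Homs \<Gamma> GH. w (\<pi>' \<rho>') = g \<rho>'" by blast
  have "w (\<pi>' (proj \<rho>)) = F \<rho>" if \<rho>: "\<rho> \<in> R0" for \<rho>
  proof -
    have "proj \<rho> \<in> R0'" using \<rho> proj_R0 by blast
    then show ?thesis using w(2) g(2) u[OF \<rho>] R0'_subset by auto
  qed
  then show ?thesis using w(1) by blast
qed

text \<open>
  If \<open>f \<rho>\<close> and \<open>f \<tau>\<close> were different, a regular function on \<open>E\<close> separating them would pull back to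
  an invariant regular function that does not factor through \<open>\<pi>\<close>.
\<close>

lemma \<pi>_determines:
  assumes f: "morphism R E f" and E: "affine_algebraic_set E"
    and inv: "\<And>g \<rho>. g \<in> carrier G \<Longrightarrow> \<rho> \<in> Homs \<Gamma> G \<Longrightarrow> f (conj_rep \<Gamma> G g \<rho>) = f \<rho>"
    and \<rho>: "\<rho> \<in> Homs \<Gamma> G" "\<tau> \<in> Homs \<Gamma> G" "\<pi> \<rho> = \<pi> \<tau>"
  shows "f \<rho> = f \<tau>"
proof (rule ccontr)
  assume "f \<rho> \<noteq> f \<tau>"
  then obtain e where e: "e \<in> reg E" "e (f \<rho>) \<noteq> e (f \<tau>)"
    using affine_algebraic_set_separated[OF E] morphism_pts[OF f] \<rho>(1,2) pts_R by metis
  obtain w where "\<forall>\<rho>\<in>Homs \<Gamma> G. w (\<pi> \<rho>) = e (f \<rho>)"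
    using invariant_factors[OF morphismD[OF f e(1)]] inv by auto
  then show False using e(2) \<rho> by metis
qed

lemma \<pi>'_proj_determined:
  assumes "\<rho> \<in> Homs \<Gamma> G" "\<tau> \<in> Homs \<Gamma> G" "\<pi> \<rho> = \<pi> \<tau>"
  shows "\<pi>' (proj \<rho>) = \<pi>' (proj \<tau>)"
proof (rule \<pi>_determines[OF morphism_compose[OF morphism_proj morphism_\<pi>'] affine_X' _ assms])
  show "\<pi>' (proj (conj_rep \<Gamma> G g \<rho>)) = \<pi>' (proj \<rho>)" if "g \<in> carrier G" "\<rho> \<in> Homs \<Gamma> G" for g \<rho>
    using proj_conj[OF that] \<pi>'_conj[of "H #> g" "proj \<rho>"] proj_Homs[OF that(2)] that(1) carrier_GH by simp
qed

abbreviation "act_X \<equiv> descended_action R0 \<pi> act"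

lemma act_X:
  assumes \<sigma>: "\<sigma> \<in> S" and \<rho>: "\<rho> \<in> R0"
  shows "act_X \<sigma> (\<pi> \<rho>) = \<pi> (act \<sigma> \<rho>)"
proof -
  have "\<pi> (act \<sigma> \<rho>) = \<pi> (act \<sigma> \<tau>)" if \<tau>: "\<tau> \<in> R0" "\<pi> \<tau> = \<pi> \<rho>" for \<tau>
  proof (rule \<pi>_determines[OF morphism_compose[OF morphism_act[OF S_Homs[OF \<sigma>]] morphism_\<pi>] affine_X])
    show "\<pi> (act \<sigma> (conj_rep \<Gamma> G g \<rho>)) = \<pi> (act \<sigma> \<rho>)" if "g \<in> carrier G" "\<rho> \<in> Homs \<Gamma> G" for g \<rho>
      using act_conj[OF S_Homs[OF \<sigma>] that] \<pi>_conj[OF that(1) mult_rep_Homs[OF S_Homs[OF \<sigma>] that(2)]] by simp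
  qed (use \<rho> \<tau> R0_subset in auto)
  then have "\<forall>\<tau>\<in>R0. \<pi> \<tau> = \<pi> \<rho> \<longrightarrow> \<pi> (act \<sigma> \<rho>) = \<pi> (act \<sigma> \<tau>)" by (intro ballI impI)
  then show ?thesis
    unfolding descended_action_def by (rule the_equality) (use \<rho> in simp)
qed

lemma orbit_X:
  assumes \<rho>: "\<rho> \<in> R0"
  shows "orbit_of S act_X (\<pi> \<rho>) = \<pi> ` {\<tau> \<in> R0. proj \<tau> = proj \<rho>}"
proof -
  have "orbit_of S act_X (\<pi> \<rho>) = (\<lambda>\<sigma>. act_X \<sigma> (\<pi> \<rho>)) ` S"
    unfolding orbit_of_def by (rule Setcompr_eq_image)
  also have "\<dots> = (\<lambda>\<sigma>. \<pi> (act \<sigma> \<rho>)) ` S" by (intro image_cong refl act_X[OF _ \<rho>])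
  also have "\<dots> = \<pi> ` (\<lambda>\<sigma>. act \<sigma> \<rho>) ` S" by (simp only: image_image)
  also have "(\<lambda>\<sigma>. act \<sigma> \<rho>) ` S = orbit_of S act \<rho>"
    unfolding orbit_of_def by (rule Setcompr_eq_image[symmetric])
  finally show ?thesis by (simp only: orbit_R0[OF \<rho>])
qed

text \<open>
  If no element of the orbit of \<open>\<rho>\<close> has the character of \<open>\<tau>\<close>, some function \<open>w\<close> on \<open>X\<close> vanishes at
  the character of \<open>\<tau>\<close> but nowhere on the finite orbit of that of \<open>\<rho>\<close>. The product of the translates
  of \<open>w\<close> is an invariant that distinguishes the images of \<open>\<rho>\<close> and \<open>\<tau>\<close> downstairs.
\<close>

lemma separation:
  assumes \<rho>: "\<rho> \<in> R0" and \<tau>: "\<tau> \<in> R0" and eq: "\<pi>' (proj \<rho>) = \<pi>' (proj \<tau>)"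
  shows "\<exists>\<sigma>\<in>S. \<pi> (act \<sigma> \<rho>) = \<pi> \<tau>"
proof (rule ccontr)
  assume no: "\<not> (\<exists>\<sigma>\<in>S. \<pi> (act \<sigma> \<rho>) = \<pi> \<tau>)"
  interpret X: function_algebra "pts X" "reg X" by (rule affine_algebraic_set_algebra[OF affine_X])
  interpret R: function_algebra "pts R" "reg R" by (rule algebra_R)
  have hom: "\<rho> \<in> Homs \<Gamma> G" "\<tau> \<in> Homs \<Gamma> G" using \<rho> \<tau> R0_subset by blast+
  let ?I = "{w \<in> reg X. w (\<pi> \<tau>) = 0}"
  have "\<exists>w\<in>?I. \<forall>x\<in>(\<lambda>\<sigma>. \<pi> (act \<sigma> \<rho>)) ` S. w x \<noteq> 0"
  proof (rule common_nonvanishing)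
    show "(\<lambda>x. f x + c * g x) \<in> ?I" if "f \<in> ?I" "g \<in> ?I" for f g c
      using that by (auto intro: X.add X.scale)
    fix x assume "x \<in> (\<lambda>\<sigma>. \<pi> (act \<sigma> \<rho>)) ` S"
    then obtain \<sigma> where \<sigma>: "\<sigma> \<in> S" "x = \<pi> (act \<sigma> \<rho>)" by blast
    then have "x \<in> pts X" "x \<noteq> \<pi> \<tau>" using no \<pi>_pts mult_rep_Homs[OF S_Homs hom(1)] by auto
    then obtain f where f: "f \<in> reg X" "f x \<noteq> f (\<pi> \<tau>)"
      using affine_algebraic_set_separated[OF affine_X _ \<pi>_pts[OF hom(2)]] by blast
    have "(\<lambda>y. f y - f (\<pi> \<tau>)) \<in> reg X" by (intro X.diff f(1) X.const)
    then show "\<exists>f\<in>?I. f x \<noteq> 0" using f(2) by (intro bexI[of _ "\<lambda>y. f y - f (\<pi> \<tau>)"]) auto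
  qed (use finite_S in \<open>auto intro: X.const\<close>)
  then obtain w where w: "w \<in> reg X" "w (\<pi> \<tau>) = 0" "\<And>\<sigma>. \<sigma> \<in> S \<Longrightarrow> w (\<pi> (act \<sigma> \<rho>)) \<noteq> 0" by auto
  define F where "F \<theta> = (\<Prod>\<sigma>\<in>S. w (\<pi> (act \<sigma> \<theta>)))" for \<theta>
  have F_reg: "F \<in> reg R"
    unfolding F_def[abs_def]
    by (intro R.prod morphismD[OF morphism_compose[OF morphism_act morphism_\<pi>] w(1)] S_Homs)
  have F_conj: "F (conj_rep \<Gamma> G g \<theta>) = F \<theta>" if "g \<in> carrier G" "\<theta> \<in> R0" for g \<theta>
    unfolding F_def
  proof (rule prod.cong[OF refl])
    fix \<sigma> assume "\<sigma> \<in> S"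
    note s = S_Homs[OF this]
    have "\<theta> \<in> Homs \<Gamma> G" using that(2) R0_subset by blast
    then show "w (\<pi> (act \<sigma> (conj_rep \<Gamma> G g \<theta>))) = w (\<pi> (act \<sigma> \<theta>))"
      using act_conj[OF s that(1)] \<pi>_conj[OF that(1) mult_rep_Homs[OF s]] by simp
  qed
  have F_fibre: "F \<theta> = F \<theta>'" if t: "\<theta> \<in> R0" "\<theta>' \<in> R0" "proj \<theta> = proj \<theta>'" for \<theta> \<theta>'
  proof -
    obtain \<sigma>' where \<sigma>': "\<sigma>' \<in> S" "\<theta>' = act \<sigma>' \<theta>" using fibre[OF t(1,2)] t(3) by blast
    have "F \<theta>' = (\<Prod>\<sigma>\<in>S. w (\<pi> (act (act \<sigma> \<sigma>') \<theta>)))"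
      unfolding F_def \<sigma>'(2)
      by (intro prod.cong refl) (use act_act[OF _ \<sigma>'(1)] t(1) R0_subset in auto)
    also have "\<dots> = F \<theta>"
      unfolding F_def by (rule prod.reindex_bij_betw[OF translation_S[OF \<sigma>'(1)]])
    finally show ?thesis by simp
  qed
  have "\<exists>v\<in>reg X'. \<forall>\<theta>\<in>R0. v (\<pi>' (proj \<theta>)) = F \<theta>"
    using F_reg F_conj F_fibre by (rule invariant_descent)
  then obtain v where v: "\<forall>\<theta>\<in>R0. v (\<pi>' (proj \<theta>)) = F \<theta>" by (rule bexE)
  have "F \<rho> = F \<tau>" using v[THEN bspec, OF \<rho>] v[THEN bspec, OF \<tau>] eq by simp
  moreover have "F \<rho> \<noteq> 0" unfolding F_def using w(3) finite_S by simp
  moreover have "F \<tau> = 0" unfolding F_def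
    by (rule prod_zero[OF finite_S])
      (use trivial_S act_trivial[OF hom(2)] w(2) in \<open>auto intro!: bexI[of _ "trivial_rep \<Gamma> G"]\<close>)
  ultimately show False by simp
qed

text \<open>
  The map \<open>\<psi>0\<close> on the points of the character variety induced by the projection, before passing to
  orbits. By \<open>\<pi>'_proj_determined\<close> the chosen representation does not affect its value.
\<close>

definition "\<psi>0 x = \<pi>' (proj (SOME \<rho>. \<rho> \<in> R0 \<and> \<pi> \<rho> = x))"

definition "\<psi> U = \<psi>0 (SOME x. x \<in> U)"

lemma \<psi>0:
  assumes \<rho>: "\<rho> \<in> R0"
  shows "\<psi>0 (\<pi> \<rho>) = \<pi>' (proj \<rho>)"
proof -
  let ?\<tau> = "SOME \<tau>. \<tau> \<in> R0 \<and> \<pi> \<tau> = \<pi> \<rho>"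
  have "?\<tau> \<in> R0 \<and> \<pi> ?\<tau> = \<pi> \<rho>" by (rule someI[of _ \<rho>]) (use \<rho> in simp)
  then show ?thesis unfolding \<psi>0_def by (intro \<pi>'_proj_determined) (use \<rho> R0_subset in auto)
qed

lemma \<psi>:
  assumes \<rho>: "\<rho> \<in> R0"
  shows "\<psi> (orbit_of S act_X (\<pi> \<rho>)) = \<pi>' (proj \<rho>)"
proof -
  let ?U = "orbit_of S act_X (\<pi> \<rho>)"
  have "\<pi> \<rho> \<in> ?U" using \<rho> by (auto simp: orbit_X)
  then have "(SOME x. x \<in> ?U) \<in> ?U" by (rule someI[of "\<lambda>x. x \<in> ?U"])
  then obtain \<tau> where "\<tau> \<in> R0" "proj \<tau> = proj \<rho>" "(SOME x. x \<in> ?U) = \<pi> \<tau>" by (auto simp: orbit_X[OF \<rho>])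
  then show ?thesis by (simp add: \<psi>_def \<psi>0)
qed

text \<open>
  Injectivity is the separation lemma. Regular functions correspond because on both sides they are the
  invariant regular functions on representations.
\<close>

theorem character_isomorphism:
  "isomorphism (orbit_space S act_X (character_variety0 \<Gamma> \<gamma>s G A X \<pi>))
     (character_variety0 \<Gamma> \<gamma>s GH AH X' \<pi>') \<psi>"
  unfolding orbit_space_def character_variety0_def
proof (rule isomorphism_quotient[where p = \<psi>0], unfold pts_subspace)
  show "function_algebra (\<pi> ` R0) (reg (subspace_of X (\<pi> ` R0)))"
    using fspace_algebra_subspace[OF affine_algebraic_set_algebra[OF affine_X], of "\<pi> ` R0"] by simp
  show "\<psi> (orbit_of S act_X x) = \<psi>0 x" if "x \<in> \<pi> ` R0" for x using that \<psi> \<psi>0 by auto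
  show "\<psi>0 ` \<pi> ` R0 = \<pi>' ` R0'" unfolding proj_R0[symmetric] image_image by (intro image_cong refl \<psi>0)
  show "orbit_of S act_X x = orbit_of S act_X y" if xy: "x \<in> \<pi> ` R0" "y \<in> \<pi> ` R0" "\<psi>0 x = \<psi>0 y" for x y
  proof -
    obtain \<rho> \<tau> where \<rho>: "\<rho> \<in> R0" "x = \<pi> \<rho>" and \<tau>: "\<tau> \<in> R0" "y = \<pi> \<tau>" using xy(1,2) by blast
    then have "\<pi>' (proj \<rho>) = \<pi>' (proj \<tau>)" using xy(3) \<psi>0 by simp
    then obtain \<sigma> where \<sigma>: "\<sigma> \<in> S" "\<pi> (act \<sigma> \<rho>) = \<pi> \<tau>" using separation[OF \<rho>(1) \<tau>(1)] by blast
    have "act \<sigma> \<rho> \<in> R0" using S_R0[OF \<sigma>(1) \<rho>(1)] .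
    moreover have "proj (act \<sigma> \<rho>) = proj \<rho>" using proj_mult_rep[OF S_Homs[OF \<sigma>(1)]] \<rho>(1) R0_subset by blast
    ultimately show ?thesis using orbit_X[of "act \<sigma> \<rho>"] orbit_X[OF \<rho>(1)] \<sigma>(2) \<rho>(2) \<tau>(2) by simp
  qed
  fix u
  show "u \<in> reg (subspace_of X' (\<pi>' ` R0')) \<longleftrightarrow> (\<lambda>x. u (\<psi>0 x)) \<in> reg (subspace_of X (\<pi> ` R0))"
  proof
    assume "u \<in> reg (subspace_of X' (\<pi>' ` R0'))"
    from reg_subspaceD[OF this]
    obtain v where v: "v \<in> reg X'" "\<forall>x\<in>\<pi>' ` R0'. u x = v x" by (rule bexE)
    have "v (\<pi>' (proj (conj_rep \<Gamma> G g \<rho>))) = v (\<pi>' (proj \<rho>))" if "g \<in> carrier G" "\<rho> \<in> Homs \<Gamma> G" for g \<rho>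
      using \<pi>'_proj_determined[OF conj_Homs[OF is_group that] that(2) \<pi>_conj[OF that]] by simp
    from invariant_factors[OF morphismD[OF morphism_compose[OF morphism_proj morphism_\<pi>'] v(1)] this]
    obtain w where w: "w \<in> reg X" "\<forall>\<rho>\<in>Homs \<Gamma> G. w (\<pi> \<rho>) = v (\<pi>' (proj \<rho>))" by blast
    have "u (\<psi>0 x) = w x" if x: "x \<in> \<pi> ` R0" for x
    proof -
      obtain \<rho> where \<rho>: "\<rho> \<in> R0" "x = \<pi> \<rho>" using x by blast
      have "u (\<pi>' (proj \<rho>)) = v (\<pi>' (proj \<rho>))"
        by (intro v(2)[THEN bspec] imageI) (use \<rho>(1) proj_R0 in blast)
      then show ?thesis using w(2) \<rho> R0_subset \<psi>0[OF \<rho>(1)] by auto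
    qed
    with w(1) show "(\<lambda>x. u (\<psi>0 x)) \<in> reg (subspace_of X (\<pi> ` R0))" by (rule reg_subspaceI)
  next
    assume "(\<lambda>x. u (\<psi>0 x)) \<in> reg (subspace_of X (\<pi> ` R0))"
    from reg_subspaceD[OF this]
    obtain w where w0: "w \<in> reg X" "\<forall>x\<in>\<pi> ` R0. u (\<psi>0 x) = w x" by (rule bexE)
    have w: "u (\<pi>' (proj \<rho>)) = w (\<pi> \<rho>)" if "\<rho> \<in> R0" for \<rho>
      using w0(2)[THEN bspec, OF imageI[OF that]] \<psi>0[OF that] by simp
    have "\<exists>v\<in>reg X'. \<forall>\<rho>\<in>R0. v (\<pi>' (proj \<rho>)) = w (\<pi> \<rho>)"
    proof (rule invariant_descent[OF morphismD[OF morphism_\<pi> w0(1)]])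
      show "w (\<pi> (conj_rep \<Gamma> G g \<rho>)) = w (\<pi> \<rho>)" if "g \<in> carrier G" "\<rho> \<in> R0" for g \<rho>
        using \<pi>_conj that R0_subset by auto
      show "w (\<pi> \<rho>) = w (\<pi> \<tau>)" if "\<rho> \<in> R0" "\<tau> \<in> R0" "proj \<rho> = proj \<tau>" for \<rho> \<tau>
        using w[OF that(1)] w[OF that(2)] that(3) by simp
    qed
    then obtain v where v: "v \<in> reg X'" "\<forall>\<rho>\<in>R0. v (\<pi>' (proj \<rho>)) = w (\<pi> \<rho>)" by (rule bexE)
    from v(1) show "u \<in> reg (subspace_of X' (\<pi>' ` R0'))"
    proof (rule reg_subspaceI)
      fix x assume "x \<in> \<pi>' ` R0'"
      then obtain \<rho> where "\<rho> \<in> R0" "x = \<pi>' (proj \<rho>)" unfolding proj_R0[symmetric] by blast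
      then show "u x = v x" using w v(2) by simp
    qed
  qed
qed

end

theorem proposition5:
  fixes G :: "'g monoid" and A :: "'g fspace" and H :: "'g set"
    and \<Gamma> :: "'c monoid" and \<gamma>s :: "'c list"
  assumes "affine_algebraic_group G A" and "reductive G A"
    and "subgroup H G" and "finite H"
    and "\<forall>h\<in>H. \<forall>g\<in>carrier G. h \<otimes>\<^bsub>G\<^esub> g = g \<otimes>\<^bsub>G\<^esub> h"
    and "group \<Gamma>" and "set \<gamma>s \<subseteq> carrier \<Gamma>" and "generate \<Gamma> (set \<gamma>s) = carrier \<Gamma>"
  defines "R0 \<equiv> rep_space0 \<Gamma> \<gamma>s G A"
    and "R0' \<equiv> rep_space0 \<Gamma> \<gamma>s (G Mod H) (coset_space G A H)"
    and "S \<equiv> Homs' \<Gamma> \<gamma>s G A H"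
    and "act \<equiv> mult_rep \<Gamma> G"
  shows "\<exists>\<phi>. isomorphism (orbit_space S act R0) R0' \<phi> \<and>
           (\<forall>\<rho>\<in>pts R0. \<phi> (orbit_of S act \<rho>) = proj_rep \<Gamma> G H \<rho>) \<and>
           (\<forall>(X :: 'x fspace) \<pi> (X' :: 'y fspace) \<pi>'.
              is_character_variety \<Gamma> \<gamma>s G A X \<pi> \<and>
              is_character_variety \<Gamma> \<gamma>s (G Mod H) (coset_space G A H) X' \<pi>' \<longrightarrow>
              (let act_X = descended_action (pts R0) \<pi> act
               in \<exists>\<psi>. isomorphism
                        (orbit_space S act_X (character_variety0 \<Gamma> \<gamma>s G A X \<pi>))
                        (character_variety0 \<Gamma> \<gamma>s (G Mod H) (coset_space G A H) X' \<pi>') \<psi> \<and>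
                      (\<forall>\<rho>\<in>pts R0. \<psi> (orbit_of S act_X (\<pi> \<rho>)) = \<pi>' (\<phi> (orbit_of S act \<rho>)))))"
proof -
  interpret representation_quotient G H A \<Gamma> \<gamma>s
  proof (intro representation_quotient.intro central_quotient.intro central_quotient_axioms.intro
      generated_group.intro generated_group_axioms.intro assms)
    show "group G" using assms(1) by (simp add: affine_algebraic_group_def)
    show "h \<otimes>\<^bsub>G\<^esub> g = g \<otimes>\<^bsub>G\<^esub> h" if "h \<in> H" "g \<in> carrier G" for h g
      by (rule assms(5)[THEN bspec, OF that(1), THEN bspec, OF that(2)])
  qed
  show ?thesis
    unfolding R0_def R0'_def S_def act_def Let_def
  proof (intro exI[of _ \<phi>] conjI ballI allI impI)
    show "isomorphism (orbit_space (Homs' \<Gamma> \<gamma>s G A H) (mult_rep \<Gamma> G) (rep_space0 \<Gamma> \<gamma>s G A))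
        (rep_space0 \<Gamma> \<gamma>s (G Mod H) (coset_space G A H)) \<phi>"
      by (rule representation_isomorphism)
    show "\<phi> (orbit_of (Homs' \<Gamma> \<gamma>s G A H) (mult_rep \<Gamma> G) \<rho>) = proj_rep \<Gamma> G H \<rho>"
      if "\<rho> \<in> pts (rep_space0 \<Gamma> \<gamma>s G A)" for \<rho>
      using that by (rule \<phi>_orbit)
    fix X :: "'x fspace" and \<pi> and X' :: "'y fspace" and \<pi>'
    assume "is_character_variety \<Gamma> \<gamma>s G A X \<pi> \<and>
      is_character_variety \<Gamma> \<gamma>s (G Mod H) (coset_space G A H) X' \<pi>'"
    then interpret character_quotient G H A \<Gamma> \<gamma>s X \<pi> X' \<pi>'
      by unfold_locales simp_all
    show "\<exists>\<psi>. isomorphism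
        (orbit_space (Homs' \<Gamma> \<gamma>s G A H) (descended_action (pts (rep_space0 \<Gamma> \<gamma>s G A)) \<pi> (mult_rep \<Gamma> G))
          (character_variety0 \<Gamma> \<gamma>s G A X \<pi>))
        (character_variety0 \<Gamma> \<gamma>s (G Mod H) (coset_space G A H) X' \<pi>') \<psi> \<and>
      (\<forall>\<rho>\<in>pts (rep_space0 \<Gamma> \<gamma>s G A).
        \<psi> (orbit_of (Homs' \<Gamma> \<gamma>s G A H)
          (descended_action (pts (rep_space0 \<Gamma> \<gamma>s G A)) \<pi> (mult_rep \<Gamma> G)) (\<pi> \<rho>)) =
        \<pi>' (\<phi> (orbit_of (Homs' \<Gamma> \<gamma>s G A H) (mult_rep \<Gamma> G) \<rho>)))"
      using character_isomorphism \<psi> \<phi>_orbit by (intro exI[of _ \<psi>]) simp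
  qed
qed

end
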